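(* Let $-\infty<a<b<\infty$, let $V\in L^1((a,b);dx)$ be real-valued a.e. on $(a,b)$, and let $x_0\in(a,b)$. Let $H^D$ and $H^D_{x_0}$ be the Dirichlet Schrödinger operators with potential $V$ on $(a,b)$ and on $(a,x_0)\cup(x_0,b)$, respectively, and let $H_0^D$ and $H^D_{0,x_0}$ be the corresponding operators with $V=0$ (all defined in the context, together with the labeling of their eigenvalues). Let $e_k$, $k\in\mathbb{N}$, be the normalized real-valued eigenfunction of $H^D$ corresponding to the eigenvalue $\lambda_k(H^D)$. Then for every $k\in\mathbb{N}$, $$ e_k(x_0)^2=\frac{(x_0-a)(b-x_0)}{b-a}\,\lambda_k(H_0^D)\,\frac{\prod_{j\in\mathbb{N}}\Big(\frac{\lambda_j(H^D_{x_0})-\lambda_k(H^D)}{\lambda_j(H^D_{0,x_0})}\Big)}{\prod_{m\in\mathbb{N}\setminus\{k\}}\Big(\frac{\lambda_m(H^D)-\lambda_k(H^D)}{\lambda_m(H_0^D)}\Big)}. $$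
   Context: $\mathbb{N}=\{1,2,3,\dots\}$; $AC(I)$ denotes the absolutely continuous functions on a compact interval $I$. $H^D$ is the self-adjoint operator in $L^2((a,b);dx)$ given by $H^Df=-f''+Vf$ with domain $$\{f\in L^2((a,b);dx)\,|\, f,f'\in AC([a,b]);\ f(a)=f(b)=0;\ -f''+Vf\in L^2((a,b);dx)\}.$$ $H^D_{x_0}$ is the self-adjoint operator in $L^2((a,b);dx)\simeq L^2((a,x_0);dx)\oplus L^2((x_0,b);dx)$ which is the direct sum of the two Dirichlet Schrödinger operators on $(a,x_0)$ and on $(x_0,b)$. That is, $H^D_{x_0}f=-f''+Vf$ on $(a,x_0)\cup(x_0,b)$, with domain all $f\in L^2((a,b);dx)$ such that $f\in AC([a,b])$, the restrictions of $f'$ to $(a,x_0)$ and $(x_0,b)$ extend to functions in $AC([a,x_0])$ and $AC([x_0,b])$ respectively, $f(a)=f(x_0)=f(b)=0$, and $-f''+Vf\in L^2((a,b);dx)$. $H_0^D$ and $H^D_{0,x_0}$ are the operators $H^D$ and $H^D_{x_0}$ in the case $V=0$. Labeling of eigenvalues. All four operators have purely discrete spectrum. The eigenvalues of $H^D$ are simple and are labeled in increasing order, $\lambda_1(H^D)<\lambda_2(H^D)<\cdots$; for $V=0$, $\lambda_k(H_0^D)=[k\pi/(b-a)]^2$, $k\in\mathbb{N}$. The eigenvalues of $H^D_{x_0}$ are listed with multiplicity (so a double eigenvalue appears twice), with even labels for the interval $(a,x_0)$ and odd labels for $(x_0,b)$: for $k\in\mathbb{N}$, $\lambda_{2k}(H^D_{x_0})$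 is the $k$-th eigenvalue, in increasing order, of the Dirichlet operator $-d^2/dx^2+V$ on $(a,x_0)$, and $\lambda_{2k-1}(H^D_{x_0})$ is the $k$-th eigenvalue, in increasing order, of the Dirichlet operator $-d^2/dx^2+V$ on $(x_0,b)$. In particular, $\lambda_{2k}(H^D_{0,x_0})=[k\pi/(x_0-a)]^2$ and $\lambda_{2k-1}(H^D_{0,x_0})=[k\pi/(b-x_0)]^2$. $e_k$ denotes the continuous real-valued eigenfunction of $H^D$ for $\lambda_k(H^D)$, normalized by $\int_a^b e_k(x)^2\,dx=1$ (unique up to sign). An infinite product over $\mathbb{N}$ is the limit of its finite partial products (the value $0$ being allowed). *)

theory Defs
  imports "HOL-Analysis.Analysis"
begin

text \<open>
  Elements of \<open>L\<^sup>2((a,b);dx)\<close> are represented by functions \<open>real \<Rightarrow> complex\<close>, of which only the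
  values on the interval under consideration matter.  Potentials are functions \<open>real \<Rightarrow> real\<close>,
  i.e. real-valued representatives of a class in \<open>L\<^sup>1\<close>.
\<close>

definition abs_cont_on :: "real set \<Rightarrow> (real \<Rightarrow> 'a::real_normed_vector) \<Rightarrow> bool"
  where "abs_cont_on S f \<longleftrightarrow>
    (\<forall>\<epsilon>>0. \<exists>\<delta>>0. \<forall>d t. d division_of t \<and> t \<subseteq> S \<and> (\<Sum>K\<in>d. Sup K - Inf K) < \<delta>
       \<longrightarrow> (\<Sum>K\<in>d. norm (f (Sup K) - f (Inf K))) < \<epsilon>)"

definition L2_on :: "real \<Rightarrow> real \<Rightarrow> (real \<Rightarrow> complex) \<Rightarrow> bool"
  where "L2_on a b f \<longleftrightarrow>
    f \<in> borel_measurable (lebesgue_on {a<..<b}) \<and>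
    integrable (lebesgue_on {a<..<b}) (\<lambda>x. (norm (f x))\<^sup>2)"

text \<open>
  One-sided at the end points.  At points of non-differentiability the value is a meaningless
  default; for the second derivative of a function in the operator domain this concerns a null set.
\<close>

definition deriv_on :: "real \<Rightarrow> real \<Rightarrow> (real \<Rightarrow> complex) \<Rightarrow> real \<Rightarrow> complex"
  where "deriv_on a b f x = vector_derivative f (at x within {a..b})"

definition dirichlet_op :: "(real \<Rightarrow> real) \<Rightarrow> real \<Rightarrow> real \<Rightarrow> (real \<Rightarrow> complex) \<Rightarrow> real \<Rightarrow> complex"
  where "dirichlet_op V a b f x = - deriv_on a b (deriv_on a b f) x + of_real (V x) * f x"

definition dirichlet_dom :: "(real \<Rightarrow> real) \<Rightarrow> real \<Rightarrow> real \<Rightarrow> (real \<Rightarrow> complex) set"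
  where "dirichlet_dom V a b = {f.
    L2_on a b f \<and>
    abs_cont_on {a..b} f \<and>
    (\<forall>x\<in>{a..b}. f differentiable (at x within {a..b})) \<and>
    abs_cont_on {a..b} (deriv_on a b f) \<and>
    f a = 0 \<and> f b = 0 \<and>
    L2_on a b (dirichlet_op V a b f)}"

definition dirichlet_eigenfunction ::
    "(real \<Rightarrow> real) \<Rightarrow> real \<Rightarrow> real \<Rightarrow> complex \<Rightarrow> (real \<Rightarrow> complex) \<Rightarrow> bool"
  where "dirichlet_eigenfunction V a b z f \<longleftrightarrow>
    f \<in> dirichlet_dom V a b \<and>
    \<not> (AE x in lebesgue_on {a<..<b}. f x = 0) \<and>
    (AE x in lebesgue_on {a<..<b}. dirichlet_op V a b f x = z * f x)"

text \<open>The operator is self-adjoint, so restricting to real numbers loses no eigenvalues.\<close>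

definition dirichlet_eigenvalues :: "(real \<Rightarrow> real) \<Rightarrow> real \<Rightarrow> real \<Rightarrow> real set"
  where "dirichlet_eigenvalues V a b = {l. \<exists>f. dirichlet_eigenfunction V a b (of_real l) f}"

text \<open>The \<open>k\<close>-th smallest element, counted from \<open>k = 1\<close>; unspecified if there is none.\<close>

definition kth_smallest :: "real set \<Rightarrow> nat \<Rightarrow> real"
  where "kth_smallest S k = (THE l. l \<in> S \<and> finite {m\<in>S. m \<le> l} \<and> card {m\<in>S. m \<le> l} = k)"

definition dirichlet_ev :: "(real \<Rightarrow> real) \<Rightarrow> real \<Rightarrow> real \<Rightarrow> nat \<Rightarrow> real"
  where "dirichlet_ev V a b k = kth_smallest (dirichlet_eigenvalues V a b) k"

definition normalized_eigenfunction ::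
    "(real \<Rightarrow> real) \<Rightarrow> real \<Rightarrow> real \<Rightarrow> nat \<Rightarrow> (real \<Rightarrow> real) \<Rightarrow> bool"
  where "normalized_eigenfunction V a b k e \<longleftrightarrow>
    dirichlet_eigenfunction V a b (of_real (dirichlet_ev V a b k)) (\<lambda>x. of_real (e x)) \<and>
    integral {a..b} (\<lambda>x. (e x)\<^sup>2) = 1"

text \<open>
  The direct sum of the Dirichlet operators on \<open>(a,x0)\<close> and \<open>(x0,b)\<close>.  A single function suffices to
  represent a pair in the direct sum of the domains, because both components vanish at \<open>x0\<close>.
\<close>

definition split_dom :: "(real \<Rightarrow> real) \<Rightarrow> real \<Rightarrow> real \<Rightarrow> real \<Rightarrow> (real \<Rightarrow> complex) set"
  where "split_dom V a x0 b = dirichlet_dom V a x0 \<inter> dirichlet_dom V x0 b"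

definition split_op ::
    "(real \<Rightarrow> real) \<Rightarrow> real \<Rightarrow> real \<Rightarrow> real \<Rightarrow> (real \<Rightarrow> complex) \<Rightarrow> real \<Rightarrow> complex"
  where "split_op V a x0 b f x =
    (if x < x0 then dirichlet_op V a x0 f x else dirichlet_op V x0 b f x)"

definition split_eigenvalues :: "(real \<Rightarrow> real) \<Rightarrow> real \<Rightarrow> real \<Rightarrow> real \<Rightarrow> real set"
  where "split_eigenvalues V a x0 b = {l. \<exists>f \<in> split_dom V a x0 b.
    \<not> (AE x in lebesgue_on {a<..<b}. f x = 0) \<and>
    (AE x in lebesgue_on {a<..<b}. split_op V a x0 b f x = of_real l * f x)}"

text \<open>
  Labeling with multiplicity, from label 1 on: even labels enumerate the eigenvalues of the
  component on \<open>(a,x0)\<close>, odd labels those of the component on \<open>(x0,b)\<close>.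
\<close>

definition split_ev :: "(real \<Rightarrow> real) \<Rightarrow> real \<Rightarrow> real \<Rightarrow> real \<Rightarrow> nat \<Rightarrow> real"
  where "split_ev V a x0 b j =
    (if even j then dirichlet_ev V a x0 (j div 2) else dirichlet_ev V x0 b ((j + 1) div 2))"


text \<open>
  The labeled values are drawn from the correct set: the eigenvalues of the direct sum are those of
  its two components.
\<close>

lemma deriv_on_cong:
  assumes "\<And>x. x \<in> {a..b} \<Longrightarrow> f x = g x" "x \<in> {a..b}"
  shows "deriv_on a b f x = deriv_on a b g x"
proof -
  have "(f has_vector_derivative D) (at x within {a..b}) \<longleftrightarrow>
        (g has_vector_derivative D) (at x within {a..b})" for D
    using assms by (metis has_vector_derivative_transform)
  then show ?thesis
    by (simp add: deriv_on_def vector_derivative_def)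
qed

lemma abs_cont_on_cong:
  assumes "\<And>x. x \<in> {a..b} \<Longrightarrow> f x = g x"
  shows "abs_cont_on {a..b} f \<longleftrightarrow> abs_cont_on {a..b} g"
proof -
  have "(\<Sum>K\<in>d. norm (f (Sup K) - f (Inf K))) = (\<Sum>K\<in>d. norm (g (Sup K) - g (Inf K)))"
    if d: "d division_of t" "t \<subseteq> {a..b}" for d t
  proof (rule sum.cong)
    fix K assume K: "K \<in> d"
    then obtain u v where uv: "K = cbox u v" "cbox u v \<noteq> {}"
      using d(1) by (metis division_ofD(3,4))
    then have "Sup K = v" "Inf K = u" "u \<in> K" "v \<in> K"
      by auto
    moreover have "K \<subseteq> {a..b}"
      using d K division_ofD(2) by blast
    ultimately have "Sup K \<in> {a..b}" "Inf K \<in> {a..b}"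
      by blast+
    then show "norm (f (Sup K) - f (Inf K)) = norm (g (Sup K) - g (Inf K))"
      by (simp only: assms)
  qed simp
  then show ?thesis
    unfolding abs_cont_on_def by (metis (no_types, lifting))
qed

lemma L2_on_cong:
  assumes "\<And>x. x \<in> {a..b} \<Longrightarrow> f x = g x"
  shows "L2_on a b f \<longleftrightarrow> L2_on a b g"
proof -
  have "f \<in> borel_measurable (lebesgue_on {a<..<b}) \<longleftrightarrow>
        g \<in> borel_measurable (lebesgue_on {a<..<b})"
    by (rule measurable_cong) (simp add: assms)
  moreover have "integrable (lebesgue_on {a<..<b}) (\<lambda>x. (norm (f x))\<^sup>2) \<longleftrightarrow>
        integrable (lebesgue_on {a<..<b}) (\<lambda>x. (norm (g x))\<^sup>2)"
    by (rule Bochner_Integration.integrable_cong) (simp_all add: assms)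
  ultimately show ?thesis
    by (simp add: L2_on_def)
qed

lemma dirichlet_op_cong:
  assumes "\<And>x. x \<in> {a..b} \<Longrightarrow> f x = g x" "x \<in> {a..b}"
  shows "dirichlet_op V a b f x = dirichlet_op V a b g x"
  using assms deriv_on_cong[of a b "deriv_on a b f" "deriv_on a b g"] deriv_on_cong[of a b f g]
  by (simp add: dirichlet_op_def)

lemma dirichlet_dom_cong:
  assumes eq: "\<And>x. x \<in> {a..b} \<Longrightarrow> f x = g x" and "a < b"
  shows "f \<in> dirichlet_dom V a b \<longleftrightarrow> g \<in> dirichlet_dom V a b"
proof -
  have "f differentiable (at x within {a..b}) \<longleftrightarrow> g differentiable (at x within {a..b})"
    if "x \<in> {a..b}" for x
    using eq that unfolding differentiable_def
    by (metis has_derivative_transform)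
  moreover have "abs_cont_on {a..b} (deriv_on a b f) \<longleftrightarrow> abs_cont_on {a..b} (deriv_on a b g)"
    by (intro abs_cont_on_cong deriv_on_cong eq)
  moreover have "L2_on a b (dirichlet_op V a b f) \<longleftrightarrow> L2_on a b (dirichlet_op V a b g)"
    by (intro L2_on_cong dirichlet_op_cong eq)
  ultimately show ?thesis
    using L2_on_cong[OF eq] abs_cont_on_cong[OF eq] eq[of a] eq[of b] \<open>a < b\<close>
    by (simp add: dirichlet_dom_def)
qed

lemma zero_in_dirichlet_dom: "(\<lambda>x. 0) \<in> dirichlet_dom V a b" if "a < b"
proof -
  have D: "deriv_on a b (\<lambda>x. 0) x = 0" if "x \<in> {a..b}" for x
    unfolding deriv_on_def using that \<open>a < b\<close>
    by (intro vector_derivative_within_closed_interval) auto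
  have AC: "abs_cont_on {a..b} (\<lambda>x. 0 :: complex)"
    by (auto simp: abs_cont_on_def intro: exI[of _ 1])
  have AC': "abs_cont_on {a..b} (deriv_on a b (\<lambda>x. 0))"
    using AC abs_cont_on_cong[OF D] by simp
  have L: "L2_on a b (\<lambda>x. 0)"
    by (simp add: L2_on_def)
  have "dirichlet_op V a b (\<lambda>x. 0) x = 0" if "x \<in> {a..b}" for x
    using deriv_on_cong[of a b "deriv_on a b (\<lambda>x. 0)" "\<lambda>x. 0" x] D that
    by (simp add: dirichlet_op_def)
  then have "L2_on a b (dirichlet_op V a b (\<lambda>x. 0))"
    using L L2_on_cong[of a b "dirichlet_op V a b (\<lambda>x. 0)" "\<lambda>x. 0"] by simp
  with AC AC' L show ?thesis
    by (simp add: dirichlet_dom_def)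
qed

lemma AE_split:
  assumes "a < x0" "x0 < (b::real)"
  shows "(AE x in lebesgue_on {a<..<b}. P x) \<longleftrightarrow>
    (AE x in lebesgue_on {a<..<x0}. P x) \<and> (AE x in lebesgue_on {x0<..<b}. P x)"
proof -
  have r: "(AE x in lebesgue_on {u<..<v}. P x) \<longleftrightarrow> (AE x in lebesgue. u < x \<and> x < v \<longrightarrow> P x)"
    for u v :: real
    by (simp add: AE_restrict_space_iff)
  have ne: "AE x in lebesgue. x \<noteq> x0"
    by (intro AE_I[where N = "{x0}"]) auto
  show ?thesis
    unfolding r
  proof (intro iffI conjI)
    assume A: "AE x in lebesgue. a < x \<and> x < b \<longrightarrow> P x"
    show "AE x in lebesgue. a < x \<and> x < x0 \<longrightarrow> P x" "AE x in lebesgue. x0 < x \<and> x < b \<longrightarrow> P x"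
      using A assms by (auto elim!: eventually_mono)
  next
    assume A: "(AE x in lebesgue. a < x \<and> x < x0 \<longrightarrow> P x) \<and>
               (AE x in lebesgue. x0 < x \<and> x < b \<longrightarrow> P x)"
    from A[THEN conjunct1] A[THEN conjunct2] ne
    show "AE x in lebesgue. a < x \<and> x < b \<longrightarrow> P x"
      by eventually_elim auto
  qed
qed

lemma AE_lebesgue_on_cong:
  assumes "\<And>x. x \<in> {a<..<b} \<Longrightarrow> P x \<longleftrightarrow> Q x"
  shows "(AE x in lebesgue_on {a<..<b::real}. P x) \<longleftrightarrow> (AE x in lebesgue_on {a<..<b}. Q x)"
  by (rule AE_cong) (use assms in auto)

lemma dirichlet_eigenfunction_cong:
  assumes eq: "\<And>x. x \<in> {a..b} \<Longrightarrow> f x = g x" and "a < b"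
  shows "dirichlet_eigenfunction V a b z f \<longleftrightarrow> dirichlet_eigenfunction V a b z g"
proof -
  have "(AE x in lebesgue_on {a<..<b}. f x = 0) \<longleftrightarrow> (AE x in lebesgue_on {a<..<b}. g x = 0)"
    by (rule AE_lebesgue_on_cong) (simp add: eq)
  moreover have "(AE x in lebesgue_on {a<..<b}. dirichlet_op V a b f x = z * f x) \<longleftrightarrow>
      (AE x in lebesgue_on {a<..<b}. dirichlet_op V a b g x = z * g x)"
    using eq dirichlet_op_cong[of a b f g _ V] by (intro AE_lebesgue_on_cong) auto
  ultimately show ?thesis
    using dirichlet_dom_cong[OF eq \<open>a < b\<close>] by (simp add: dirichlet_eigenfunction_def)
qed

lemma split_eigenvalues_eq:
  assumes x0: "a < x0" "x0 < b"
  shows "split_eigenvalues V a x0 b = dirichlet_eigenvalues V a x0 \<union> dirichlet_eigenvalues V x0 b"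
proof -
  have op: "(AE x in lebesgue_on {a<..<b}. split_op V a x0 b f x = z * f x) \<longleftrightarrow>
     (AE x in lebesgue_on {a<..<x0}. dirichlet_op V a x0 f x = z * f x) \<and>
     (AE x in lebesgue_on {x0<..<b}. dirichlet_op V x0 b f x = z * f x)" for f z
    unfolding AE_split[OF x0]
    by (intro arg_cong2[where f = "(\<and>)"] AE_lebesgue_on_cong) (auto simp: split_op_def)
  have zero: "dirichlet_op V u v (\<lambda>x. 0) x = 0" if "u < v" "x \<in> {u..v}" for u v x
  proof -
    have D: "deriv_on u v (\<lambda>x. 0) y = 0" if "y \<in> {u..v}" for y
      unfolding deriv_on_def using that \<open>u < v\<close>
      by (intro vector_derivative_within_closed_interval) auto
    show ?thesis
      using deriv_on_cong[of u v "deriv_on u v (\<lambda>x. 0)" "\<lambda>x. 0" x] D that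
      by (simp add: dirichlet_op_def)
  qed
  show ?thesis
  proof (intro equalityI subsetI)
    fix l assume "l \<in> split_eigenvalues V a x0 b"
    then obtain f where f: "f \<in> dirichlet_dom V a x0" "f \<in> dirichlet_dom V x0 b"
      "\<not> (AE x in lebesgue_on {a<..<b}. f x = 0)"
      "AE x in lebesgue_on {a<..<b}. split_op V a x0 b f x = of_real l * f x"
      by (auto simp: split_eigenvalues_def split_dom_def)
    then have "dirichlet_eigenfunction V a x0 (of_real l) f \<or>
               dirichlet_eigenfunction V x0 b (of_real l) f"
      unfolding op AE_split[OF x0] dirichlet_eigenfunction_def by blast
    then show "l \<in> dirichlet_eigenvalues V a x0 \<union> dirichlet_eigenvalues V x0 b"
      by (auto simp: dirichlet_eigenvalues_def)
  next
    fix l assume "l \<in> dirichlet_eigenvalues V a x0 \<union> dirichlet_eigenvalues V x0 b"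
    then show "l \<in> split_eigenvalues V a x0 b"
    proof
      assume "l \<in> dirichlet_eigenvalues V a x0"
      then obtain f where f: "dirichlet_eigenfunction V a x0 (of_real l) f"
        by (auto simp: dirichlet_eigenvalues_def)
      define g where "g = (\<lambda>x. if x \<le> x0 then f x else 0)"
      have fx0: "f x0 = 0"
        using f by (simp add: dirichlet_eigenfunction_def dirichlet_dom_def)
      have g: "dirichlet_eigenfunction V a x0 (of_real l) g"
        using f dirichlet_eigenfunction_cong[of a x0 g f] x0 by (auto simp: g_def)
      have g0: "g x = 0" if "x \<in> {x0..b}" for x
        using that fx0 by (cases "x = x0") (auto simp: g_def)
      have "g \<in> dirichlet_dom V x0 b"
        using dirichlet_dom_cong[of x0 b g "\<lambda>x. 0"] g0 x0 zero_in_dirichlet_dom by auto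
      moreover have "AE x in lebesgue_on {x0<..<b}. dirichlet_op V x0 b g x = of_real l * g x"
        using dirichlet_op_cong[of x0 b g "\<lambda>x. 0"] g0 zero[OF x0(2)] by (intro AE_I2) auto
      ultimately show ?thesis
        using g unfolding split_eigenvalues_def split_dom_def op dirichlet_eigenfunction_def
        by (auto simp: AE_split[OF x0])
    next
      assume "l \<in> dirichlet_eigenvalues V x0 b"
      then obtain f where f: "dirichlet_eigenfunction V x0 b (of_real l) f"
        by (auto simp: dirichlet_eigenvalues_def)
      define g where "g = (\<lambda>x. if x0 \<le> x then f x else 0)"
      have fx0: "f x0 = 0"
        using f by (simp add: dirichlet_eigenfunction_def dirichlet_dom_def)
      have g: "dirichlet_eigenfunction V x0 b (of_real l) g"
        using f dirichlet_eigenfunction_cong[of x0 b g f] x0 by (auto simp: g_def)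
      have g0: "g x = 0" if "x \<in> {a..x0}" for x
        using that fx0 by (cases "x = x0") (auto simp: g_def)
      have "g \<in> dirichlet_dom V a x0"
        using dirichlet_dom_cong[of a x0 g "\<lambda>x. 0"] g0 x0 zero_in_dirichlet_dom by auto
      moreover have "AE x in lebesgue_on {a<..<x0}. dirichlet_op V a x0 g x = of_real l * g x"
        using dirichlet_op_cong[of a x0 g "\<lambda>x. 0"] g0 zero[OF x0(1)] by (intro AE_I2) auto
      ultimately show ?thesis
        using g unfolding split_eigenvalues_def split_dom_def op dirichlet_eigenfunction_def
        by (auto simp: AE_split[OF x0])
    qed
  qed
qed

end

(*
  Let phi(x, l) be the solution of -u'' + V u = l u with u(a) = 0, u'(a) = 1.  The eigenvalues of H^D
  are the zeros of the entire function F(l) = phi(b, l), which are real and simple, and comparison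
  with V = 0 gives F(z^2) = sin(z (b-a)) / z + O(exp(|Im z| (b-a)) / |z|^2).  By Rouche's theorem the
  m-th zero stays within a bounded distance of (m pi / (b-a))^2, and the maximum principle on growing
  circles then yields F(l) = (b-a) * prod_m (l_m - l) / l0_m.  The same holds on (a, x0) and (x0, b),
  with F1(l) = phi(x0, l) and, at an eigenvalue l of H^D, F2(l) = - phi(x0, l) theta(b, l), where theta
  is the solution with u(a) = 1, u'(a) = 0.  Since F'(l) = theta(b, l) * int phi^2 there, the
  normalized eigenfunction satisfies e(x0)^2 = phi(x0)^2 / int phi^2 = - F1(l) F2(l) / F'(l).
*)
theory Submission
  imports Defs "HOL-Complex_Analysis.Complex_Analysis"
begin

text \<open>The potential is only integrable and the domains are given by epsilon-delta absolute
  continuity, so classical calculus does not reach the equation. Absolute continuity is therefore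
  first shown to mean being the indefinite integral of an integrable density. After that the
  equation is treated as an integrated first-order system, and pointwise derivatives return only
  where eigenfunctions are matched with zeros of F. The product for F is obtained by comparison with
  the free function, whose product is Euler's for the sine. The circles |l| = ((N + 1/2) pi / L)^2,
  L being the length of the interval, keep the sine away from its zeros, and for large N they
  enclose exactly N zeros of either function. Bounded shifts l_m - l0_m change the product of the
  first N factors on such a circle by a relative error of order N^(-1/2), and dividing out these
  zeros leaves a quotient without poles in the disc. Reality of the zeros and a lower bound for them
  turn counts in a disc into counts on the line; simplicity turns multiplicities into labels. In the
  final formula F2 and F' share the factor theta(b, l), which cancels.\<close>

section \<open>Absolutely continuous functions\<close>

definition clip :: "real \<Rightarrow> real \<Rightarrow> real \<Rightarrow> real"
  where "clip u v t = max u (min v t)"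

definition nonoverlapping :: "real \<Rightarrow> real \<Rightarrow> 'i set \<Rightarrow> ('i \<Rightarrow> real) \<Rightarrow> ('i \<Rightarrow> real) \<Rightarrow> bool"
  where "nonoverlapping a b I u v \<longleftrightarrow> finite I \<and> (\<forall>i\<in>I. a \<le> u i \<and> u i \<le> v i \<and> v i \<le> b) \<and>
    (\<forall>i\<in>I. \<forall>j\<in>I. i \<noteq> j \<longrightarrow> {u i<..<v i} \<inter> {u j<..<v j} = {})"

lemma nonoverlapping_unit: "a \<le> u \<Longrightarrow> u \<le> v \<Longrightarrow> v \<le> b \<Longrightarrow> nonoverlapping a b {()} (\<lambda>_. u) (\<lambda>_. v)"
  by (simp add: nonoverlapping_def)

text \<open>Degenerate members contribute nothing to either sum and are dropped. The remaining
  intervals are pairwise distinct, since equal ones would share their midpoint, so they form a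
  division and both sums can be reindexed.\<close>

lemma abs_cont_on_family:
  fixes f :: "real \<Rightarrow> 'a::real_normed_vector"
  assumes "abs_cont_on {a..b} f" "\<epsilon> > 0"
  shows "\<exists>\<delta>>0. \<forall>(I :: 'i set) u v. nonoverlapping a b I u v \<longrightarrow> (\<Sum>i\<in>I. v i - u i) < \<delta> \<longrightarrow>
    (\<Sum>i\<in>I. norm (f (v i) - f (u i))) < \<epsilon>"
proof -
  obtain \<delta> where \<delta>: "\<delta> > 0" "\<And>d t. d division_of t \<Longrightarrow> t \<subseteq> {a..b} \<Longrightarrow> (\<Sum>K\<in>d. Sup K - Inf K) < \<delta>
       \<Longrightarrow> (\<Sum>K\<in>d. norm (f (Sup K) - f (Inf K))) < \<epsilon>"
    using assms unfolding abs_cont_on_def by metis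
  show ?thesis
  proof (intro exI[of _ \<delta>] conjI allI impI \<delta>(1))
    fix I :: "'i set" and u v
    assume no: "nonoverlapping a b I u v" and less: "(\<Sum>i\<in>I. v i - u i) < \<delta>"
    from no have fin: "finite I" and uv: "\<And>i. i \<in> I \<Longrightarrow> a \<le> u i \<and> u i \<le> v i \<and> v i \<le> b"
      and disj: "\<And>i j. \<lbrakk>i \<in> I; j \<in> I; i \<noteq> j\<rbrakk> \<Longrightarrow> {u i<..<v i} \<inter> {u j<..<v j} = {}"
      by (auto simp: nonoverlapping_def)
    define J where "J = {i\<in>I. u i < v i}"
    define d where "d = (\<lambda>i. {u i..v i}) ` J"
    have inj: "inj_on (\<lambda>i. {u i..v i}) J"
    proof (rule inj_onI)
      fix i j assume ij: "i \<in> J" "j \<in> J" "{u i..v i} = {u j..v j}"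
      then have "u i = u j" "v i = v j" "u i < v i"
        by (auto simp: J_def Icc_eq_Icc)
      then have "(u i + v i) / 2 \<in> {u i<..<v i} \<inter> {u j<..<v j}"
        by auto
      then show "i = j"
        using disj[of i j] ij by (auto simp: J_def)
    qed
    have div: "d division_of \<Union>d"
    proof (rule division_ofI)
      show "finite d" using fin by (simp add: d_def J_def)
    next
      fix K assume "K \<in> d"
      then obtain i where i: "i \<in> J" "K = {u i..v i}" by (auto simp: d_def)
      then show "K \<subseteq> \<Union>d" "K \<noteq> {}" "\<exists>a b. K = cbox a b"
        using \<open>K \<in> d\<close> by (auto simp: J_def)
    next
      fix K L assume "K \<in> d" "L \<in> d" "K \<noteq> L"
      then obtain i j where i: "i \<in> J" "K = {u i..v i}" "j \<in> J" "L = {u j..v j}" "i \<noteq> j"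
        by (auto simp: d_def)
      then show "interior K \<inter> interior L = {}"
        using disj[of i j] by (simp add: J_def)
    qed simp
    have sub: "\<Union>d \<subseteq> {a..b}"
      using uv by (force simp: d_def J_def)
    have zero: "(\<Sum>i\<in>I. g i) = (\<Sum>i\<in>J. g i)" if "\<And>i. i \<in> I \<Longrightarrow> u i = v i \<Longrightarrow> g i = 0"
      for g :: "'i \<Rightarrow> real"
      using fin uv that by (intro sum.mono_neutral_right) (force simp: J_def)+
    have re: "(\<Sum>K\<in>d. g (Sup K) (Inf K)) = (\<Sum>i\<in>J. g (v i) (u i))" for g :: "real \<Rightarrow> real \<Rightarrow> real"
      unfolding d_def sum.reindex[OF inj] by (intro sum.cong) (auto simp: J_def)
    have "(\<Sum>K\<in>d. norm (f (Sup K) - f (Inf K))) < \<epsilon>"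
    proof (rule \<delta>(2)[OF div sub])
      show "(\<Sum>K\<in>d. Sup K - Inf K) < \<delta>"
        using less zero[of "\<lambda>i. v i - u i"] re[of "(-)"] by simp
    qed
    then show "(\<Sum>i\<in>I. norm (f (v i) - f (u i))) < \<epsilon>"
      using zero[of "\<lambda>i. norm (f (v i) - f (u i))"] re[of "\<lambda>x y. norm (f x - f y)"] by simp
  qed
qed

lemma abs_cont_on_imp_uniformly_continuous:
  assumes "abs_cont_on {a..b} f"
  shows "uniformly_continuous_on {a..b} f"
  unfolding uniformly_continuous_on_def
proof (intro allI impI)
  fix e :: real assume "e > 0"
  obtain \<delta> where \<delta>: "\<delta> > 0"
    "\<forall>(I :: unit set) u v. nonoverlapping a b I u v \<longrightarrow> (\<Sum>i\<in>I. v i - u i) < \<delta> \<longrightarrow>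
       (\<Sum>i\<in>I. norm (f (v i) - f (u i))) < e"
    using abs_cont_on_family[OF assms \<open>e > 0\<close>] by blast
  have *: "dist (f y) (f x) < e" if "x \<in> {a..b}" "y \<in> {a..b}" "dist y x < \<delta>" "x \<le> y" for x y
    using \<delta>(2)[rule_format, of "{()}" "\<lambda>_. x" "\<lambda>_. y"] that nonoverlapping_unit[of a x y b] by (simp add: dist_norm)
  show "\<exists>d>0. \<forall>x\<in>{a..b}. \<forall>x'\<in>{a..b}. dist x' x < d \<longrightarrow> dist (f x') (f x) < e"
  proof (intro exI conjI ballI impI)
    fix x x' assume "x \<in> {a..b}" "x' \<in> {a..b}" "dist x' x < \<delta>"
    then show "dist (f x') (f x) < e"
      using *[of x x'] *[of x' x] by (cases "x \<le> x'") (auto simp: dist_commute)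
  qed (rule \<delta>(1))
qed

section \<open>Total variation along dyadic partitions\<close>

context
  fixes h :: "real \<Rightarrow> real" and a b :: real
  assumes ab: "a < b" and ac: "abs_cont_on {a..b} h"
begin

definition dyad :: "nat \<Rightarrow> nat \<Rightarrow> real"
  where "dyad n i = a + (b - a) * (real i / 2 ^ n)"

text \<open>The variation of \<open>h\<close> on [u, v] along the grid of level \<open>n\<close>,
  with \<open>u\<close> and \<open>v\<close> added as partition points: the clipping turns grid
  cells outside [u, v] into single points with increment 0.\<close>

definition dvar :: "nat \<Rightarrow> real \<Rightarrow> real \<Rightarrow> real"
  where "dvar n u v = (\<Sum>i<2^n. \<bar>h (clip u v (dyad n (Suc i))) - h (clip u v (dyad n i))\<bar>)"

lemma dyad_mono: "i \<le> j \<Longrightarrow> dyad n i \<le> dyad n j"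
  using ab by (auto simp: dyad_def intro!: mult_left_mono divide_right_mono)

lemma clip_mono: "s \<le> t \<Longrightarrow> clip u v s \<le> clip u v t"
  by (auto simp: clip_def)

lemma clip_bounds: "u \<le> v \<Longrightarrow> u \<le> clip u v t \<and> clip u v t \<le> v"
  by (auto simp: clip_def)

lemma clip_dyad_0: "a \<le> u \<Longrightarrow> u \<le> v \<Longrightarrow> clip u v (dyad n 0) = u"
  by (auto simp: clip_def dyad_def)

lemma clip_dyad_end: "u \<le> v \<Longrightarrow> v \<le> b \<Longrightarrow> clip u v (dyad n (2^n)) = v"
  by (auto simp: clip_def dyad_def)

lemma dvar_ge:
  assumes "a \<le> u" "u \<le> v" "v \<le> b"
  shows "\<bar>h v - h u\<bar> \<le> dvar n u v"
proof -
  have "h v - h u = (\<Sum>i<2^n. h (clip u v (dyad n (Suc i))) - h (clip u v (dyad n i)))"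
    using assms by (subst sum_lessThan_telescope) (simp add: clip_dyad_0 clip_dyad_end)
  then show ?thesis
    unfolding dvar_def by (metis sum_abs)
qed

text \<open>Up to the constant \<open>h v\<close>, \<open>h\<close> clipped to [u, w] is the sum of
  \<open>h\<close> clipped to [u, v] and to [v, w], so in each cell this is the triangle inequality
  for increments.\<close>

lemma dvar_triangle:
  assumes "u \<le> v" "v \<le> w"
  shows "dvar n u w \<le> dvar n u v + dvar n v w"
proof -
  have *: "h (clip u w t) = h (clip u v t) + h (clip v w t) - h v" for t
    using assms by (cases "t \<le> v") (auto simp: clip_def min_def max_def)
  show ?thesis
    unfolding dvar_def sum.distrib[symmetric]
    by (rule sum_mono) (simp add: *)
qed

lemma dvar_Suc: "dvar n u v \<le> dvar (Suc n) u v"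
proof -
  have d: "dyad (Suc n) (2 * i) = dyad n i" for i
    by (simp add: dyad_def)
  have eq: "(\<Sum>i<2*m. g i) = (\<Sum>i<m. g (2*i) + g (Suc (2*i)))" for g :: "nat \<Rightarrow> real" and m
    by (induction m) auto
  show ?thesis
    unfolding dvar_def power_Suc eq
    using d[of "Suc i" for i] by (intro sum_mono) (simp add: d)
qed

text \<open>Converse to \<open>dvar_triangle\<close> up to \<open>e\<close>. Additivity is exact in
  every cell except the one with \<open>v\<close> in its interior, and there uniform continuity
  makes both pieces small once the mesh is fine.\<close>

lemma dvar_superadditive:
  assumes uvw: "a \<le> u" "u \<le> v" "v \<le> w" "w \<le> b" and "e > 0"
  shows "\<forall>\<^sub>F n in sequentially. dvar n u v + dvar n v w \<le> dvar n u w + e"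
proof -
  obtain \<delta> where \<delta>: "\<delta> > 0" "\<And>x y. x \<in> {a..b} \<Longrightarrow> y \<in> {a..b} \<Longrightarrow> dist y x < \<delta> \<Longrightarrow> dist (h y) (h x) < e/2"
    using abs_cont_on_imp_uniformly_continuous[OF ac] \<open>e > 0\<close> unfolding uniformly_continuous_on_def
    by (metis half_gt_zero)
  have "(\<lambda>n. (b - a) / 2^n) \<longlonglongrightarrow> 0"
    by real_asymp
  then have "\<forall>\<^sub>F n in sequentially. (b - a) / 2^n < \<delta>"
    using \<delta>(1) by (rule order_tendstoD)
  then show ?thesis
  proof eventually_elim
    fix n assume n: "(b - a) / 2^n < \<delta>"
    define T where "T = (\<lambda>u v i. \<bar>h (clip u v (dyad n (Suc i))) - h (clip u v (dyad n i))\<bar>)"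
    define X where "X = {i. i < 2^n \<and> dyad n i < v \<and> v < dyad n (Suc i)}"
    have step: "dyad n (Suc i) - dyad n i < \<delta>" for i
    proof -
      have "dyad n (Suc i) - dyad n i = (b - a) / 2^n"
        by (simp add: dyad_def add_divide_distrib algebra_simps)
      then show ?thesis using n by simp
    qed
    have out: "T u v i + T v w i = T u w i" if "i \<in> {..<2^n} - X" for i
    proof -
      have "v \<le> dyad n i \<or> dyad n (Suc i) \<le> v"
        using that by (auto simp: X_def)
      then show ?thesis
      proof
        assume "v \<le> dyad n i"
        then show ?thesis
          using uvw dyad_mono[of i "Suc i" n] by (simp add: T_def clip_def min_def max_def)
      next
        assume *: "dyad n (Suc i) \<le> v"
        then have "dyad n i \<le> v"
          using dyad_mono[of i "Suc i" n] by simp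
        with * have "clip v w (dyad n i) = v" "clip v w (dyad n (Suc i)) = v"
          "clip u w (dyad n i) = clip u v (dyad n i)" "clip u w (dyad n (Suc i)) = clip u v (dyad n (Suc i))"
          using uvw by (simp_all add: clip_def)
        then show ?thesis by (simp add: T_def)
      qed
    qed
    have close: "dist (h (clip p q (dyad n (Suc i)))) (h (clip p q (dyad n i))) < e/2"
      if "a \<le> p" "p \<le> q" "q \<le> b" for p q i
    proof (rule \<delta>(2))
      show "clip p q (dyad n i) \<in> {a..b}" "clip p q (dyad n (Suc i)) \<in> {a..b}"
        using clip_bounds[OF that(2)] that by (meson atLeastAtMost_iff order_trans)+
      have "\<bar>clip p q (dyad n (Suc i)) - clip p q (dyad n i)\<bar> \<le> dyad n (Suc i) - dyad n i"
        using dyad_mono[of i "Suc i" n] by (auto simp: clip_def)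
      then show "dist (clip p q (dyad n (Suc i))) (clip p q (dyad n i)) < \<delta>"
        using step[of i] by (simp add: dist_norm)
    qed
    have inX: "T u v i + T v w i \<le> T u w i + e" for i
    proof -
      have "T u v i < e/2" "T v w i < e/2" "T u w i \<ge> 0"
        using close[of u v i] close[of v w i] uvw by (auto simp: T_def dist_norm)
      then show ?thesis by linarith
    qed
    have X1: "i = j" if "i \<in> X" "j \<in> X" for i j
    proof (rule ccontr)
      assume "i \<noteq> j"
      then have "Suc i \<le> j \<or> Suc j \<le> i" by auto
      then have "dyad n (Suc i) \<le> dyad n j \<or> dyad n (Suc j) \<le> dyad n i"
        using dyad_mono by blast
      then show False using that by (auto simp: X_def)
    qed
    have Xsub: "X \<subseteq> {..<2^n}" by (auto simp: X_def)
    have "(\<Sum>i<2^n. T u v i + T v w i) = (\<Sum>i\<in>{..<2^n}-X. T u v i + T v w i) + (\<Sum>i\<in>X. T u v i + T v w i)"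
      using Xsub by (simp add: sum.subset_diff)
    also have "\<dots> \<le> (\<Sum>i\<in>{..<2^n}-X. T u w i) + ((\<Sum>i\<in>X. T u w i) + e)"
    proof (rule add_mono)
      show "(\<Sum>i\<in>X. T u v i + T v w i) \<le> (\<Sum>i\<in>X. T u w i) + e"
      proof (cases "X = {}")
        case False
        then obtain i where "X = {i}" using X1 by blast
        then show ?thesis using inX[of i] by simp
      qed (use \<open>e > 0\<close> in simp)
    qed (use out in simp)
    also have "\<dots> = (\<Sum>i<2^n. T u w i) + e"
      using Xsub sum.subset_diff[of X "{..<2^n}" "T u w"] by simp
    finally show "dvar n u v + dvar n v w \<le> dvar n u w + e"
      by (simp add: dvar_def T_def sum.distrib)
  qed
qed

text \<open>The dyadic pieces of all members again form a nonoverlapping family of the same total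
  length, so one \<delta> from the absolute continuity of \<open>h\<close> serves all levels
  \<open>n\<close>.\<close>

lemma dvar_family:
  assumes "e > 0"
  shows "\<exists>\<delta>>0. \<forall>n (J :: 'j set) u v. nonoverlapping a b J u v \<longrightarrow> (\<Sum>i\<in>J. v i - u i) < \<delta> \<longrightarrow>
    (\<Sum>j\<in>J. dvar n (u j) (v j)) < e"
proof -
  obtain \<delta> where \<delta>: "\<delta> > 0"
    "\<forall>(I :: ('j \<times> nat) set) u v. nonoverlapping a b I u v \<longrightarrow> (\<Sum>i\<in>I. v i - u i) < \<delta> \<longrightarrow>
       (\<Sum>i\<in>I. norm (h (v i) - h (u i))) < e"
    using abs_cont_on_family[OF ac assms] by blast
  show ?thesis
  proof (intro exI[of _ \<delta>] conjI allI impI \<delta>(1))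
    fix n and J :: "'j set" and u v
    assume no: "nonoverlapping a b J u v" and less: "(\<Sum>i\<in>J. v i - u i) < \<delta>"
    from no have fin: "finite J" and uv: "\<And>i. i \<in> J \<Longrightarrow> a \<le> u i \<and> u i \<le> v i \<and> v i \<le> b"
      and disj: "\<And>i j. \<lbrakk>i \<in> J; j \<in> J; i \<noteq> j\<rbrakk> \<Longrightarrow> {u i<..<v i} \<inter> {u j<..<v j} = {}"
      by (auto simp: nonoverlapping_def)
    define U where "U = (\<lambda>p. clip (u (fst p)) (v (fst p)) (dyad n (snd p)))"
    define W where "W = (\<lambda>p. clip (u (fst p)) (v (fst p)) (dyad n (Suc (snd p))))"
    have le: "a \<le> U p \<and> U p \<le> W p \<and> W p \<le> b" if p: "p \<in> J \<times> {..<2^n}" for p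
    proof -
      have "u (fst p) \<le> v (fst p)" "a \<le> u (fst p)" "v (fst p) \<le> b"
        using uv p by auto
      moreover have "U p \<le> W p"
        unfolding U_def W_def by (intro clip_mono dyad_mono) simp
      ultimately show ?thesis
        using clip_bounds[of "u (fst p)" "v (fst p)" "dyad n (snd p)"]
          clip_bounds[of "u (fst p)" "v (fst p)" "dyad n (Suc (snd p))"] unfolding U_def W_def
        by linarith
    qed
    have sub: "{U r<..<W r} \<subseteq> {u (fst r)<..<v (fst r)}" if "r \<in> J \<times> {..<2^n}" for r
    proof -
      have "u (fst r) \<le> v (fst r)"
        using uv that by auto
      then show ?thesis
        using clip_bounds[of "u (fst r)" "v (fst r)" "dyad n (snd r)"]
          clip_bounds[of "u (fst r)" "v (fst r)" "dyad n (Suc (snd r))"] unfolding U_def W_def by force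
    qed
    have "{U p<..<W p} \<inter> {U q<..<W q} = {}"
      if p: "p \<in> J \<times> {..<2^n}" and q: "q \<in> J \<times> {..<2^n}" and "p \<noteq> q" for p q
    proof (cases "fst p = fst q")
      case True
      then have "snd p < snd q \<or> snd q < snd p"
        using \<open>p \<noteq> q\<close> by (metis linorder_neqE prod_eqI)
      then have "W p \<le> U q \<or> W q \<le> U p"
        using True by (auto simp: U_def W_def intro!: clip_mono dyad_mono)
      then show ?thesis by auto
    next
      case False
      then have "{u (fst p)<..<v (fst p)} \<inter> {u (fst q)<..<v (fst q)} = {}"
        using disj[of "fst p" "fst q"] p q by (simp add: mem_Times_iff)
      then show ?thesis
        using sub[OF p] sub[OF q] by blast
    qed
    with le have no2: "nonoverlapping a b (J \<times> {..<2^n}) U W"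
      using fin by (simp add: nonoverlapping_def)
    have "(\<Sum>p\<in>J \<times> {..<2^n}. W p - U p) = (\<Sum>j\<in>J. \<Sum>i<2^n. clip (u j) (v j) (dyad n (Suc i)) - clip (u j) (v j) (dyad n i))"
      by (simp add: sum.cartesian_product U_def W_def case_prod_beta)
    also have "\<dots> = (\<Sum>j\<in>J. v j - u j)"
    proof (rule sum.cong[OF refl])
      fix j assume "j \<in> J"
      then show "(\<Sum>i<2^n. clip (u j) (v j) (dyad n (Suc i)) - clip (u j) (v j) (dyad n i)) = v j - u j"
        using uv[of j] sum_lessThan_telescope[of "\<lambda>i. clip (u j) (v j) (dyad n i)" "2^n"]
        by (simp add: clip_dyad_0 clip_dyad_end)
    qed
    finally have "(\<Sum>p\<in>J \<times> {..<2^n}. W p - U p) < \<delta>"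
      using less by simp
    with \<delta>(2)[rule_format, OF no2] have "(\<Sum>p\<in>J \<times> {..<2^n}. norm (h (W p) - h (U p))) < e"
      by simp
    then show "(\<Sum>j\<in>J. dvar n (u j) (v j)) < e"
      by (simp add: dvar_def sum.cartesian_product U_def W_def case_prod_beta)
  qed
qed

lemma dvar_nonneg: "dvar n u v \<ge> 0"
  by (simp add: dvar_def sum_nonneg)

text \<open>Absolute continuity implies bounded variation: a step of length \<delta>/2 adds at most
  1 at every level, and finitely many steps reach \<open>b\<close>.\<close>

lemma dvar_bounded: "\<exists>B. \<forall>n. \<forall>x\<in>{a..b}. dvar n a x \<le> B"
proof -
  obtain \<delta> where \<delta>: "\<delta> > 0"
    "\<forall>n (J :: unit set) u v. nonoverlapping a b J u v \<longrightarrow> (\<Sum>i\<in>J. v i - u i) < \<delta> \<longrightarrow>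
      (\<Sum>j\<in>J. dvar n (u j) (v j)) < 1"
    using dvar_family[OF zero_less_one] by blast
  have one: "dvar n u v < 1" if "a \<le> u" "u \<le> v" "v \<le> b" "v - u < \<delta>" for n u v
    using \<delta>(2)[rule_format, of "{()}" "\<lambda>_. u" "\<lambda>_. v" n] that nonoverlapping_unit[of a u v b] by simp
  have *: "dvar n a x \<le> real m" if "x \<in> {a..b}" "x \<le> a + real m * (\<delta>/2)" for n m x
    using that
  proof (induction m arbitrary: x)
    case 0
    then have "x = a" by simp
    then show ?case
      by (simp add: dvar_def clip_def)
  next
    case (Suc m)
    show ?case
    proof (cases "x \<le> a + \<delta>/2")
      case True
      then show ?thesis
        using one[of a x n] Suc.prems \<delta>(1) by auto
    next
      case False
      then have "dvar n a x \<le> dvar n a (x - \<delta>/2) + dvar n (x - \<delta>/2) x"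
        using \<delta>(1) by (intro dvar_triangle) auto
      also have "dvar n a (x - \<delta>/2) \<le> real m"
        using Suc.prems \<delta>(1) False by (intro Suc.IH) (auto simp: field_simps)
      also have "dvar n (x - \<delta>/2) x \<le> 1"
        using one[of "x - \<delta>/2" x n] False Suc.prems \<delta>(1) by auto
      finally show ?thesis by simp
    qed
  qed
  obtain m where "(b - a) / (\<delta>/2) \<le> real m"
    using real_arch_simple by blast
  then have "b \<le> a + real m * (\<delta>/2)"
    using \<delta>(1) by (simp add: field_simps)
  then show ?thesis
    by (intro exI[of _ "real m"]) (auto intro!: *)
qed

text \<open>The total variation.  Dyadic partitions suffice: the sums \<open>dvar n\<close> increase with \<open>n\<close>, and
  the uniform continuity of \<open>h\<close> makes their limit additive in the interval.\<close>

definition tvar :: "real \<Rightarrow> real"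
  where "tvar x = lim (\<lambda>n. dvar n a x)"

lemma dvar_tendsto:
  assumes "x \<in> {a..b}"
  shows "(\<lambda>n. dvar n a x) \<longlonglongrightarrow> tvar x"
proof -
  obtain B where "\<And>n. dvar n a x \<le> B"
    using dvar_bounded assms by blast
  then have "convergent (\<lambda>n. dvar n a x)"
    by (intro Bseq_monoseq_convergent[OF BseqI'[of _ B]])
       (auto simp: dvar_nonneg intro!: incseq_SucI dvar_Suc incseq_imp_monoseq)
  then show ?thesis
    by (simp add: tvar_def convergent_LIMSEQ_iff)
qed

text \<open>\<open>dvar_triangle\<close> and \<open>dvar_superadditive\<close> squeeze the defect of
  additivity to 0.\<close>

lemma dvar_tendsto_diff:
  assumes "a \<le> u" "u \<le> v" "v \<le> b"
  shows "(\<lambda>n. dvar n u v) \<longlonglongrightarrow> tvar v - tvar u"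
proof -
  have "(\<lambda>n. dvar n a u + dvar n u v - dvar n a v) \<longlonglongrightarrow> 0"
  proof (rule tendstoI)
    fix e :: real assume "e > 0"
    then have "\<forall>\<^sub>F n in sequentially. dvar n a u + dvar n u v \<le> dvar n a v + e/2"
      using assms by (intro dvar_superadditive) auto
    then show "\<forall>\<^sub>F n in sequentially. dist (dvar n a u + dvar n u v - dvar n a v) 0 < e"
    proof eventually_elim
      case (elim n)
      then show ?case
        using dvar_triangle[of a u v n] assms \<open>e > 0\<close> by (simp add: dist_norm)
    qed
  qed
  moreover have "(\<lambda>n. dvar n a v - dvar n a u) \<longlonglongrightarrow> tvar v - tvar u"
    using assms by (intro tendsto_diff dvar_tendsto) auto
  ultimately have "(\<lambda>n. (dvar n a u + dvar n u v - dvar n a v) + (dvar n a v - dvar n a u)) \<longlonglongrightarrow> 0 + (tvar v - tvar u)"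
    by (rule tendsto_add)
  then show ?thesis by simp
qed

lemma tvar_ge:
  assumes "a \<le> u" "u \<le> v" "v \<le> b"
  shows "\<bar>h v - h u\<bar> \<le> tvar v - tvar u"
  by (rule tendsto_lowerbound[OF dvar_tendsto_diff[OF assms]])
     (auto intro!: always_eventually dvar_ge assms)

lemma tvar_family:
  assumes "e > 0"
  shows "\<exists>\<delta>>0. \<forall>(J :: 'j set) u v. nonoverlapping a b J u v \<longrightarrow> (\<Sum>i\<in>J. v i - u i) < \<delta> \<longrightarrow>
    (\<Sum>j\<in>J. tvar (v j) - tvar (u j)) \<le> e"
proof -
  obtain \<delta> where \<delta>: "\<delta> > 0"
    "\<forall>n (J :: 'j set) u v. nonoverlapping a b J u v \<longrightarrow> (\<Sum>i\<in>J. v i - u i) < \<delta> \<longrightarrow>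
      (\<Sum>j\<in>J. dvar n (u j) (v j)) < e"
    using dvar_family[OF assms] by blast
  show ?thesis
  proof (intro exI[of _ \<delta>] conjI allI impI \<delta>(1))
    fix J :: "'j set" and u v
    assume *: "nonoverlapping a b J u v" "(\<Sum>i\<in>J. v i - u i) < \<delta>"
    have "(\<lambda>n. \<Sum>j\<in>J. dvar n (u j) (v j)) \<longlonglongrightarrow> (\<Sum>j\<in>J. tvar (v j) - tvar (u j))"
      using *(1) by (intro tendsto_sum dvar_tendsto_diff) (auto simp: nonoverlapping_def)
    moreover have "\<forall>\<^sub>F n in sequentially. (\<Sum>j\<in>J. dvar n (u j) (v j)) \<le> e"
      using \<delta>(2)[rule_format, OF *] by (intro always_eventually allI less_imp_le)
    ultimately show "(\<Sum>j\<in>J. tvar (v j) - tvar (u j)) \<le> e"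
      by (rule tendsto_upperbound) simp
  qed
qed

end

text \<open>The Stieltjes measure of \<open>G\<close> is absolutely continuous with respect to
  Lebesgue measure, and \<open>g\<close> is its Radon-Nikodym density. Smallness passes from finite
  families of intervals to open sets, and by outer regularity to null sets. The index type
  \<open>real set\<close> suits divisions, whose members index themselves.\<close>

lemma increasing_abs_cont_density:
  fixes G :: "real \<Rightarrow> real"
  assumes ab: "a < b" and mono: "\<And>u v. a \<le> u \<Longrightarrow> u \<le> v \<Longrightarrow> v \<le> b \<Longrightarrow> G u \<le> G v"
    and ac: "\<And>e. e > 0 \<Longrightarrow> \<exists>\<delta>>0. \<forall>(J :: real set set) u v. nonoverlapping a b J u v \<longrightarrow>
      (\<Sum>i\<in>J. v i - u i) < \<delta> \<longrightarrow> (\<Sum>j\<in>J. G (v j) - G (u j)) \<le> e"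
  shows "\<exists>g. g absolutely_integrable_on {a..b} \<and> (\<forall>x\<in>{a..b}. G x = G a + integral {a..x} g)"
proof -
  \<comment> \<open>Constant continuation beyond \<open>a\<close> and \<open>b\<close> makes
    \<open>G\<close> a distribution function on the whole line.\<close>
  define E where "E = (\<lambda>x. G (clip a b x))"
  have clipab: "a \<le> clip a b x \<and> clip a b x \<le> b" for x
    using ab by (auto simp: clip_def)
  have cmono: "clip a b x \<le> clip a b y" if "x \<le> y" for x y
    using that by (auto simp: clip_def)
  have clip_diff: "clip a b y - clip a b x \<le> y - x" if "x \<le> y" for x y
    using that by (auto simp: clip_def)
  have Emono: "E x \<le> E y" if "x \<le> y" for x y
    unfolding E_def using clipab cmono[OF that] by (intro mono) auto
  have Econt: "isCont E x" for x
  proof (rule continuous_at_eps_delta[THEN iffD2, rule_format])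
    fix e :: real assume "e > 0"
    then obtain \<delta> where \<delta>: "\<delta> > 0" "\<And>(J :: real set set) u v. nonoverlapping a b J u v \<Longrightarrow>
      (\<Sum>i\<in>J. v i - u i) < \<delta> \<Longrightarrow> (\<Sum>j\<in>J. G (v j) - G (u j)) \<le> e/2"
      using ac[of "e/2"] by auto
    have *: "E y - E x < e" if "x \<le> y" "y - x < \<delta>" for x y
    proof -
      \<comment> \<open>A single interval needs a single index; the empty set is an arbitrary
        inhabitant of the index type.\<close>
      have "nonoverlapping a b {{}::real set} (\<lambda>_. clip a b x) (\<lambda>_. clip a b y)"
        using clipab cmono[OF that(1)] by (simp add: nonoverlapping_def)
      moreover have "clip a b y - clip a b x < \<delta>"
        using that \<delta>(1) by (auto simp: clip_def)
      ultimately show ?thesis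
        using \<delta>(2)[of "{{}::real set}" "\<lambda>_. clip a b x" "\<lambda>_. clip a b y"] \<open>e > 0\<close> by (simp add: E_def)
    qed
    show "\<exists>d>0. \<forall>x'. dist x' x < d \<longrightarrow> dist (E x') (E x) < e"
    proof (intro exI[of _ \<delta>] conjI allI impI \<delta>(1))
      fix y assume "dist y x < \<delta>"
      then show "dist (E y) (E x) < e"
        using *[of x y] *[of y x] Emono[of x y] Emono[of y x]
        by (cases "x \<le> y") (auto simp: dist_real_def)
    qed
  qed
  define M where "M = interval_measure E"
  have M_Icc: "emeasure M {u..v} = ennreal (E v - E u)" if "u \<le> v" for u v
    unfolding M_def using that Emono Econt
    by (intro emeasure_interval_measure_Icc) (auto intro!: continuous_at_imp_continuous_on)
  have M_Ioc: "emeasure M {u<..v} = ennreal (E v - E u)" if "u \<le> v" for u v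
    unfolding M_def using that Emono Econt
    by (intro emeasure_interval_measure_Ioc) (auto intro: continuous_at_imp_continuous_at_within)
  have setsM: "sets M = sets borel"
    by (simp add: M_def)
  \<comment> \<open>An open set is a countable union of boxes. A finite subunion is rewritten as a
    division, to which the hypothesis applies after clipping to [a, b]; continuity from below then
    gives the whole set.\<close>
  have open_small: "\<exists>\<delta>>0. \<forall>U. open U \<longrightarrow> emeasure lborel U < ennreal \<delta> \<longrightarrow> emeasure M U \<le> ennreal e" if e: "e > 0" for e
  proof -
    obtain \<delta> where \<delta>: "\<delta> > 0" "\<And>(J :: real set set) u v. nonoverlapping a b J u v \<Longrightarrow>
      (\<Sum>i\<in>J. v i - u i) < \<delta> \<Longrightarrow> (\<Sum>j\<in>J. G (v j) - G (u j)) \<le> e"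
      using ac[OF e] by blast
    have "emeasure M U \<le> ennreal e" if U: "open U" "emeasure lborel U < ennreal \<delta>" for U
    proof -
      obtain D where D: "countable D" "D \<subseteq> Pow U" "\<And>X. X \<in> D \<Longrightarrow> \<exists>a b. X = cbox a b" "\<Union>D = U"
        using open_countable_Union_open_cbox[OF U(1)] by metis
      have fin: "emeasure M (\<Union>F) \<le> ennreal e" if F: "finite F" "F \<subseteq> D" for F
      proof -
        obtain p where p: "p division_of \<Union>F"
          using elementary_unions_intervals[OF F(1)] D(3) F(2) by (metis subsetD)
        have K: "\<exists>u v. K = {u..v} \<and> u \<le> v" if Kp: "K \<in> p" for K
        proof -
          obtain u v where uv: "K = cbox u v"
            using division_ofD(4)[OF p Kp] by blast
          then show ?thesis
            using division_ofD(3)[OF p Kp] by (intro exI[of _ u] exI[of _ v]) simp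
        qed
        define u where "u = (\<lambda>K. clip a b (Inf K))"
        define v where "v = (\<lambda>K. clip a b (Sup K))"
        have le: "Inf K \<le> Sup K" "K = {Inf K..Sup K}" if "K \<in> p" for K
          using K[OF that] by auto
        have fp: "finite p" by (rule division_ofD(1)[OF p])
        have sub: "{clip a b x<..<clip a b y} \<subseteq> {x<..<y}" for x y
          by (auto simp: clip_def)
        have "nonoverlapping a b p u v"
          unfolding nonoverlapping_def
        proof (intro conjI ballI impI)
          fix K assume "K \<in> p"
          then show "a \<le> u K" "u K \<le> v K" "v K \<le> b"
            using clipab cmono[OF le(1)] by (simp_all add: u_def v_def)
        next
          fix K L assume KL: "K \<in> p" "L \<in> p" "K \<noteq> L"
          have "interior K = {Inf K<..<Sup K}" "interior L = {Inf L<..<Sup L}"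
            by (subst le(2)[OF KL(1)], rule interior_atLeastAtMost_real)
               (subst le(2)[OF KL(2)], rule interior_atLeastAtMost_real)
          then have "{Inf K<..<Sup K} \<inter> {Inf L<..<Sup L} = {}"
            using division_ofD(5)[OF p KL] by simp
          then show "{u K<..<v K} \<inter> {u L<..<v L} = {}"
            using sub unfolding u_def v_def by blast
        qed (rule fp)
        moreover have "(\<Sum>K\<in>p. v K - u K) < \<delta>"
        proof -
          have "(\<Sum>K\<in>p. v K - u K) \<le> (\<Sum>K\<in>p. Sup K - Inf K)"
          proof (rule sum_mono)
            fix K assume "K \<in> p"
            then show "v K - u K \<le> Sup K - Inf K"
              unfolding u_def v_def by (intro clip_diff le(1))
          qed
          also have "\<dots> = (\<Sum>K\<in>p. measure lebesgue K)"
          proof (rule sum.cong[OF refl])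
            fix K assume "K \<in> p"
            then show "Sup K - Inf K = measure lebesgue K"
              by (subst (3) le(2)) (simp_all add: le(1))
          qed
          also have "\<dots> = measure lebesgue (\<Union>F)"
            using content_division[OF p] by simp
          also have "\<dots> < \<delta>"
          proof -
            have "\<Union>F \<subseteq> U" using D F by blast
            have Fb: "\<Union>F \<in> sets borel"
            proof (intro borel_closed compact_imp_closed compact_Union F(1))
              fix X assume "X \<in> F"
              then have "\<exists>a b. X = cbox a b" using D(3) F(2) by blast
              then show "compact X" by (metis compact_cbox)
            qed
            have "emeasure lborel (\<Union>F) \<le> emeasure lborel U"
              using \<open>\<Union>F \<subseteq> U\<close> U(1) by (intro emeasure_mono) auto
            with U(2) have "emeasure lborel (\<Union>F) < ennreal \<delta>" by simp
            then have "measure lborel (\<Union>F) < \<delta>"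
              unfolding measure_def using enn2real_less_iff[of \<delta>] \<delta>(1)
              by (simp add: order_less_le_trans)
            then show ?thesis
              using Fb by (simp add: measure_completion)
          qed
          finally show ?thesis .
        qed
        ultimately have sum: "(\<Sum>K\<in>p. G (v K) - G (u K)) \<le> e"
          by (rule \<delta>(2))
        have "emeasure M (\<Union>F) = emeasure M (\<Union>K\<in>p. K)"
          using p by (simp add: division_ofD(6)[OF p])
        also have "\<dots> \<le> (\<Sum>K\<in>p. emeasure M K)"
        proof (intro emeasure_subadditive_finite fp image_subsetI)
          fix K assume "K \<in> p"
          show "K \<in> sets M"
            by (subst le(2)[OF \<open>K \<in> p\<close>]) (simp add: setsM)
        qed
        also have "\<dots> = (\<Sum>K\<in>p. ennreal (G (v K) - G (u K)))"
        proof (rule sum.cong[OF refl])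
          fix K assume "K \<in> p"
          show "emeasure M K = ennreal (G (v K) - G (u K))"
            by (subst le(2)[OF \<open>K \<in> p\<close>], subst M_Icc[OF le(1)[OF \<open>K \<in> p\<close>]]) (simp add: E_def u_def v_def)
        qed
        also have "\<dots> = ennreal (\<Sum>K\<in>p. G (v K) - G (u K))"
          using clipab cmono[OF le(1)] by (intro sum_ennreal) (simp add: u_def v_def mono)
        also have "\<dots> \<le> ennreal e"
          using sum by (rule ennreal_leI)
        finally show ?thesis .
      qed
      show ?thesis
      proof (cases "D = {}")
        case True
        then show ?thesis using D(4) by simp
      next
        case False
        define A where "A = (\<lambda>n. \<Union>(from_nat_into D ` {..n}))"
        have range: "(\<Union>n. A n) = U"
        proof -
          have "(\<Union>n. A n) = \<Union>(range (from_nat_into D))"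
            unfolding A_def by blast
          then show ?thesis
            using range_from_nat_into[OF False D(1)] D(4) by simp
        qed
        have Aset: "A n \<in> sets M" for n
        proof -
          have "from_nat_into D i \<in> sets borel" for i
            using D(3)[OF from_nat_into[OF False, of i]] by auto
          then show ?thesis unfolding A_def setsM by auto
        qed
        have "(SUP n. emeasure M (A n)) = emeasure M (\<Union>n. A n)"
          using Aset by (intro SUP_emeasure_incseq) (auto simp: incseq_def A_def intro!: Union_mono image_mono)
        moreover have "emeasure M (A n) \<le> ennreal e" for n
          unfolding A_def using from_nat_into[OF False] by (intro fin) auto
        ultimately show ?thesis
          using SUP_least[of UNIV "\<lambda>n. emeasure M (A n)" "ennreal e"] range by simp
      qed
    qed
    then show ?thesis using \<delta>(1) by blast
  qed
  have abs: "absolutely_continuous lborel M"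
    unfolding absolutely_continuous_def
  proof
    fix A :: "real set" assume A: "A \<in> null_sets lborel"
    have small: "emeasure M A \<le> ennreal e" if "e > 0" for e
    proof -
      obtain \<delta> where \<delta>: "\<delta> > 0" "\<And>U. open U \<Longrightarrow> emeasure lborel U < ennreal \<delta> \<Longrightarrow> emeasure M U \<le> ennreal e"
        using open_small[OF \<open>e > 0\<close>] by blast
      have A': "A \<in> sets lebesgue" "emeasure lebesgue A = 0" "A \<in> sets borel"
        using A by (auto simp: null_sets_def)
      obtain T where T: "open T" "A \<subseteq> T" "emeasure lebesgue (T - A) < ennreal \<delta>"
        by (rule sets_lebesgue_outer_open[OF A'(1) \<delta>(1)])
      have "emeasure lebesgue T \<le> emeasure lebesgue ((T - A) \<union> A)"
        using T A' by (intro emeasure_mono) auto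
      also have "\<dots> \<le> emeasure lebesgue (T - A) + emeasure lebesgue A"
        using T A' by (intro emeasure_subadditive) auto
      finally have "emeasure lborel T < ennreal \<delta>"
        using T A' by (simp add: emeasure_completion)
      then have "emeasure M T \<le> ennreal e"
        using \<delta> T by blast
      moreover have "emeasure M A \<le> emeasure M T"
        using T by (intro emeasure_mono) (auto simp: setsM)
      ultimately show ?thesis by simp
    qed
    have "emeasure M A \<le> 0"
    proof (rule ennreal_le_epsilon)
      fix e :: real assume "e > 0"
      then show "emeasure M A \<le> 0 + ennreal e"
        using small[of e] by simp
    qed
    moreover have "A \<in> sets M"
      unfolding setsM using null_setsD2[OF A] by simp
    ultimately show "A \<in> null_sets M"
      by (intro null_setsI) simp_all
  qed
  have "sets M = sets lborel"
    by (simp add: setsM)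
  then obtain f where f: "f \<in> borel_measurable lborel" "density lborel f = M"
    using sigma_finite_measure.Radon_Nikodym[OF sigma_finite_lborel abs] by blast
  define g where "g = (\<lambda>x. enn2real (f x))"
  have gm: "g \<in> borel_measurable borel"
    using f(1) by (simp add: g_def)
  have hi: "(g has_integral (G x - G a)) {a..x}" if "x \<in> {a..b}" for x
  proof -
    have Ex: "E x - E a = G x - G a"
      using that ab by (simp add: E_def clip_def)
    have "(\<integral>\<^sup>+y. f y * indicator {a<..x} y \<partial>lborel) = emeasure M {a<..x}"
      using emeasure_density[OF f(1), of "{a<..x}"] unfolding f(2) by simp
    also have "\<dots> = ennreal (G x - G a)"
      using M_Ioc[of a x] Ex that by simp
    finally have nn: "(\<integral>\<^sup>+y. f y * indicator {a<..x} y \<partial>lborel) = ennreal (G x - G a)" .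
    \<comment> \<open>\<open>g\<close> replaces the value infinity of \<open>f\<close> by 0, which
      does no harm because the finite integral makes \<open>f\<close> finite almost everywhere on
      {a<..x}.\<close>
    have AE: "AE y in lborel. f y * indicator {a<..x} y \<noteq> \<infinity>"
      using f(1) nn by (intro nn_integral_PInf_AE) auto
    have "(\<integral>\<^sup>+y. ennreal (g y * indicator {a<..x} y) \<partial>lborel) = (\<integral>\<^sup>+y. f y * indicator {a<..x} y \<partial>lborel)"
      using AE by (intro nn_integral_cong_AE, eventually_elim)
        (auto simp: g_def indicator_def ennreal_enn2real_if)
    then have "((\<lambda>y. g y * indicator {a<..x} y) has_integral (G x - G a)) UNIV"
      using nn gm mono[of a x] that by (intro nn_integral_has_integral) (auto simp: g_def)
    then have "((\<lambda>y. if y \<in> {a<..x} then g y else 0) has_integral (G x - G a)) UNIV"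
      by (rule has_integral_eq[rotated]) (auto simp: indicator_def)
    then have "(g has_integral (G x - G a)) {a<..x}"
      by (simp only: has_integral_restrict_UNIV)
    then show ?thesis
    proof (subst has_integral_spike_set_eq)
      have "{a} \<supseteq> {x' \<in> {a<..x} - {a..x}. g x' \<noteq> 0}" "{a} \<supseteq> {x' \<in> {a..x} - {a<..x}. g x' \<noteq> 0}"
        by auto
      then show "negligible {x' \<in> {a<..x} - {a..x}. g x' \<noteq> 0}" "negligible {x' \<in> {a..x} - {a<..x}. g x' \<noteq> 0}"
        using negligible_sing negligible_subset by blast+
    qed
  qed
  have "g absolutely_integrable_on {a..b}"
    using hi[of b] ab by (intro nonnegative_absolutely_integrable_1) (auto simp: g_def integrable_on_def)
  moreover have "G x = G a + integral {a..x} g" if "x \<in> {a..b}" for x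
    using hi[OF that] by (simp add: integral_unique)
  ultimately show ?thesis by blast
qed

text \<open>Jordan decomposition: with the total variation \<open>T\<close>, both \<open>T\<close>
  and \<open>T + h\<close> are increasing and inherit the \<epsilon>-\<delta> condition, the latter
  because its increments are at most twice those of \<open>T\<close>. The density of
  \<open>h\<close> is the difference of the two densities.\<close>

lemma abs_cont_density_real:
  fixes h :: "real \<Rightarrow> real"
  assumes ab: "a < b" and ac: "abs_cont_on {a..b} h"
  shows "\<exists>g. g absolutely_integrable_on {a..b} \<and> (\<forall>x\<in>{a..b}. h x = h a + integral {a..x} g)"
proof -
  define T where "T = tvar h a b"
  have ge: "\<bar>h v - h u\<bar> \<le> T v - T u" if "a \<le> u" "u \<le> v" "v \<le> b" for u v
    unfolding T_def using tvar_ge[OF ab ac that] .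
  have fam: "\<exists>\<delta>>0. \<forall>(J :: real set set) u v. nonoverlapping a b J u v \<longrightarrow> (\<Sum>i\<in>J. v i - u i) < \<delta> \<longrightarrow>
    (\<Sum>j\<in>J. T (v j) - T (u j)) \<le> e" if "e > 0" for e
    unfolding T_def using tvar_family[OF ab ac that] .
  have famh: "\<exists>\<delta>>0. \<forall>(J :: real set set) u v. nonoverlapping a b J u v \<longrightarrow> (\<Sum>i\<in>J. v i - u i) < \<delta> \<longrightarrow>
    (\<Sum>j\<in>J. (T (v j) + h (v j)) - (T (u j) + h (u j))) \<le> e" if e: "e > 0" for e
  proof -
    obtain \<delta> where \<delta>: "\<delta> > 0" "\<And>(J :: real set set) u v. nonoverlapping a b J u v \<Longrightarrow>
      (\<Sum>i\<in>J. v i - u i) < \<delta> \<Longrightarrow> (\<Sum>j\<in>J. T (v j) - T (u j)) \<le> e/2"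
      using fam[OF half_gt_zero[OF e]] by blast
    have "(\<Sum>j\<in>J. (T (v j) + h (v j)) - (T (u j) + h (u j))) \<le> e"
      if J: "nonoverlapping a b J u v" "(\<Sum>i\<in>J. v i - u i) < \<delta>" for J :: "real set set" and u v
    proof -
      have "(\<Sum>j\<in>J. (T (v j) + h (v j)) - (T (u j) + h (u j))) \<le> (\<Sum>j\<in>J. 2 * (T (v j) - T (u j)))"
        using J(1) ge by (intro sum_mono) (force simp: nonoverlapping_def)
      also have "\<dots> \<le> e"
        using \<delta>(2)[OF J] by (simp only: sum_distrib_left[symmetric])
      finally show ?thesis .
    qed
    then show ?thesis using \<delta>(1) by blast
  qed
  have m1: "T u \<le> T v" "T u + h u \<le> T v + h v" if "a \<le> u" "u \<le> v" "v \<le> b" for u v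
    using ge[OF that] by auto
  obtain g1 where g1: "g1 absolutely_integrable_on {a..b}" "\<forall>x\<in>{a..b}. T x = T a + integral {a..x} g1"
    using increasing_abs_cont_density[OF ab m1(1) fam] by auto
  obtain g2 where g2: "g2 absolutely_integrable_on {a..b}"
      "\<forall>x\<in>{a..b}. T x + h x = T a + h a + integral {a..x} g2"
    using increasing_abs_cont_density[of a b "\<lambda>x. T x + h x", OF ab m1(2) famh] by auto
  have "h x = h a + integral {a..x} (\<lambda>t. g2 t - g1 t)" if "x \<in> {a..b}" for x
  proof -
    have "g1 integrable_on {a..x}" "g2 integrable_on {a..x}"
      using g1(1) g2(1) that
      by (auto intro: integrable_on_subinterval[OF absolutely_integrable_on_def[THEN iffD1, THEN conjunct1]])
    then have "integral {a..x} (\<lambda>t. g2 t - g1 t) = integral {a..x} g2 - integral {a..x} g1"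
      by (intro Henstock_Kurzweil_Integration.integral_diff)
    then show ?thesis
      using bspec[OF g1(2) that] bspec[OF g2(2) that] by simp
  qed
  then show ?thesis
    using set_integral_diff(1)[OF g2(1) g1(1)] by blast
qed

lemma abs_cont_on_bounded_linear:
  assumes "bounded_linear L" and norm_le: "\<And>x. norm (L x) \<le> norm x" and "abs_cont_on S f"
  shows "abs_cont_on S (\<lambda>x. L (f x))"
proof -
  interpret bounded_linear L by fact
  have "(\<Sum>K\<in>d. norm (L (f (Sup K)) - L (f (Inf K)))) \<le> (\<Sum>K\<in>d. norm (f (Sup K) - f (Inf K)))" for d
    by (intro sum_mono) (metis diff norm_le)
  then show ?thesis
    using assms(3) unfolding abs_cont_on_def by (meson le_less_trans)
qed

lemma abs_cont_density:
  fixes h :: "real \<Rightarrow> complex"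
  assumes ab: "a < b" and ac: "abs_cont_on {a..b} h"
  shows "\<exists>g. g absolutely_integrable_on {a..b} \<and> (\<forall>x\<in>{a..b}. h x = h a + integral {a..x} g)"
proof -
  obtain g1 where g1: "g1 absolutely_integrable_on {a..b}" "\<forall>x\<in>{a..b}. Re (h x) = Re (h a) + integral {a..x} g1"
    using abs_cont_density_real[OF ab abs_cont_on_bounded_linear[OF bounded_linear_Re abs_Re_le_cmod[folded real_norm_def] ac]] by auto
  obtain g2 where g2: "g2 absolutely_integrable_on {a..b}" "\<forall>x\<in>{a..b}. Im (h x) = Im (h a) + integral {a..x} g2"
    using abs_cont_density_real[OF ab abs_cont_on_bounded_linear[OF bounded_linear_Im abs_Im_le_cmod[folded real_norm_def] ac]] by auto
  define g where "g = (\<lambda>t. complex_of_real (g1 t) + \<i> * complex_of_real (g2 t))"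
  have hi: "(g has_integral (h x - h a)) {a..x}" if x: "x \<in> {a..b}" for x
  proof -
    have "g1 integrable_on {a..x}" "g2 integrable_on {a..x}"
      using g1(1) g2(1) that
      by (auto intro: integrable_on_subinterval[OF absolutely_integrable_on_def[THEN iffD1, THEN conjunct1]])
    then have "(g1 has_integral (Re (h x) - Re (h a))) {a..x}" "(g2 has_integral (Im (h x) - Im (h a))) {a..x}"
      using bspec[OF g1(2) x] bspec[OF g2(2) x] by (simp_all add: has_integral_iff)
    then have "(g has_integral (complex_of_real (Re (h x) - Re (h a)) + \<i> * complex_of_real (Im (h x) - Im (h a)))) {a..x}"
      unfolding g_def by (intro has_integral_add has_integral_mult_right has_integral_of_real)
    moreover have "complex_of_real (Re (h x) - Re (h a)) + \<i> * complex_of_real (Im (h x) - Im (h a)) = h x - h a"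
      by (simp add: complex_eq_iff)
    ultimately show ?thesis by simp
  qed
  have "(\<lambda>t. complex_of_real (g1 t)) absolutely_integrable_on {a..b}"
    "(\<lambda>t. \<i> * complex_of_real (g2 t)) absolutely_integrable_on {a..b}"
    using absolutely_integrable_linear[OF g1(1) bounded_linear_of_real]
      absolutely_integrable_linear[OF g2(1) bounded_linear_compose[OF bounded_linear_mult_right[of \<i>] bounded_linear_of_real]]
    by (simp_all add: o_def)
  then have "g absolutely_integrable_on {a..b}"
    unfolding g_def by (rule set_integral_add(1))
  moreover have "h x = h a + integral {a..x} g" if "x \<in> {a..b}" for x
    using hi[OF that] by (simp add: integral_unique)
  ultimately show ?thesis by blast
qed

text \<open>Lebesgue differentiation is applied twice: to \<open>f\<close> for averages over
  [x, x + h], and to the reflected function for averages over [x - h, x]. The second exceptional set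
  is therefore reflected back.\<close>

lemma indefinite_integral_has_vector_derivative_AE:
  fixes g :: "real \<Rightarrow> complex"
  assumes ab: "a < b" and g: "g absolutely_integrable_on {a..b}"
  obtains N where "negligible N"
    "\<And>x. x \<in> {a<..<b} - N \<Longrightarrow> ((\<lambda>x. integral {a..x} g) has_vector_derivative g x) (at x within {a..b})"
proof -
  define f where "f = (\<lambda>x. if x \<in> {a..b} then g x else 0)"
  have gi: "g integrable_on {u..v}" if "a \<le> u" "v \<le> b" for u v
    using g that by (intro integrable_on_subinterval[OF set_lebesgue_integral_eq_integral(1)[OF g]]) auto
  have "f integrable_on UNIV"
    unfolding f_def using gi[of a b] by (subst integrable_restrict_UNIV) auto
  then have fi: "f integrable_on cbox u v" for u v
    by (rule integrable_on_subcbox) simp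
  have fi': "(\<lambda>x. f (- x)) integrable_on cbox u v" for u v
    using integrable_reflect[of f "-u" "-v"] fi[of "-v" "-u"] by simp
  obtain N1 where N1: "negligible N1"
       "\<And>x e. \<lbrakk>x \<notin> N1; 0 < e\<rbrakk> \<Longrightarrow>
               \<exists>d>0. \<forall>h. 0 < h \<and> h < d \<longrightarrow>
                         norm(integral (cbox x (x + h *\<^sub>R One)) f /\<^sub>R h ^ DIM(real) - f x) < e"
    by (rule integrable_ccontinuous_explicit[OF fi], rule that)
  obtain N2 where N2: "negligible N2"
       "\<And>x e. \<lbrakk>x \<notin> N2; 0 < e\<rbrakk> \<Longrightarrow>
               \<exists>d>0. \<forall>h. 0 < h \<and> h < d \<longrightarrow>
                         norm(integral (cbox x (x + h *\<^sub>R One)) (\<lambda>x. f (- x)) /\<^sub>R h ^ DIM(real) - f (- x)) < e"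
    by (rule integrable_ccontinuous_explicit[OF fi'], rule that)
  have bound: "norm (I - h *\<^sub>R c) \<le> e * h" if "norm (I /\<^sub>R h - c) < e" "h > 0" for I c :: complex and h e :: real
  proof -
    have "I - h *\<^sub>R c = h *\<^sub>R (I /\<^sub>R h - c)"
      using that(2) by (simp add: algebra_simps)
    then have "norm (I - h *\<^sub>R c) = h * norm (I /\<^sub>R h - c)"
      using that(2) by simp
    also have "\<dots> \<le> h * e"
      using that by (intro mult_left_mono) auto
    finally show ?thesis by (simp add: mult.commute)
  qed
  have "((\<lambda>x. integral {a..x} g) has_vector_derivative g x) (at x within {a..b})"
    if x: "x \<in> {a<..<b} - (N1 \<union> uminus ` N2)" for x
    unfolding has_vector_derivative_def has_derivative_within_alt
  proof (intro conjI allI impI bounded_linear_scaleR_left)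
    fix e :: real assume "e > 0"
    have xN: "x \<notin> N1" "- x \<notin> N2"
      using x by (auto simp: image_iff)
    obtain d1 where d1: "d1 > 0" "\<And>h. 0 < h \<and> h < d1 \<Longrightarrow> norm (integral {x..x + h} f /\<^sub>R h - f x) < e"
      using N1(2)[OF xN(1) \<open>e > 0\<close>] by auto
    obtain d2 where d2: "d2 > 0" "\<And>h. 0 < h \<and> h < d2 \<Longrightarrow> norm (integral {-x..-x + h} (\<lambda>x. f (-x)) /\<^sub>R h - f x) < e"
      using N2(2)[OF xN(2) \<open>e > 0\<close>] by auto
    have fg: "integral {u..v} f = integral {u..v} g" if "a \<le> u" "v \<le> b" for u v
      using that by (intro integral_cong) (auto simp: f_def)
    have fx: "f x = g x" using x by (simp add: f_def)
    show "\<exists>d>0. \<forall>y\<in>{a..b}. norm (y - x) < d \<longrightarrow>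
      norm (integral {a..y} g - integral {a..x} g - (y - x) *\<^sub>R g x) \<le> e * norm (y - x)"
    proof (intro exI[of _ "min d1 d2"] conjI ballI impI)
      fix y assume y: "y \<in> {a..b}" "norm (y - x) < min d1 d2"
      consider "y = x" | "x < y" | "y < x" by linarith
      then show "norm (integral {a..y} g - integral {a..x} g - (y - x) *\<^sub>R g x) \<le> e * norm (y - x)"
      proof cases
        case 2
        have "integral {a..x} g + integral {x..y} g = integral {a..y} g"
          using x y 2 gi by (intro Henstock_Kurzweil_Integration.integral_combine) auto
        then have "integral {a..y} g - integral {a..x} g - (y - x) *\<^sub>R g x = integral {x..y} g - (y - x) *\<^sub>R g x"
          by (simp add: algebra_simps)
        moreover have "norm (integral {x..x + (y - x)} f /\<^sub>R (y - x) - f x) < e"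
          using y 2 by (intro d1(2)) auto
        ultimately show ?thesis
          using bound[of "y - x" "integral {x..y} f" "f x" e] 2 x y fg[of x y] fx by simp
      next
        case 3
        have "integral {a..y} g + integral {y..x} g = integral {a..x} g"
          using x y 3 gi by (intro Henstock_Kurzweil_Integration.integral_combine) auto
        moreover have "norm (integral {-x..-x + (x - y)} (\<lambda>x. f (- x)) /\<^sub>R (x - y) - f x) < e"
          using y 3 by (intro d2(2)) auto
        ultimately have "norm (integral {y..x} g - (x - y) *\<^sub>R g x) \<le> e * (x - y)"
            "integral {a..y} g - integral {a..x} g - (y - x) *\<^sub>R g x = - (integral {y..x} g - (x - y) *\<^sub>R g x)"
          using bound[of "x - y" "integral {y..x} f" "f x" e] 3 x y fg[of y x] fx
            integral_reflect_real[of y x f] by (auto simp: algebra_simps)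
        then show ?thesis
          using 3 by (simp only: norm_minus_cancel) simp
      qed simp
    qed (use d1 d2 in simp)
  qed
  moreover have "negligible (N1 \<union> uminus ` N2)"
    using N1(1) N2(1)
    by (intro negligible_Un negligible_differentiable_image_negligible)
       (auto intro!: derivative_intros simp: differentiable_on_def)
  ultimately show ?thesis using that by blast
qed

text \<open>Truncation of the norm of \<open>g\<close> at a height \<open>n\<close>: the excess
  \<open>r\<close> has integral below \<epsilon>/2, and the bounded part contributes at most
  \<open>n\<close> times the total length.\<close>

lemma indefinite_integral_abs_cont_on:
  fixes g :: "real \<Rightarrow> complex"
  assumes g: "g absolutely_integrable_on {a..b}"
    and f: "\<And>x. x \<in> {a..b} \<Longrightarrow> f x = c + integral {a..x} g"
  shows "abs_cont_on {a..b} f"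
  unfolding abs_cont_on_def
proof (intro allI impI)
  fix \<epsilon> :: real assume "\<epsilon> > 0"
  have gi: "g integrable_on {a..b}" and ni: "(\<lambda>x. norm (g x)) integrable_on {a..b}"
    using g by (auto simp: absolutely_integrable_on_def)
  define h where "h = (\<lambda>n x. min (norm (g x)) (real n))"
  have hi: "h n absolutely_integrable_on {a..b}" for n
    unfolding h_def using absolutely_integrable_norm[OF g]
    by (intro absolutely_integrable_min_1) (auto simp: o_def)
  then have hi': "h n integrable_on {a..b}" for n
    by (rule set_lebesgue_integral_eq_integral(1))
  have "(\<lambda>n. integral {a..b} (h n)) \<longlonglongrightarrow> integral {a..b} (\<lambda>x. norm (g x))"
  proof (rule dominated_convergence(2)[OF hi' ni])
    fix x
    have "\<forall>\<^sub>F n in sequentially. h n x = norm (g x)"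
      using eventually_ge_at_top[of "nat \<lceil>norm (g x)\<rceil>"]
    proof eventually_elim
      case (elim n)
      then have "norm (g x) \<le> real n"
        by linarith
      then show ?case by (simp add: h_def)
    qed
    then show "(\<lambda>n. h n x) \<longlonglongrightarrow> norm (g x)"
      by (rule tendsto_eventually)
  qed (simp add: h_def)
  then have "\<forall>\<^sub>F n in sequentially. dist (integral {a..b} (h n)) (integral {a..b} (\<lambda>x. norm (g x))) < \<epsilon>/2"
    using \<open>\<epsilon> > 0\<close> by (intro tendstoD) auto
  then obtain n where n: "dist (integral {a..b} (h n)) (integral {a..b} (\<lambda>x. norm (g x))) < \<epsilon>/2"
    by (auto simp: eventually_sequentially)
  define r where "r = (\<lambda>x. norm (g x) - h n x)"
  have ri: "r integrable_on {a..b}"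
    unfolding r_def using ni hi' by (rule integrable_diff)
  have r0: "r x \<ge> 0" for x by (simp add: r_def h_def)
  have rint: "integral {a..b} r < \<epsilon>/2"
    using n unfolding r_def by (subst Henstock_Kurzweil_Integration.integral_diff[OF ni hi'], unfold dist_real_def, arith)
  show "\<exists>\<delta>>0. \<forall>d t. d division_of t \<and> t \<subseteq> {a..b} \<and> (\<Sum>K\<in>d. Sup K - Inf K) < \<delta>
       \<longrightarrow> (\<Sum>K\<in>d. norm (f (Sup K) - f (Inf K))) < \<epsilon>"
  \<comment> \<open>With this \<delta> the bounded part contributes at most \<epsilon>/2; the
    summand 1 covers the case n = 0.\<close>
  proof (intro exI[of _ "\<epsilon> / (2 * (real n + 1))"] conjI allI impI)
    fix d t assume *: "d division_of t \<and> t \<subseteq> {a..b} \<and> (\<Sum>K\<in>d. Sup K - Inf K) < \<epsilon> / (2 * (real n + 1))"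
    have K: "\<exists>u v. K = {u..v} \<and> u \<le> v \<and> {u..v} \<subseteq> {a..b}" if Kd: "K \<in> d" for K
    proof -
      obtain u v where uv: "K = cbox u v"
        using division_ofD(4)[OF conjunct1[OF *] Kd] by blast
      moreover have "K \<subseteq> {a..b}" "K \<noteq> {}"
        using division_ofD(2,3)[OF conjunct1[OF *] Kd] * by blast+
      ultimately show ?thesis
        by (intro exI[of _ u] exI[of _ v]) simp
    qed
    have "norm (f (Sup K) - f (Inf K)) \<le> integral K r + real n * (Sup K - Inf K)" if Kd: "K \<in> d" for K
    proof -
      obtain u v where uv: "K = {u..v}" "u \<le> v" "{u..v} \<subseteq> {a..b}"
        using K[OF Kd] by blast
      then have ab: "a \<le> u" "v \<le> b" by auto
      have sub: "p integrable_on {u..v}" if "p integrable_on {a..b}" for p :: "real \<Rightarrow> 'z::banach"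
        using integrable_on_subinterval[OF that] ab by auto
      have "integral {a..u} g + integral {u..v} g = integral {a..v} g"
        using ab uv(2) integrable_on_subinterval[OF gi]
        by (intro Henstock_Kurzweil_Integration.integral_combine) auto
      then have "f v - f u = integral {u..v} g"
        using f[of u] f[of v] ab uv(2) by (simp add: algebra_simps)
      also have "norm \<dots> \<le> integral {u..v} (\<lambda>x. r x + real n)"
        using sub[OF gi] sub[OF ri]
        by (intro integral_norm_bound_integral integrable_add) (auto simp: r_def h_def)
      also have "\<dots> = integral {u..v} r + real n * (v - u)"
        using sub[OF ri] uv(2) by (subst Henstock_Kurzweil_Integration.integral_add) auto
      finally show ?thesis
        using uv by simp
    qed
    then have "(\<Sum>K\<in>d. norm (f (Sup K) - f (Inf K))) \<le> (\<Sum>K\<in>d. integral K r + real n * (Sup K - Inf K))"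
      by (rule sum_mono)
    also have "\<dots> = (\<Sum>K\<in>d. integral K r) + real n * (\<Sum>K\<in>d. Sup K - Inf K)"
      by (simp add: sum.distrib sum_distrib_left)
    also have "(\<Sum>K\<in>d. integral K r) = integral t r"
      using * ri by (intro integral_combine_division_topdown[symmetric]) (auto intro: integrable_on_subdivision)
    also have "\<dots> \<le> integral {a..b} r"
      using * ri r0 by (intro integral_subset_le) (auto intro: integrable_on_subdivision)
    also have "real n * (\<Sum>K\<in>d. Sup K - Inf K) \<le> (real n + 1) * (\<epsilon> / (2 * (real n + 1)))"
    proof (rule mult_mono)
      show "0 \<le> (\<Sum>K\<in>d. Sup K - Inf K)"
      proof (rule sum_nonneg)
        fix K assume "K \<in> d"
        then obtain u v where "K = {u..v}" "u \<le> v" using K by blast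
        then show "0 \<le> Sup K - Inf K" by simp
      qed
    qed (use * in auto)
    also have "(real n + 1) * (\<epsilon> / (2 * (real n + 1))) = \<epsilon>/2"
      by (simp add: field_simps)
    finally show "(\<Sum>K\<in>d. norm (f (Sup K) - f (Inf K))) < \<epsilon>"
      using rint by simp
  qed (use \<open>\<epsilon> > 0\<close> in simp)
qed

lemma integrable_on_Icc_subset:
  fixes f :: "real \<Rightarrow> 'a::euclidean_space"
  assumes "f absolutely_integrable_on {a..b}" "a \<le> u" "v \<le> b"
  shows "f integrable_on {u..v}"
  using integrable_on_subinterval[OF set_lebesgue_integral_eq_integral(1)[OF assms(1)]] assms by auto

section \<open>Linear equations with integrable coefficients\<close>

text \<open>\<open>F\<close> is an absolutely continuous primitive of \<open>f\<close>. Integrals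
  over initial segments take the place of derivatives, which exist only almost everywhere.\<close>

definition ac_prim :: "real \<Rightarrow> real \<Rightarrow> (real \<Rightarrow> 'a) \<Rightarrow> (real \<Rightarrow> 'a::{real_normed_field,euclidean_space}) \<Rightarrow> bool"
  where "ac_prim a b F f \<longleftrightarrow> f absolutely_integrable_on {a..b} \<and>
    (\<forall>x\<in>{a..b}. (f has_integral (F x - F a)) {a..x})"

lemma ac_prim_has_integral:
  assumes "ac_prim a b F f" "a \<le> x" "x \<le> y" "y \<le> b"
  shows "(f has_integral (F y - F x)) {x..y}"
proof -
  have f: "f integrable_on {a..b}"
    using assms by (auto simp: ac_prim_def intro: set_lebesgue_integral_eq_integral(1))
  have i: "f integrable_on {u..v}" if "a \<le> u" "v \<le> b" for u v
    using integrable_on_subinterval[OF f] that by auto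
  have "integral {a..x} f + integral {x..y} f = integral {a..y} f"
    using assms i by (intro Henstock_Kurzweil_Integration.integral_combine) auto
  moreover have "integral {a..x} f = F x - F a" "integral {a..y} f = F y - F a"
    using assms by (auto simp: ac_prim_def intro!: integral_unique)
  ultimately have "integral {x..y} f = F y - F x"
    by (simp add: algebra_simps)
  then show ?thesis
    using i[of x y] assms by (simp add: has_integral_iff)
qed

lemma ac_prim_subinterval:
  assumes "ac_prim a b F f" "a \<le> c" "d \<le> b"
  shows "ac_prim c d F f"
  unfolding ac_prim_def
proof (intro conjI ballI)
  show "f absolutely_integrable_on {c..d}"
    using assms by (auto simp: ac_prim_def intro: set_integrable_subset)
  show "(f has_integral (F x - F c)) {c..x}" if "x \<in> {c..d}" for x
    using that assms by (intro ac_prim_has_integral[OF assms(1)]) auto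
qed

lemma ac_prim_integrable: "ac_prim a b F f \<Longrightarrow> f integrable_on {a..b}"
  by (auto simp: ac_prim_def intro: set_lebesgue_integral_eq_integral(1))

lemma ac_prim_continuous:
  assumes "ac_prim a b F f"
  shows "continuous_on {a..b} F"
proof -
  have "continuous_on {a..b} (\<lambda>x. F a + integral {a..x} f)"
    by (intro continuous_intros indefinite_integral_continuous_1 ac_prim_integrable[OF assms])
  then show ?thesis
  proof (rule continuous_on_eq)
    fix x assume "x \<in> {a..b}"
    then have "integral {a..x} f = F x - F a"
      using assms by (intro integral_unique) (simp add: ac_prim_def)
    then show "F a + integral {a..x} f = F x" by simp
  qed
qed

lemma absolutely_integrable_mult_continuous:
  fixes q u :: "real \<Rightarrow> 'a::{real_normed_field,euclidean_space}"
  assumes "q absolutely_integrable_on {a..b}" "continuous_on {a..b} u"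
  shows "(\<lambda>t. q t * u t) absolutely_integrable_on {a..b}"
proof -
  have bl: "bilinear (\<lambda>x y :: 'a. y * x)"
    by (simp add: bilinear_def linear_iff algebra_simps)
  show ?thesis
  proof (rule absolutely_integrable_bounded_measurable_product[OF bl _ _ _ assms(1)])
    show "u \<in> borel_measurable (lebesgue_on {a..b})"
      by (intro continuous_imp_measurable_on_sets_lebesgue assms) auto
    show "bounded (u ` {a..b})"
      by (intro compact_imp_bounded compact_continuous_image assms compact_Icc)
  qed auto
qed

lemma ac_prim_integral:
  assumes "f absolutely_integrable_on {a..b}"
  shows "ac_prim a b (\<lambda>x. c + integral {a..x} f) f"
proof -
  have "f integrable_on {a..x}" if "x \<in> {a..b}" for x
    using integrable_on_subinterval[OF set_lebesgue_integral_eq_integral(1)[OF assms]] that by auto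
  then show ?thesis
    using assms by (auto simp: ac_prim_def has_integral_iff)
qed

text \<open>Adding up the increments over a fine subdivision bounds the norm of D b - D a by e (M b
  - M a) for every \<open>e\<close>. With \<open>M\<close> an indefinite integral this takes over
  the role of a vanishing derivative.\<close>

lemma constant_if_locally_small_increments:
  fixes D :: "real \<Rightarrow> 'a::real_normed_vector" and M :: "real \<Rightarrow> real"
  assumes ab: "a \<le> b" and
    small: "\<And>e. e > 0 \<Longrightarrow> \<exists>d>0. \<forall>x y. a \<le> x \<longrightarrow> x \<le> y \<longrightarrow> y \<le> b \<longrightarrow> y - x < d \<longrightarrow>
      norm (D y - D x) \<le> e * (M y - M x)"
  shows "D b = D a"
proof -
  have le: "norm (D b - D a) \<le> e * (M b - M a)" if e: "e > 0" for e
  proof -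
    obtain d where d: "d > 0" "\<And>x y. a \<le> x \<Longrightarrow> x \<le> y \<Longrightarrow> y \<le> b \<Longrightarrow> y - x < d \<Longrightarrow>
        norm (D y - D x) \<le> e * (M y - M x)"
      using small[OF e] by blast
    obtain n where n: "(b - a) / d < real n"
      using reals_Archimedean2 by blast
    have n0: "n > 0" using n ab d(1) by (cases n) (auto simp: divide_less_0_iff)
    define x where "x = (\<lambda>i. a + real i * ((b - a) / real n))"
    have step: "x (Suc i) = x i + (b - a) / real n" for i
      by (simp add: x_def distrib_right add_divide_distrib)
    have le_b: "x i \<le> b" if "i \<le> n" for i
    proof -
      have "real i * ((b - a) / real n) \<le> real n * ((b - a) / real n)"
        using that ab by (intro mult_right_mono) auto
      then show ?thesis using n0 by (simp add: x_def)
    qed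
    have ge_a: "a \<le> x i" for i using ab by (simp add: x_def)
    have "norm (D (x i) - D a) \<le> e * (M (x i) - M a)" if "i \<le> n" for i
      using that
    proof (induction i)
      case (Suc i)
      have "(b - a) / real n < d"
        using n n0 d(1) by (simp add: field_simps)
      then have "norm (D (x (Suc i)) - D (x i)) \<le> e * (M (x (Suc i)) - M (x i))"
        using Suc.prems ab by (intro d(2) ge_a le_b) (auto simp: step)
      moreover have "norm (D (x (Suc i)) - D a) \<le> norm (D (x (Suc i)) - D (x i)) + norm (D (x i) - D a)"
        by (metis diff_add_cancel diff_add_eq add_diff_eq norm_triangle_ineq)
      ultimately show ?case
        using Suc by (simp add: algebra_simps)
    qed (simp add: x_def)
    from this[of n] show ?thesis
      using n0 by (simp add: x_def)
  qed
  have "norm (D b - D a) \<le> 0"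
  proof (rule field_le_epsilon)
    fix e :: real assume "e > 0"
    then have "norm (D b - D a) \<le> e / (\<bar>M b - M a\<bar> + 1) * (M b - M a)"
      by (intro le) auto
    also have "\<dots> \<le> e / (\<bar>M b - M a\<bar> + 1) * (\<bar>M b - M a\<bar> + 1)"
      using \<open>e > 0\<close> by (intro mult_left_mono) auto
    finally show "norm (D b - D a) \<le> 0 + e" by simp
  qed
  then show ?thesis by simp
qed

text \<open>The product rule without derivatives: \<open>D\<close>, the product minus the candidate
  integral, has increments bounded by \<open>e\<close> times those of the integral of
  \<open>m\<close>, hence it is constant.\<close>

lemma ac_prim_mult:
  fixes F G :: "real \<Rightarrow> 'a::{real_normed_field,euclidean_space}"
  assumes F: "ac_prim a b F f" and G: "ac_prim a b G g"
  shows "ac_prim a b (\<lambda>x. F x * G x) (\<lambda>x. f x * G x + F x * g x)"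
proof -
  let ?h = "\<lambda>x. f x * G x + F x * g x"
  have cF: "continuous_on {a..b} F" and cG: "continuous_on {a..b} G"
    using F G by (auto intro: ac_prim_continuous)
  have h: "?h absolutely_integrable_on {a..b}"
    using absolutely_integrable_mult_continuous[where q = f and u = G] absolutely_integrable_mult_continuous[where q = g and u = F]
      F G cF cG by (intro set_integral_add(1)) (auto simp: ac_prim_def mult.commute)
  have "(?h has_integral (F z * G z - F a * G a)) {a..z}" if z: "z \<in> {a..b}" for z
  proof -
    have hi: "?h integrable_on {u..v}" if "a \<le> u" "v \<le> b" for u v
      using integrable_on_Icc_subset[OF h that] .
    define m where "m = (\<lambda>x. norm (f x) + norm (g x))"
    have "(\<lambda>x. norm (f x)) absolutely_integrable_on {a..b}" "(\<lambda>x. norm (g x)) absolutely_integrable_on {a..b}"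
      using F G absolutely_integrable_norm by (auto simp: ac_prim_def o_def)
    then have m: "m absolutely_integrable_on {a..b}"
      unfolding m_def by (rule set_integral_add(1))
    have mi: "m integrable_on {u..v}" if "a \<le> u" "v \<le> b" for u v
      using integrable_on_Icc_subset[OF m that] .
    define D where "D = (\<lambda>x. F x * G x - integral {a..x} ?h)"
    have "D z = D a"
    proof (rule constant_if_locally_small_increments[where M = "\<lambda>x. integral {a..x} m"])
      fix e :: real assume "e > 0"
      have "uniformly_continuous_on {a..b} F" "uniformly_continuous_on {a..b} G"
        using cF cG by (auto intro: compact_uniformly_continuous)
      then obtain d1 d2 where d1: "d1 > 0" "\<And>x y. x \<in> {a..b} \<Longrightarrow> y \<in> {a..b} \<Longrightarrow> dist y x < d1 \<Longrightarrow> dist (F y) (F x) < e"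
        and d2: "d2 > 0" "\<And>x y. x \<in> {a..b} \<Longrightarrow> y \<in> {a..b} \<Longrightarrow> dist y x < d2 \<Longrightarrow> dist (G y) (G x) < e"
        using \<open>e > 0\<close> unfolding uniformly_continuous_on_def by metis
      show "\<exists>d>0. \<forall>x y. a \<le> x \<longrightarrow> x \<le> y \<longrightarrow> y \<le> z \<longrightarrow> y - x < d \<longrightarrow>
        norm (D y - D x) \<le> e * (integral {a..y} m - integral {a..x} m)"
      proof (intro exI[of _ "min d1 d2"] conjI allI impI)
        fix x y assume xy: "a \<le> x" "x \<le> y" "y \<le> z" "y - x < min d1 d2"
        then have yb: "y \<le> b" using z by auto
        \<comment> \<open>Over [x, y] the increment of the product is exactly the integral of
          \<open>f\<close> with \<open>G\<close> frozen at \<open>y\<close> plus \<open>g\<close>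
          with \<open>F\<close> frozen at \<open>x\<close>; \<open>?k\<close> is the difference from
          the true integrand.\<close>
        let ?k = "\<lambda>t. f t * (G y - G t) + (F x - F t) * g t"
        have "((\<lambda>t. f t * G y + F x * g t) has_integral ((F y - F x) * G y + F x * (G y - G x))) {x..y}"
          using F G xy yb by (intro has_integral_add has_integral_mult_left has_integral_mult_right ac_prim_has_integral)
        then have "((\<lambda>t. (f t * G y + F x * g t) - ?h t) has_integral
            ((F y - F x) * G y + F x * (G y - G x) - integral {x..y} ?h)) {x..y}"
          using hi[of x y] xy yb by (intro has_integral_diff integrable_integral) auto
        moreover have "integral {a..x} ?h + integral {x..y} ?h = integral {a..y} ?h"
          using xy yb by (intro Henstock_Kurzweil_Integration.integral_combine hi) auto
        then have "(F y - F x) * G y + F x * (G y - G x) - integral {x..y} ?h = D y - D x"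
          by (simp add: D_def algebra_simps)
        moreover have "(\<lambda>t. (f t * G y + F x * g t) - ?h t) = ?k"
          by (auto simp: algebra_simps)
        ultimately have k: "(?k has_integral (D y - D x)) {x..y}" by simp
        have "norm (integral {x..y} ?k) \<le> integral {x..y} (\<lambda>t. e * m t)"
        proof (rule integral_norm_bound_integral)
          show "?k integrable_on {x..y}" using k by blast
          show "(\<lambda>t. e * m t) integrable_on {x..y}"
            using mi[of x y] xy yb by (intro integrable_on_mult_right) auto
          fix t assume t: "t \<in> {x..y}"
          have "dist (G y) (G t) < e" "dist (F x) (F t) < e"
            using t xy yb by (auto intro!: d1(2) d2(2) simp: dist_real_def)
          then have "norm (?k t) \<le> norm (f t) * e + e * norm (g t)"
            using \<open>e > 0\<close> by (intro norm_triangle_le add_mono) (auto simp: norm_mult dist_norm intro!: mult_mono)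
          then show "norm (?k t) \<le> e * m t"
            by (simp add: m_def algebra_simps)
        qed
        also have "\<dots> = e * integral {x..y} m"
          by simp
        also have "integral {x..y} m = integral {a..y} m - integral {a..x} m"
          using Henstock_Kurzweil_Integration.integral_combine[of a x y m] xy mi[of a y] yb by simp
        finally show "norm (D y - D x) \<le> e * (integral {a..y} m - integral {a..x} m)"
          using k by (simp add: integral_unique)
      qed (use d1 d2 in simp)
    qed (use z in auto)
    then have "integral {a..z} ?h = F z * G z - F a * G a"
      by (simp add: D_def algebra_simps)
    then show ?thesis
      using hi[of a z] z by (simp add: has_integral_iff)
  qed
  then show ?thesis
    using h by (simp add: ac_prim_def)
qed

lemma ac_prim_power:
  fixes M :: "real \<Rightarrow> 'a::{real_normed_field,euclidean_space}"
  assumes "ac_prim a b M m"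
  shows "ac_prim a b (\<lambda>x. M x ^ Suc n) (\<lambda>x. of_nat (Suc n) * (m x * M x ^ n))"
proof (induction n)
  case 0
  then show ?case using assms by simp
next
  case (Suc n)
  have "(\<lambda>x. m x * M x ^ Suc n + M x * (of_nat (Suc n) * (m x * M x ^ n))) = (\<lambda>x. of_nat (Suc (Suc n)) * (m x * M x ^ Suc n))"
    by (auto simp: algebra_simps)
  then show ?case
    using ac_prim_mult[OF assms Suc] by simp
qed

section \<open>Iterated integrals and Gronwall's inequality\<close>

lemma has_integral_power_div_fact:
  fixes m :: "real \<Rightarrow> real"
  assumes M: "ac_prim a b M m" and "M a = 0" "x \<in> {a..b}"
  shows "((\<lambda>t. m t * (M t ^ k / fact k)) has_integral (M x ^ Suc k / fact (Suc k))) {a..x}"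
proof -
  have "((\<lambda>t. of_nat (Suc k) * (m t * M t ^ k)) has_integral (M x ^ Suc k - M a ^ Suc k)) {a..x}"
    using ac_prim_power[OF M, of k] assms(3) by (simp only: ac_prim_def)
  then have "((\<lambda>t. 1 / fact (Suc k) * (of_nat (Suc k) * (m t * M t ^ k))) has_integral
      (1 / fact (Suc k) * (M x ^ Suc k - M a ^ Suc k))) {a..x}"
    by (rule has_integral_mult_right)
  moreover have "(\<lambda>t. 1 / fact (Suc k) * (of_nat (Suc k) * (m t * M t ^ k))) = (\<lambda>t. m t * (M t ^ k / fact k))"
    by (auto simp: field_simps simp del: of_nat_Suc)
  ultimately show ?thesis using assms(2) by simp
qed

text \<open>Each step integrates against dM and so turns M^n / n! into M^(n+1) / (n+1)!. The
  factorial is what makes Picard iteration and Gronwall's inequality work for \<open>M\<close> of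
  any size.\<close>

lemma iterated_integral_bound:
  fixes m :: "real \<Rightarrow> real"
  assumes M: "ac_prim a b M m" and Ma: "M a = 0" and m0: "\<And>x. x \<in> {a..b} \<Longrightarrow> m x \<ge> 0"
    and cont: "\<And>n. continuous_on {a..b} (d n)"
    and d0: "\<And>x. x \<in> {a..b} \<Longrightarrow> d 0 x \<le> B"
    and step: "\<And>n x. x \<in> {a..b} \<Longrightarrow> d (Suc n) x \<le> integral {a..x} (\<lambda>t. m t * d n t)"
    and x: "x \<in> {a..b}"
  shows "d n x \<le> B * M x ^ n / fact n"
  using x
proof (induction n arbitrary: x)
  case (Suc n)
  have hi: "((\<lambda>t. m t * (B * M t ^ n / fact n)) has_integral (B * M x ^ Suc n / fact (Suc n))) {a..x}"
    using has_integral_mult_right[OF has_integral_power_div_fact[OF M Ma Suc.prems, of n], of B]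
    by (simp add: mult_ac)
  have "integral {a..x} (\<lambda>t. m t * d n t) \<le> integral {a..x} (\<lambda>t. m t * (B * M t ^ n / fact n))"
  proof (rule integral_le)
    have "(\<lambda>t. m t * d n t) absolutely_integrable_on {a..b}"
      using M cont by (intro absolutely_integrable_mult_continuous) (auto simp: ac_prim_def)
    then show "(\<lambda>t. m t * d n t) integrable_on {a..x}"
      using Suc.prems by (intro integrable_on_Icc_subset) auto
    show "(\<lambda>t. m t * (B * M t ^ n / fact n)) integrable_on {a..x}"
      using hi by blast
    fix t assume "t \<in> {a..x}"
    then show "m t * d n t \<le> m t * (B * M t ^ n / fact n)"
      using Suc.prems by (intro mult_left_mono Suc.IH m0) auto
  qed
  then show ?case
    using step[OF Suc.prems, of n] integral_unique[OF hi] by linarith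
qed (use d0 in simp)

lemma gronwall:
  fixes m w :: "real \<Rightarrow> real"
  assumes M: "ac_prim a b M m" and Ma: "M a = 0" and m0: "\<And>x. x \<in> {a..b} \<Longrightarrow> m x \<ge> 0"
    and cont: "continuous_on {a..b} w"
    and le: "\<And>x. x \<in> {a..b} \<Longrightarrow> w x \<le> A + integral {a..x} (\<lambda>t. m t * w t)"
    and x: "x \<in> {a..b}"
  shows "w x \<le> A * exp (M x)"
proof -
  \<comment> \<open>Subtracting the n-th partial sum of A exp(M) removes the constant
    \<open>A\<close> from the passage from \<open>d n\<close> to \<open>d (Suc n)\<close>, so that
    only the factorially small bound remains.\<close>
  define d where "d = (\<lambda>n x. w x - A * (\<Sum>k<n. M x ^ k / fact k))"
  have cM: "continuous_on {a..b} M" by (rule ac_prim_continuous[OF M])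
  obtain B where B: "\<And>x. x \<in> {a..b} \<Longrightarrow> norm (w x) \<le> B"
    using compact_imp_bounded[OF compact_continuous_image[OF cont compact_Icc]]
    unfolding bounded_iff by blast
  have dn: "d n x \<le> B * M x ^ n / fact n" for n
  proof (rule iterated_integral_bound[OF M Ma m0 _ _ _ x])
    show "continuous_on {a..b} (d n)" for n
      unfolding d_def by (intro continuous_intros cont cM) auto
    show "d 0 x \<le> B" if "x \<in> {a..b}" for x
      using B[OF that] by (simp add: d_def)
    fix n x assume x: "x \<in> {a..b}"
    have mw: "(\<lambda>t. m t * w t) integrable_on {a..x}"
      using M cont x
      by (intro integrable_on_Icc_subset[OF absolutely_integrable_mult_continuous])
         (auto simp: ac_prim_def)
    note mM = has_integral_power_div_fact[OF M Ma x]
    have "((\<lambda>t. m t * w t - A * (\<Sum>k<n. m t * (M t ^ k / fact k))) has_integral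
      (integral {a..x} (\<lambda>t. m t * w t) - A * (\<Sum>k<n. M x ^ Suc k / fact (Suc k)))) {a..x}"
      by (intro has_integral_diff has_integral_mult_right has_integral_sum integrable_integral mw mM) simp
    moreover have "(\<lambda>t. m t * w t - A * (\<Sum>k<n. m t * (M t ^ k / fact k))) = (\<lambda>t. m t * d n t)"
      by (auto simp: d_def algebra_simps sum_distrib_left)
    ultimately have "integral {a..x} (\<lambda>t. m t * d n t) = integral {a..x} (\<lambda>t. m t * w t) - A * (\<Sum>k<n. M x ^ Suc k / fact (Suc k))"
      by (simp only: integral_unique)
    moreover have "(\<Sum>k<Suc n. M x ^ k / fact k) = 1 + (\<Sum>k<n. M x ^ Suc k / fact (Suc k))"
      by (subst sum.lessThan_Suc_shift) simp
    ultimately show "d (Suc n) x \<le> integral {a..x} (\<lambda>t. m t * d n t)"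
      using le[OF x] by (simp only: d_def distrib_left)
  qed
  have s: "(\<lambda>k. M x ^ k / fact k) sums exp (M x)"
    using exp_converges[of "M x"] by (simp add: scaleR_conv_of_real divide_inverse mult.commute)
  have "(\<lambda>n. w x - A * (\<Sum>k<n. M x ^ k / fact k)) \<longlonglongrightarrow> w x - A * exp (M x)"
    using s by (intro tendsto_intros) (simp add: sums_def)
  moreover have "(\<lambda>n. B * (M x ^ n / fact n)) \<longlonglongrightarrow> B * 0"
    using s by (intro tendsto_intros summable_LIMSEQ_zero) (auto simp: sums_iff)
  ultimately have "w x - A * exp (M x) \<le> B * 0"
    by (rule LIMSEQ_le) (use dn in \<open>auto simp: d_def\<close>)
  then show ?thesis by simp
qed

section \<open>Existence, uniqueness and Green's identity for the linear equation\<close>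

text \<open>The equation \<open>u'' = q u\<close> in the form of an integrated first-order system with \<open>v = u'\<close>, because
  \<open>q\<close> is merely integrable.\<close>

definition sl_solution ::
    "(real \<Rightarrow> complex) \<Rightarrow> real \<Rightarrow> real \<Rightarrow> (real \<Rightarrow> complex) \<Rightarrow> (real \<Rightarrow> complex) \<Rightarrow> bool"
  where "sl_solution q a b u v \<longleftrightarrow> ac_prim a b u v \<and> ac_prim a b v (\<lambda>t. q t * u t)"

text \<open>In the norm |u| + |v| the right-hand side of u' = v, v' = q u is bounded by the factor 1
  + |q|, the weight \<open>m\<close> of the existence and growth proofs.\<close>

lemma absolutely_integrable_sl_weight:
  fixes q :: "real \<Rightarrow> complex"
  assumes "q absolutely_integrable_on {a..b}"
  shows "(\<lambda>t. 1 + norm (q t)) absolutely_integrable_on {a..b}"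
  using absolutely_integrable_norm[OF assms]
  by (intro set_integral_add(1)) (auto simp: o_def)

lemma tendsto_integral_mult_uniform_limit:
  fixes p u :: "real \<Rightarrow> complex"
  assumes p: "p absolutely_integrable_on {a..b}" and U: "\<And>n. continuous_on {a..b} (U n)"
    and lim: "uniform_limit {a..b} U u sequentially" and x: "x \<in> {a..b}"
  shows "(\<lambda>n. integral {a..x} (\<lambda>t. p t * U n t)) \<longlonglongrightarrow> integral {a..x} (\<lambda>t. p t * u t)"
proof (rule tendstoI)
  fix e :: real assume "e > 0"
  have u: "continuous_on {a..b} u"
    using uniform_limit_theorem[OF _ lim] U by simp
  have pi: "(\<lambda>t. norm (p t)) integrable_on {a..x}"
    using absolutely_integrable_norm[OF p] x
    by (intro integrable_on_Icc_subset[where a = a and b = b]) (auto simp: o_def)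
  define P where "P = integral {a..x} (\<lambda>t. norm (p t))"
  have P0: "P \<ge> 0"
    unfolding P_def using pi by (intro integral_nonneg) auto
  have pu: "(\<lambda>t. p t * w t) integrable_on {a..x}" if "continuous_on {a..b} w" for w
    using x by (intro integrable_on_Icc_subset[OF absolutely_integrable_mult_continuous[OF p that]]) auto
  have "e / (P + 1) > 0" using P0 \<open>e > 0\<close> by simp
  with lim have "\<forall>\<^sub>F n in sequentially. \<forall>t\<in>{a..b}. dist (U n t) (u t) < e / (P + 1)"
    by (rule uniform_limitD)
  then show "\<forall>\<^sub>F n in sequentially. dist (integral {a..x} (\<lambda>t. p t * U n t)) (integral {a..x} (\<lambda>t. p t * u t)) < e"
  proof eventually_elim
    case (elim n)
    have "dist (integral {a..x} (\<lambda>t. p t * U n t)) (integral {a..x} (\<lambda>t. p t * u t)) =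
        norm (integral {a..x} (\<lambda>t. p t * U n t - p t * u t))"
      unfolding dist_norm by (subst Henstock_Kurzweil_Integration.integral_diff[OF pu[OF U] pu[OF u]]) simp
    also have "\<dots> \<le> integral {a..x} (\<lambda>t. e / (P + 1) * norm (p t))"
    proof (rule integral_norm_bound_integral)
      show "(\<lambda>t. p t * U n t - p t * u t) integrable_on {a..x}"
        by (intro integrable_diff pu U u)
      show "(\<lambda>t. e / (P + 1) * norm (p t)) integrable_on {a..x}"
        using pi by (rule integrable_on_mult_right)
      fix t assume "t \<in> {a..x}"
      then have "dist (U n t) (u t) < e / (P + 1)" using elim x by auto
      then show "norm (p t * U n t - p t * u t) \<le> e / (P + 1) * norm (p t)"
        by (metis dist_norm less_imp_le mult.commute mult_left_mono norm_ge_zero norm_mult right_diff_distrib)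
    qed
    also have "\<dots> = e / (P + 1) * P"
      by (simp add: P_def)
    also have "\<dots> < e"
      using P0 \<open>e > 0\<close> by (simp add: field_simps)
    finally show ?case .
  qed
qed

text \<open>Picard iteration from constant initial data. The successive differences
  \<open>d n\<close> obey the Volterra inequality with weight \<open>m\<close>, so they are at most
  B M^n / n!, and both components converge uniformly by the Weierstrass test.\<close>

lemma sl_solution_exists:
  fixes q :: "real \<Rightarrow> complex"
  assumes ab: "a \<le> b" and q: "q absolutely_integrable_on {a..b}"
  shows "\<exists>u v. sl_solution q a b u v \<and> u a = \<alpha> \<and> v a = \<beta>"
proof -
  define m where "m = (\<lambda>t. 1 + norm (q t))"
  have mi: "m absolutely_integrable_on {a..b}"
    unfolding m_def by (rule absolutely_integrable_sl_weight[OF q])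
  define M where "M = (\<lambda>x. 0 + integral {a..x} m)"
  have M: "ac_prim a b M m"
    unfolding M_def by (rule ac_prim_integral[OF mi])
  have Ma: "M a = 0" by (simp add: M_def)
  define T where "T = (\<lambda>(u, v). (\<lambda>x. \<alpha> + integral {a..x} v, \<lambda>x. \<beta> + integral {a..x} (\<lambda>t. q t * u t)))"
  define Z where "Z = (\<lambda>n. (T ^^ n) (\<lambda>_. \<alpha>, \<lambda>_. \<beta>))"
  define U where "U = (\<lambda>n. fst (Z n))"
  define W where "W = (\<lambda>n. snd (Z n))"
  have U0: "U 0 = (\<lambda>_. \<alpha>)" and W0: "W 0 = (\<lambda>_. \<beta>)"
    by (simp_all add: U_def W_def Z_def)
  have USuc: "U (Suc n) = (\<lambda>x. \<alpha> + integral {a..x} (W n))"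
    and WSuc: "W (Suc n) = (\<lambda>x. \<beta> + integral {a..x} (\<lambda>t. q t * U n t))" for n
    by (simp_all add: U_def W_def Z_def T_def case_prod_beta)
  have const: "(\<lambda>_. 1 :: complex) absolutely_integrable_on {a..b}"
    by (intro absolutely_integrable_continuous_real continuous_intros)
  have cont: "continuous_on {a..b} (U n) \<and> continuous_on {a..b} (W n)" for n
  proof (induction n)
    case (Suc n)
    then have "W n absolutely_integrable_on {a..b}" "(\<lambda>t. q t * U n t) absolutely_integrable_on {a..b}"
      by (auto intro: absolutely_integrable_mult_continuous q absolutely_integrable_continuous_real)
    then show ?case
      unfolding USuc WSuc by (auto intro: ac_prim_continuous ac_prim_integral)
  qed (auto simp: U0 W0)
  have intW: "W n integrable_on {a..x}" and intU: "(\<lambda>t. q t * U n t) integrable_on {a..x}"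
    if "x \<in> {a..b}" for n x
    using that cont
      integrable_on_Icc_subset[OF absolutely_integrable_continuous_real, of a b "W n" a x]
      integrable_on_Icc_subset[OF absolutely_integrable_mult_continuous[OF q], of "U n" a x]
    by auto
  define d where "d = (\<lambda>n x. norm (U (Suc n) x - U n x) + norm (W (Suc n) x - W n x))"
  have cd: "continuous_on {a..b} (d n)" for n
    unfolding d_def using cont by (intro continuous_intros) auto
  obtain B where B: "\<And>x. x \<in> {a..b} \<Longrightarrow> norm (d 0 x) \<le> B"
    using compact_imp_bounded[OF compact_continuous_image[OF cd compact_Icc]]
    unfolding bounded_iff by blast
  have dn: "d n x \<le> B * M x ^ n / fact n" if "x \<in> {a..b}" for n x
  proof (rule iterated_integral_bound[OF M Ma _ cd _ _ that])
    show "0 \<le> m x" for x by (simp add: m_def)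
    show "d 0 x \<le> B" if "x \<in> {a..b}" for x
      using B[OF that] by simp
    fix n x assume x: "x \<in> {a..b}"
    have e1: "U (Suc (Suc n)) x - U (Suc n) x = integral {a..x} (\<lambda>t. W (Suc n) t - W n t)"
      unfolding USuc by (subst Henstock_Kurzweil_Integration.integral_diff[OF intW[OF x] intW[OF x]]) simp
    have e2: "W (Suc (Suc n)) x - W (Suc n) x = integral {a..x} (\<lambda>t. q t * U (Suc n) t - q t * U n t)"
      unfolding WSuc by (subst Henstock_Kurzweil_Integration.integral_diff[OF intU[OF x] intU[OF x]]) simp
    have i1: "(\<lambda>t. norm (W (Suc n) t - W n t)) integrable_on {a..x}"
      using x cont continuous_on_subset[of "{a..b}" "W n" "{a..x}" for n]
      by (intro integrable_continuous_real continuous_intros) auto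
    have "(\<lambda>t. norm (q t) * norm (U (Suc n) t - U n t)) absolutely_integrable_on {a..b}"
      using absolutely_integrable_norm[OF q] cont
      by (intro absolutely_integrable_mult_continuous continuous_intros) (auto simp: o_def)
    then have i2: "(\<lambda>t. norm (q t) * norm (U (Suc n) t - U n t)) integrable_on {a..x}"
      using x by (intro integrable_on_Icc_subset) auto
    have "(\<lambda>t. m t * d n t) absolutely_integrable_on {a..b}"
      by (intro absolutely_integrable_mult_continuous mi cd)
    then have i3: "(\<lambda>t. m t * d n t) integrable_on {a..x}"
      using x by (intro integrable_on_Icc_subset) auto
    have "d (Suc n) x \<le> integral {a..x} (\<lambda>t. norm (W (Suc n) t - W n t)) +
        integral {a..x} (\<lambda>t. norm (q t) * norm (U (Suc n) t - U n t))"
      unfolding d_def e1 e2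
      by (intro add_mono integral_norm_bound_integral i1 i2 integrable_diff intU intW x)
         (auto simp: norm_mult simp flip: right_diff_distrib)
    also have "\<dots> = integral {a..x} (\<lambda>t. norm (W (Suc n) t - W n t) + norm (q t) * norm (U (Suc n) t - U n t))"
      by (rule Henstock_Kurzweil_Integration.integral_add[OF i1 i2, symmetric])
    also have "\<dots> \<le> integral {a..x} (\<lambda>t. m t * d n t)"
      by (intro integral_le integrable_add i1 i2 i3) (auto simp: m_def d_def algebra_simps)
    finally show "d (Suc n) x \<le> integral {a..x} (\<lambda>t. m t * d n t)" .
  qed
  have Mmono: "M x \<le> M b" "0 \<le> M x" if "x \<in> {a..b}" for x
  proof -
    have "m integrable_on {a..x}" "m integrable_on {a..b}"
      using that by (auto intro: integrable_on_Icc_subset[OF mi])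
    then show "M x \<le> M b" "0 \<le> M x"
      using that unfolding M_def
      by (auto simp: m_def intro!: integral_subset_le integral_nonneg)
  qed
  have B0: "B \<ge> 0"
    using B[of a] ab norm_ge_zero[of "d 0 a"] by (metis atLeastAtMost_iff order_refl order_trans)
  have dB: "norm (d n x) \<le> B * (M b ^ n / fact n)" if "x \<in> {a..b}" for n x
  proof -
    have "norm (d n x) = d n x" by (simp add: d_def)
    also have "\<dots> \<le> B * M x ^ n / fact n" by (rule dn[OF that])
    also have "\<dots> \<le> B * M b ^ n / fact n"
      using Mmono[OF that] B0 by (intro divide_right_mono mult_left_mono power_mono) auto
    finally show ?thesis by simp
  qed
  have summ: "summable (\<lambda>n. B * (M b ^ n / fact n))"
    using summable_exp[of "M b"] by (intro summable_mult) (simp add: divide_inverse mult.commute)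
  have U_lim: "\<exists>u. uniform_limit {a..b} X u sequentially"
    if "\<And>n x. x \<in> {a..b} \<Longrightarrow> norm (X (Suc n) x - X n x) \<le> norm (d n x)" for X :: "nat \<Rightarrow> real \<Rightarrow> complex"
  proof -
    have telescope: "(\<Sum>i<n. X (Suc i) x - X i x) = X n x - X 0 x" for n x
      using sum_lessThan_telescope[of "\<lambda>i. X i x" n] by simp
    have "uniform_limit {a..b} (\<lambda>n x. \<Sum>i<n. X (Suc i) x - X i x) (\<lambda>x. \<Sum>i. X (Suc i) x - X i x) sequentially"
      using that dB by (intro Weierstrass_m_test[OF _ summ]) (meson order_trans)
    then have "uniform_limit {a..b} (\<lambda>n x. X n x - X 0 x) (\<lambda>x. \<Sum>i. X (Suc i) x - X i x) sequentially"
      by (simp only: telescope)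
    then have "uniform_limit {a..b} (\<lambda>n x. X 0 x + (X n x - X 0 x)) (\<lambda>x. X 0 x + (\<Sum>i. X (Suc i) x - X i x)) sequentially"
      by (intro uniform_limit_intros)
    then show ?thesis by auto
  qed
  obtain u where u: "uniform_limit {a..b} U u sequentially"
    using U_lim[of U] by (auto simp: d_def)
  obtain w where w: "uniform_limit {a..b} W w sequentially"
    using U_lim[of W] by (auto simp: d_def)
  have cu: "continuous_on {a..b} u" and cw: "continuous_on {a..b} w"
    using uniform_limit_theorem[OF _ u] uniform_limit_theorem[OF _ w] cont by simp_all
  have eu: "u x = \<alpha> + integral {a..x} w" and ew: "w x = \<beta> + integral {a..x} (\<lambda>t. q t * u t)"
    if x: "x \<in> {a..b}" for x
  proof -
    have "(\<lambda>n. \<alpha> + integral {a..x} (\<lambda>t. 1 * W n t)) \<longlonglongrightarrow> \<alpha> + integral {a..x} (\<lambda>t. 1 * w t)"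
      using cont by (intro tendsto_intros tendsto_integral_mult_uniform_limit[OF const _ w x]) auto
    then have "(\<lambda>n. U (Suc n) x) \<longlonglongrightarrow> \<alpha> + integral {a..x} w"
      by (simp add: USuc)
    moreover have "(\<lambda>n. U (Suc n) x) \<longlonglongrightarrow> u x"
      using tendsto_uniform_limitI[OF u x] by (rule LIMSEQ_Suc)
    ultimately show "u x = \<alpha> + integral {a..x} w"
      using LIMSEQ_unique by blast
    have "(\<lambda>n. \<beta> + integral {a..x} (\<lambda>t. q t * U n t)) \<longlonglongrightarrow> \<beta> + integral {a..x} (\<lambda>t. q t * u t)"
      using cont by (intro tendsto_intros tendsto_integral_mult_uniform_limit[OF q _ u x]) auto
    then have "(\<lambda>n. W (Suc n) x) \<longlonglongrightarrow> \<beta> + integral {a..x} (\<lambda>t. q t * u t)"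
      by (simp add: WSuc)
    moreover have "(\<lambda>n. W (Suc n) x) \<longlonglongrightarrow> w x"
      using tendsto_uniform_limitI[OF w x] by (rule LIMSEQ_Suc)
    ultimately show "w x = \<beta> + integral {a..x} (\<lambda>t. q t * u t)"
      using LIMSEQ_unique by blast
  qed
  \<comment> \<open>These are primitives as functions on the whole line; they agree with the limits
    \<open>u\<close> and \<open>w\<close> on [a, b], which is all that \<open>ac_prim\<close> looks
    at.\<close>
  define u' where "u' = (\<lambda>x. \<alpha> + integral {a..x} w)"
  define w' where "w' = (\<lambda>x. \<beta> + integral {a..x} (\<lambda>t. q t * u t))"
  have "ac_prim a b u' w" "ac_prim a b w' (\<lambda>t. q t * u t)"
    unfolding u'_def w'_def
    by (intro ac_prim_integral absolutely_integrable_continuous_real absolutely_integrable_mult_continuous q cu cw)+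
  then have "ac_prim a b u w" "ac_prim a b w (\<lambda>t. q t * u t)"
    using eu ew ab by (auto simp: ac_prim_def u'_def w'_def)
  moreover have "u a = \<alpha>" "w a = \<beta>"
    using eu[of a] ew[of a] ab by auto
  ultimately show ?thesis
    unfolding sl_solution_def by blast
qed

lemma sl_solution_continuous:
  assumes "sl_solution q a b u v"
  shows "continuous_on {a..b} u" "continuous_on {a..b} v"
  using assms by (auto simp: sl_solution_def intro: ac_prim_continuous)

lemma sl_solution_subinterval:
  assumes "sl_solution q a b u v" "a \<le> c" "d \<le> b"
  shows "sl_solution q c d u v"
  using assms by (auto simp: sl_solution_def intro: ac_prim_subinterval)

lemma ac_prim_lincomb:
  fixes F G :: "real \<Rightarrow> complex"
  assumes "ac_prim a b F f" "ac_prim a b G g"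
  shows "ac_prim a b (\<lambda>x. c * F x + d * G x) (\<lambda>x. c * f x + d * g x)"
  unfolding ac_prim_def
proof (intro conjI ballI)
  show "(\<lambda>x. c * f x + d * g x) absolutely_integrable_on {a..b}"
    using assms by (intro set_integral_add(1) set_integrable_mult_right) (auto simp: ac_prim_def)
  fix x assume "x \<in> {a..b}"
  then have "((\<lambda>x. c * f x + d * g x) has_integral (c * (F x - F a) + d * (G x - G a))) {a..x}"
    using assms by (intro has_integral_add has_integral_mult_right) (auto simp: ac_prim_def)
  then show "((\<lambda>x. c * f x + d * g x) has_integral (c * F x + d * G x - (c * F a + d * G a))) {a..x}"
    by (simp add: algebra_simps)
qed

lemma sl_solution_lincomb:
  assumes "sl_solution q a b u1 v1" "sl_solution q a b u2 v2"
  shows "sl_solution q a b (\<lambda>x. c * u1 x + d * u2 x) (\<lambda>x. c * v1 x + d * v2 x)"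
  using assms ac_prim_lincomb[of a b u1 v1 u2 v2 c d]
    ac_prim_lincomb[of a b v1 "\<lambda>t. q t * u1 t" v2 "\<lambda>t. q t * u2 t" c d]
  by (simp add: sl_solution_def algebra_simps)

text \<open>Gronwall for the inhomogeneous equation. The source \<open>g\<close> = 0 yields
  uniqueness; a source proportional to a second solution yields continuous dependence on the
  spectral parameter.\<close>

lemma sl_solution_growth:
  fixes q g :: "real \<Rightarrow> complex"
  assumes q: "q absolutely_integrable_on {a..b}" and g: "g absolutely_integrable_on {a..b}"
    and u: "ac_prim a b u v" and v: "ac_prim a b v (\<lambda>t. q t * u t + g t)" and x: "x \<in> {a..b}"
  shows "norm (u x) + norm (v x) \<le>
    (norm (u a) + norm (v a) + integral {a..b} (\<lambda>t. norm (g t))) * exp (integral {a..b} (\<lambda>t. 1 + norm (q t)))"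
proof -
  define m where "m = (\<lambda>t. 1 + norm (q t))"
  have mi: "m absolutely_integrable_on {a..b}"
    unfolding m_def by (rule absolutely_integrable_sl_weight[OF q])
  define M where "M = (\<lambda>x. 0 + integral {a..x} m)"
  have M: "ac_prim a b M m"
    unfolding M_def by (rule ac_prim_integral[OF mi])
  have cu: "continuous_on {a..b} u" and cv: "continuous_on {a..b} v"
    using u v by (auto intro: ac_prim_continuous)
  define w where "w = (\<lambda>x. norm (u x) + norm (v x))"
  have cw: "continuous_on {a..b} w"
    unfolding w_def by (intro continuous_intros cu cv)
  let ?A = "norm (u a) + norm (v a) + integral {a..b} (\<lambda>t. norm (g t))"
  have gn: "(\<lambda>t. norm (g t)) absolutely_integrable_on {a..b}"
    using absolutely_integrable_norm[OF g] by (simp add: o_def)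
  have "w x \<le> ?A * exp (M x)"
  proof (rule gronwall[OF M _ _ cw _ x])
    show "M a = 0" "0 \<le> m x" for x by (simp_all add: M_def m_def)
    fix x assume x: "x \<in> {a..b}"
    have sub: "p integrable_on {a..x}" if "p absolutely_integrable_on {a..b}" for p :: "real \<Rightarrow> 'z::euclidean_space"
      using x by (intro integrable_on_Icc_subset[OF that]) auto
    have iu: "(v has_integral (u x - u a)) {a..x}" "((\<lambda>t. q t * u t + g t) has_integral (v x - v a)) {a..x}"
      using u v x by (auto simp: ac_prim_def)
    have i1: "(\<lambda>t. norm (v t)) integrable_on {a..x}"
      by (intro sub absolutely_integrable_continuous_real continuous_intros cv)
    have i2: "(\<lambda>t. norm (q t) * norm (u t)) integrable_on {a..x}"
      using absolutely_integrable_norm[OF q]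
      by (intro sub absolutely_integrable_mult_continuous continuous_intros cu) (simp add: o_def)
    have i3: "(\<lambda>t. m t * w t) integrable_on {a..x}"
      by (intro sub absolutely_integrable_mult_continuous mi cw)
    have i4: "(\<lambda>t. norm (g t)) integrable_on {a..x}"
      by (rule sub[OF gn])
    have "norm (u x - u a) \<le> integral {a..x} (\<lambda>t. norm (v t))"
      unfolding integral_unique[OF iu(1), symmetric] using iu(1) i1
      by (intro integral_norm_bound_integral) auto
    moreover have "norm (v x - v a) \<le> integral {a..x} (\<lambda>t. norm (q t) * norm (u t) + norm (g t))"
      unfolding integral_unique[OF iu(2), symmetric] using iu(2) i2 i4
      by (intro integral_norm_bound_integral integrable_add[of "\<lambda>t. norm (q t) * norm (u t)"])
         (auto simp: norm_mult intro: norm_triangle_le)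
    moreover have "norm (u x) \<le> norm (u a) + norm (u x - u a)" "norm (v x) \<le> norm (v a) + norm (v x - v a)"
      by (metis add.commute diff_add_cancel norm_triangle_ineq)+
    moreover have "integral {a..x} (\<lambda>t. norm (q t) * norm (u t) + norm (g t)) =
        integral {a..x} (\<lambda>t. norm (q t) * norm (u t)) + integral {a..x} (\<lambda>t. norm (g t))"
      by (rule Henstock_Kurzweil_Integration.integral_add[OF i2 i4])
    moreover have "integral {a..x} (\<lambda>t. norm (g t)) \<le> integral {a..b} (\<lambda>t. norm (g t))"
      using x i4 set_lebesgue_integral_eq_integral(1)[OF gn] by (intro integral_subset_le) auto
    moreover have "integral {a..x} (\<lambda>t. norm (v t)) + integral {a..x} (\<lambda>t. norm (q t) * norm (u t)) \<le>
        integral {a..x} (\<lambda>t. m t * w t)"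
      unfolding Henstock_Kurzweil_Integration.integral_add[OF i1 i2, symmetric]
      by (intro integral_le integrable_add i1 i2 i3) (auto simp: m_def w_def algebra_simps)
    ultimately show "w x \<le> ?A + integral {a..x} (\<lambda>t. m t * w t)"
      unfolding w_def by linarith
  qed
  also have "\<dots> \<le> ?A * exp (M b)"
  proof (intro mult_left_mono)
    have "M x \<le> M b"
      unfolding M_def using x integrable_on_Icc_subset[OF mi]
      by (auto simp: m_def intro!: integral_subset_le)
    then show "exp (M x) \<le> exp (M b)" by simp
    show "0 \<le> ?A"
      using set_lebesgue_integral_eq_integral(1)[OF gn] by (intro add_nonneg_nonneg integral_nonneg) auto
  qed
  finally show ?thesis
    by (simp add: w_def M_def m_def)
qed

lemma sl_solution_unique:
  assumes q: "q absolutely_integrable_on {a..b}"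
    and s: "sl_solution q a b u1 v1" "sl_solution q a b u2 v2" "u1 a = u2 a" "v1 a = v2 a" "x \<in> {a..b}"
  shows "u1 x = u2 x" "v1 x = v2 x"
proof -
  have "sl_solution q a b (\<lambda>x. 1 * u1 x + (-1) * u2 x) (\<lambda>x. 1 * v1 x + (-1) * v2 x)"
    by (rule sl_solution_lincomb[OF s(1,2)])
  then have "norm (1 * u1 x + (-1) * u2 x) + norm (1 * v1 x + (-1) * v2 x) \<le> 0"
    using sl_solution_growth[OF q, of "\<lambda>_. 0" "\<lambda>x. 1 * u1 x + (-1) * u2 x" "\<lambda>x. 1 * v1 x + (-1) * v2 x" x] s
    by (simp add: sl_solution_def)
  then have "norm (u1 x - u2 x) = 0" "norm (v1 x - v2 x) = 0"
    using norm_ge_zero[of "u1 x - u2 x"] norm_ge_zero[of "v1 x - v2 x"] unfolding mult_1 mult_minus1 diff_conv_add_uminus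
    by linarith+
  then show "u1 x = u2 x" "v1 x = v2 x" by auto
qed

text \<open>The Wronskian has the derivative (q2 - q1) u1 u2. Its constancy for equal potentials,
  the difference quotient in the spectral parameter, the reality of the eigenvalues and the Volterra
  equation are all instances.\<close>

lemma sl_green:
  assumes "sl_solution q1 a b u1 v1" "sl_solution q2 a b u2 v2" "a \<le> b"
  shows "((\<lambda>t. (q2 t - q1 t) * (u1 t * u2 t)) has_integral
    ((u1 b * v2 b - v1 b * u2 b) - (u1 a * v2 a - v1 a * u2 a))) {a..b}"
proof -
  have "ac_prim a b (\<lambda>x. u1 x * v2 x) (\<lambda>x. v1 x * v2 x + u1 x * (q2 x * u2 x))"
    "ac_prim a b (\<lambda>x. v1 x * u2 x) (\<lambda>x. q1 x * u1 x * u2 x + v1 x * v2 x)"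
    using assms by (auto simp: sl_solution_def intro!: ac_prim_mult)
  from ac_prim_lincomb[OF this, of 1 "-1"] show ?thesis
    using \<open>a \<le> b\<close> by (simp add: ac_prim_def algebra_simps)
qed

section \<open>The characteristic function of the Dirichlet problem\<close>

text \<open>The pair of a solution and its derivative with prescribed data at \<open>a\<close>;
  uniqueness fixes its values on [a, b] only. In the notation of the overview,
  \<open>sine_sol\<close> is phi, \<open>cosine_sol\<close> is theta and \<open>char_fn\<close> is
  F.\<close>

definition sl_sol :: "(real \<Rightarrow> real) \<Rightarrow> real \<Rightarrow> real \<Rightarrow> complex \<Rightarrow> complex \<Rightarrow> complex \<Rightarrow>
    (real \<Rightarrow> complex) \<times> (real \<Rightarrow> complex)"
  where "sl_sol V a b \<alpha> \<beta> l = (SOME p. sl_solution (\<lambda>t. of_real (V t) - l) a b (fst p) (snd p) \<and>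
    fst p a = \<alpha> \<and> snd p a = \<beta>)"

abbreviation "sine_sol V a b l \<equiv> fst (sl_sol V a b 0 1 l)"
abbreviation "dsine_sol V a b l \<equiv> snd (sl_sol V a b 0 1 l)"
abbreviation "cosine_sol V a b l \<equiv> fst (sl_sol V a b 1 0 l)"
abbreviation "dcosine_sol V a b l \<equiv> snd (sl_sol V a b 1 0 l)"

definition char_fn :: "(real \<Rightarrow> real) \<Rightarrow> real \<Rightarrow> real \<Rightarrow> complex \<Rightarrow> complex"
  where "char_fn V a b l = sine_sol V a b l b"

lemma sl_green_unit:
  assumes "sl_solution q a b u1 v1" "sl_solution q a b u2 v2" "x \<in> {a..b}"
  shows "u1 x * v2 x - v1 x * u2 x = u1 a * v2 a - v1 a * u2 a"
proof -
  have "sl_solution q a x u1 v1" "sl_solution q a x u2 v2" "a \<le> x"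
    using assms by (auto intro: sl_solution_subinterval)
  from sl_green[OF this]
  have "((\<lambda>t. 0) has_integral ((u1 x * v2 x - v1 x * u2 x) - (u1 a * v2 a - v1 a * u2 a))) {a..x}"
    by simp
  then show ?thesis
    by simp
qed

lemma ac_prim_C1:
  fixes F :: "real \<Rightarrow> complex"
  assumes "\<And>t. t \<in> {a..b} \<Longrightarrow> (F has_vector_derivative f t) (at t within {a..b})" "continuous_on {a..b} f"
  shows "ac_prim a b F f"
  unfolding ac_prim_def
proof (intro conjI ballI)
  show "f absolutely_integrable_on {a..b}"
    by (rule absolutely_integrable_continuous_real[OF assms(2)])
  fix x assume x: "x \<in> {a..b}"
  show "(f has_integral (F x - F a)) {a..x}"
  proof (rule fundamental_theorem_of_calculus)
    fix t assume "t \<in> {a..x}"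
    then show "(F has_vector_derivative f t) (at t within {a..x})"
      using x by (intro has_vector_derivative_within_subset[OF assms(1)]) auto
  qed (use x in auto)
qed

lemma cmod_sin_le: "cmod (sin w) \<le> exp \<bar>Im w\<bar>"
proof -
  have "cmod (exp (\<i> * w)) \<le> exp \<bar>Im w\<bar>" "cmod (exp (- (\<i> * w))) \<le> exp \<bar>Im w\<bar>"
    by (auto simp: norm_exp_eq_Re)
  then have "cmod (exp (\<i> * w) - exp (- (\<i> * w))) \<le> 2 * exp \<bar>Im w\<bar>"
    by (smt (verit) norm_triangle_ineq4)
  then show ?thesis
    by (simp add: sin_exp_eq norm_divide norm_mult)
qed

text \<open>A free solution in \<open>t\<close> with value 0 and slope -1 at \<open>x\<close>.
  Paired with a perturbed solution in Green's identity it yields the Volterra equation, since the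
  terms with z^2 cancel and only \<open>V\<close> remains in the kernel.\<close>

lemma sl_solution_backward_sine:
  assumes "z \<noteq> 0"
  shows "sl_solution (\<lambda>_. - (z^2)) a b (\<lambda>t. sin (z * of_real (x - t)) / z) (\<lambda>t. - cos (z * of_real (x - t)))"
  unfolding sl_solution_def
proof (intro conjI ac_prim_C1)
  fix t :: real
  have "((\<lambda>w. sin (z * (of_real x - w)) / z) has_field_derivative - cos (z * of_real (x - t))) (at (of_real t))"
    using assms by (auto intro!: derivative_eq_intros simp: field_simps)
  from has_vector_derivative_real_field[OF this]
  show "((\<lambda>t. sin (z * of_real (x - t)) / z) has_vector_derivative - cos (z * of_real (x - t))) (at t within {a..b})"
    by simp
  have "((\<lambda>w. - cos (z * (of_real x - w))) has_field_derivative - (z^2) * (sin (z * of_real (x - t)) / z)) (at (of_real t))"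
    using assms by (auto intro!: derivative_eq_intros simp: field_simps power2_eq_square)
  from has_vector_derivative_real_field[OF this]
  show "((\<lambda>t. - cos (z * of_real (x - t))) has_vector_derivative - (z^2) * (sin (z * of_real (x - t)) / z)) (at t within {a..b})"
    by simp
qed (use assms in \<open>auto intro!: continuous_intros\<close>)

locale sl_problem =
  fixes V :: "real \<Rightarrow> real" and a b :: real
  assumes ab: "a < b" and V: "V absolutely_integrable_on {a..b}"
begin

abbreviation "pot l \<equiv> \<lambda>t. complex_of_real (V t) - l"

lemma V_complex: "(\<lambda>t. complex_of_real (V t)) absolutely_integrable_on {a..b}"
  using absolutely_integrable_linear[OF V bounded_linear_of_real] by (simp add: o_def)

lemma pot: "pot l absolutely_integrable_on {a..b}"
  by (rule set_integral_diff(1)[OF V_complex absolutely_integrable_continuous_real[OF continuous_on_const]])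

lemma sl_sol:
  "sl_solution (pot l) a b (fst (sl_sol V a b \<alpha> \<beta> l)) (snd (sl_sol V a b \<alpha> \<beta> l))"
  "fst (sl_sol V a b \<alpha> \<beta> l) a = \<alpha>" "snd (sl_sol V a b \<alpha> \<beta> l) a = \<beta>"
proof -
  have "\<exists>p. sl_solution (pot l) a b (fst p) (snd p) \<and> fst p a = \<alpha> \<and> snd p a = \<beta>"
  proof -
    obtain u v where "sl_solution (pot l) a b u v \<and> u a = \<alpha> \<and> v a = \<beta>"
      using sl_solution_exists[OF less_imp_le[OF ab] pot] by blast
    then show ?thesis by (intro exI[of _ "(u, v)"]) simp
  qed
  from someI_ex[OF this] show
    "sl_solution (pot l) a b (fst (sl_sol V a b \<alpha> \<beta> l)) (snd (sl_sol V a b \<alpha> \<beta> l))"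
    "fst (sl_sol V a b \<alpha> \<beta> l) a = \<alpha>" "snd (sl_sol V a b \<alpha> \<beta> l) a = \<beta>"
    unfolding sl_sol_def by auto
qed

lemma sl_sol_unique:
  assumes "sl_solution (pot l) a b u v" "u a = \<alpha>" "v a = \<beta>" "x \<in> {a..b}"
  shows "u x = fst (sl_sol V a b \<alpha> \<beta> l) x" "v x = snd (sl_sol V a b \<alpha> \<beta> l) x"
  using sl_solution_unique[OF pot assms(1) sl_sol(1)[of l \<alpha> \<beta>] _ _ assms(4)] assms(2,3)
  by (simp_all add: sl_sol(2,3))

lemma wronskian:
  assumes "x \<in> {a..b}"
  shows "sine_sol V a b l x * dcosine_sol V a b l x - dsine_sol V a b l x * cosine_sol V a b l x = -1"
  using sl_green_unit[OF sl_sol(1)[of l 0 1] sl_sol(1)[of l 1 0] assms] by (simp add: sl_sol)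

text \<open>The potential and the initial data 0 and 1 are real, so conjugation maps the solution
  for \<open>l\<close> to the one for \<open>cnj l\<close>.\<close>

lemma sine_sol_real:
  "x \<in> {a..b} \<Longrightarrow> sine_sol V a b (cnj l) x = cnj (sine_sol V a b l x)"
proof -
  assume x: "x \<in> {a..b}"
  let ?u = "sine_sol V a b l" and ?v = "dsine_sol V a b l"
  have int_cnj: "ac_prim a b (\<lambda>x. cnj (F x)) (\<lambda>x. cnj (f x))" if "ac_prim a b F f" for F f
    unfolding ac_prim_def
  proof (intro conjI ballI)
    show "(\<lambda>x. cnj (f x)) absolutely_integrable_on {a..b}"
      using that absolutely_integrable_linear[OF _ bounded_linear_cnj, where f = f]
      by (simp add: ac_prim_def o_def)
    show "((\<lambda>x. cnj (f x)) has_integral (cnj (F y) - cnj (F a))) {a..y}" if "y \<in> {a..b}" for y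
      using has_integral_linear[OF _ bounded_linear_cnj, where f = f and y = "F y - F a" and S = "{a..y}"]
        \<open>ac_prim a b F f\<close> that
      by (simp add: ac_prim_def o_def)
  qed
  have "sl_solution (pot (cnj l)) a b (\<lambda>x. cnj (?u x)) (\<lambda>x. cnj (?v x))"
    using int_cnj[of ?u ?v] int_cnj[of ?v "\<lambda>t. pot l t * ?u t"] sl_sol(1)[of l 0 1]
    by (simp add: sl_solution_def)
  from sl_sol_unique(1)[OF this, of 0 1 x] show ?thesis
    using x by (simp add: sl_sol)
qed

section \<open>Derivative of the characteristic function; its zeros are real and simple\<close>

text \<open>The solution that vanishes at \<open>b\<close> with slope \<open>-1\<close>.  Green's identity for the pair of
  \<open>sine_sol V a b l\<close> and \<open>psi m\<close> yields the difference quotient of the characteristic function.\<close>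

definition psi :: "complex \<Rightarrow> real \<Rightarrow> complex"
  where "psi l x = char_fn V a b l * cosine_sol V a b l x - cosine_sol V a b l b * sine_sol V a b l x"

definition dpsi :: "complex \<Rightarrow> real \<Rightarrow> complex"
  where "dpsi l x = char_fn V a b l * dcosine_sol V a b l x - cosine_sol V a b l b * dsine_sol V a b l x"

lemma psi:
  "sl_solution (pot l) a b (psi l) (dpsi l)" "psi l b = 0" "dpsi l b = -1" "psi l a = char_fn V a b l"
proof -
  have "psi l = (\<lambda>x. char_fn V a b l * cosine_sol V a b l x + (- cosine_sol V a b l b) * sine_sol V a b l x)"
    "dpsi l = (\<lambda>x. char_fn V a b l * dcosine_sol V a b l x + (- cosine_sol V a b l b) * dsine_sol V a b l x)"
    by (auto simp: psi_def dpsi_def)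
  then show "sl_solution (pot l) a b (psi l) (dpsi l)"
    using sl_solution_lincomb[OF sl_sol(1) sl_sol(1)] by presburger
  show "psi l b = 0" by (simp add: psi_def char_fn_def)
  show "dpsi l b = -1"
    using wronskian[of b l] ab by (simp add: dpsi_def char_fn_def mult.commute)
  show "psi l a = char_fn V a b l"
    by (simp add: psi_def sl_sol)
qed

lemma continuous_sols: "continuous_on {a..b} (sine_sol V a b l)" "continuous_on {a..b} (psi l)"
  using sl_solution_continuous[OF sl_sol(1)] sl_solution_continuous[OF psi(1)] by auto

lemma char_fn_diff:
  "char_fn V a b l - char_fn V a b m = - (l - m) * integral {a..b} (\<lambda>t. sine_sol V a b l t * psi m t)"
proof -
  let ?u = "sine_sol V a b l"
  have "((\<lambda>t. (l - m) * (?u t * psi m t)) has_integral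
      ((?u b * dpsi m b - dsine_sol V a b l b * psi m b) - (?u a * dpsi m a - dsine_sol V a b l a * psi m a))) {a..b}"
    using sl_green[OF sl_sol(1)[of l 0 1] psi(1)[of m]] ab by simp
  then have "((\<lambda>t. (l - m) * (?u t * psi m t)) has_integral (- char_fn V a b l + char_fn V a b m)) {a..b}"
    by (simp add: psi sl_sol char_fn_def[of V a b l])
  then have "integral {a..b} (\<lambda>t. (l - m) * (?u t * psi m t)) = - char_fn V a b l + char_fn V a b m"
    by (rule integral_unique)
  then have "(l - m) * integral {a..b} (\<lambda>t. ?u t * psi m t) = - char_fn V a b l + char_fn V a b m"
    by simp
  then show ?thesis
    by (simp add: left_diff_distrib) (metis minus_diff_eq)
qed

text \<open>The difference of the solutions for \<open>l\<close> and \<open>m\<close> solves the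
  equation for \<open>l\<close> with zero initial data and, as source, (m - l) times the solution
  for \<open>m\<close>, so the growth estimate applies.\<close>

lemma sine_sol_lipschitz:
  "\<exists>K\<ge>0. \<forall>l. cmod (l - m) \<le> 1 \<longrightarrow> (\<forall>x\<in>{a..b}. cmod (sine_sol V a b l x - sine_sol V a b m x) \<le> K * cmod (l - m))"
proof -
  let ?I = "integral {a..b} (\<lambda>t. cmod (sine_sol V a b m t))"
  \<comment> \<open>An upper bound for the integral of 1 + |V - l| that is uniform in
    \<open>l\<close>, from |l| \<le> |m| + 1.\<close>
  let ?W = "integral {a..b} (\<lambda>t. (1 + cmod m + 1) + \<bar>V t\<bar>)"
  have cu: "continuous_on {a..b} (\<lambda>t. cmod (sine_sol V a b m t))"
    by (intro continuous_intros continuous_sols)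
  have I0: "?I \<ge> 0"
    by (intro integral_nonneg integrable_continuous_real cu) auto
  have Vi: "(\<lambda>t. \<bar>V t\<bar>) integrable_on {a..b}"
    using absolutely_integrable_norm[OF V] by (auto simp: o_def intro: set_lebesgue_integral_eq_integral(1))
  have "cmod (sine_sol V a b l x - sine_sol V a b m x) \<le> ?I * exp ?W * cmod (l - m)"
    if l: "cmod (l - m) \<le> 1" and x: "x \<in> {a..b}" for l x
  proof -
    let ?u = "sine_sol V a b l" and ?v = "dsine_sol V a b l" and ?u' = "sine_sol V a b m" and ?v' = "dsine_sol V a b m"
    let ?g = "\<lambda>t. (m - l) * ?u' t"
    define U where "U = (\<lambda>t. 1 * ?u t + (-1) * ?u' t)"
    define W where "W = (\<lambda>t. 1 * ?v t + (-1) * ?v' t)"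
    have g: "?g absolutely_integrable_on {a..b}"
      by (intro absolutely_integrable_continuous_real continuous_intros continuous_sols)
    have "ac_prim a b U W"
      unfolding U_def W_def using sl_sol(1)[of l 0 1] sl_sol(1)[of m 0 1]
      by (intro ac_prim_lincomb) (auto simp: sl_solution_def)
    moreover have "ac_prim a b W (\<lambda>t. 1 * (pot l t * ?u t) + (-1) * (pot m t * ?u' t))"
      unfolding W_def using sl_sol(1)[of l 0 1] sl_sol(1)[of m 0 1]
      by (intro ac_prim_lincomb) (auto simp: sl_solution_def)
    moreover have "(\<lambda>t. 1 * (pot l t * ?u t) + (-1) * (pot m t * ?u' t)) = (\<lambda>t. pot l t * U t + ?g t)"
      by (auto simp: U_def algebra_simps)
    ultimately have "cmod (U x) + cmod (W x) \<le> (cmod (U a) + cmod (W a) + integral {a..b} (\<lambda>t. cmod (?g t))) *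
        exp (integral {a..b} (\<lambda>t. 1 + cmod (pot l t)))"
      using g x by (intro sl_solution_growth pot) simp_all
    also have "U a = 0" by (simp add: U_def sl_sol)
    also have "W a = 0" by (simp add: W_def sl_sol)
    also have "integral {a..b} (\<lambda>t. cmod (?g t)) = cmod (l - m) * ?I"
      by (simp add: norm_mult norm_minus_commute)
    also have "(cmod 0 + cmod 0 + cmod (l - m) * ?I) * exp (integral {a..b} (\<lambda>t. 1 + cmod (pot l t))) \<le>
        (cmod (l - m) * ?I) * exp ?W"
    proof -
      have "integral {a..b} (\<lambda>t. 1 + cmod (pot l t)) \<le> ?W"
      proof (rule integral_le)
        show "(\<lambda>t. 1 + cmod (pot l t)) integrable_on {a..b}"
          using absolutely_integrable_sl_weight[OF pot] by (rule set_lebesgue_integral_eq_integral(1))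
        show "(\<lambda>t. (1 + cmod m + 1) + \<bar>V t\<bar>) integrable_on {a..b}"
          by (intro integrable_add Vi integrable_const_ivl)
        fix t
        have "cmod (pot l t) \<le> \<bar>V t\<bar> + cmod l"
          by (metis norm_of_real norm_triangle_ineq4)
        moreover have "cmod l \<le> cmod m + 1"
          using l norm_triangle_ineq2[of l m] by linarith
        ultimately show "1 + cmod (pot l t) \<le> (1 + cmod m + 1) + \<bar>V t\<bar>" by linarith
      qed
      then show ?thesis
        using I0 by (simp add: mult_left_mono)
    qed
    finally have "cmod (U x) \<le> cmod (l - m) * ?I * exp ?W"
      using norm_ge_zero[of "W x"] by linarith
    then show ?thesis
      by (simp add: U_def mult_ac)
  qed
  then show ?thesis
    using I0 by (intro exI[of _ "?I * exp ?W"]) auto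
qed

text \<open>By \<open>char_fn_diff\<close> the difference quotient equals the negative of
  \<open>?J l\<close> with no remainder, so differentiability reduces to continuity of
  \<open>?J\<close> at \<open>m\<close>.\<close>

lemma char_fn_deriv:
  "(char_fn V a b has_field_derivative - integral {a..b} (\<lambda>t. sine_sol V a b m t * psi m t)) (at m)"
proof -
  let ?J = "\<lambda>l. integral {a..b} (\<lambda>t. sine_sol V a b l t * psi m t)"
  obtain K where K: "K \<ge> 0" "\<And>l x. cmod (l - m) \<le> 1 \<Longrightarrow> x \<in> {a..b} \<Longrightarrow>
      cmod (sine_sol V a b l x - sine_sol V a b m x) \<le> K * cmod (l - m)"
    using sine_sol_lipschitz[of m] by blast
  let ?P = "integral {a..b} (\<lambda>t. cmod (psi m t))"
  have ci: "(\<lambda>t. sine_sol V a b l t * psi m t) integrable_on {a..b}" for l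
    by (intro integrable_continuous_real continuous_intros continuous_sols)
  have bound: "cmod (?J l - ?J m) \<le> K * ?P * cmod (l - m)" if l: "cmod (l - m) \<le> 1" for l
  proof -
    have eq: "?J l - ?J m = integral {a..b} (\<lambda>t. sine_sol V a b l t * psi m t - sine_sol V a b m t * psi m t)"
      by (rule Henstock_Kurzweil_Integration.integral_diff[OF ci ci, symmetric])
    have "cmod (?J l - ?J m) \<le> integral {a..b} (\<lambda>t. (K * cmod (l - m)) * cmod (psi m t))"
      unfolding eq
    proof (rule integral_norm_bound_integral)
      show "(\<lambda>t. (K * cmod (l - m)) * cmod (psi m t)) integrable_on {a..b}"
        by (intro integrable_continuous_real continuous_intros continuous_sols)
      fix t assume "t \<in> {a..b}"
      then show "cmod (sine_sol V a b l t * psi m t - sine_sol V a b m t * psi m t) \<le> (K * cmod (l - m)) * cmod (psi m t)"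
        using K(2)[OF l] by (simp add: norm_mult mult_right_mono flip: left_diff_distrib)
    qed (intro integrable_diff ci)
    also have "\<dots> = K * cmod (l - m) * ?P"
      by (rule Henstock_Kurzweil_Integration.integral_mult_right)
    finally show ?thesis by (simp only: mult_ac)
  qed
  have "(?J \<longlongrightarrow> ?J m) (at m)"
  proof (rule LIM_zero_cancel, rule Lim_null_comparison)
    have "\<forall>\<^sub>F l in at m. dist l m < 1"
      unfolding eventually_at by (auto intro: exI[of _ 1])
    then show "\<forall>\<^sub>F l in at m. cmod (?J l - ?J m) \<le> K * ?P * cmod (l - m)"
    proof eventually_elim
      case (elim l)
      then show ?case using bound[of l] by (simp only: dist_norm less_imp_le)
    qed
    have "((\<lambda>l. K * ?P * cmod (l - m)) \<longlongrightarrow> K * ?P * cmod (m - m)) (at m)"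
      by (intro tendsto_intros)
    then show "((\<lambda>l. K * ?P * cmod (l - m)) \<longlongrightarrow> 0) (at m)" by simp
  qed
  then have "((\<lambda>l. - ?J l) \<longlongrightarrow> - ?J m) (at m)"
    by (rule tendsto_minus)
  moreover have "\<forall>\<^sub>F l in at m. - ?J l = (char_fn V a b l - char_fn V a b m) / (l - m)"
    using eventually_neq_at_within[of m m] 
  proof eventually_elim
    case (elim l)
    have "l - m \<noteq> 0"
      using elim by simp
    then have "- (l - m) * ?J l / (l - m) = - ?J l"
      by (metis minus_divide_left mult_minus_left nonzero_mult_div_cancel_left)
    then show ?case
      unfolding char_fn_diff ..
  qed
  ultimately show ?thesis
    unfolding has_field_derivative_iff by (rule Lim_transform_eventually)
qed

lemma char_fn_holomorphic: "char_fn V a b holomorphic_on S"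
  by (meson char_fn_deriv field_differentiable_at_within field_differentiable_def holomorphic_on_def)

text \<open>At a zero, \<open>psi\<close> is a multiple of the sine solution itself, with factor
  minus the cosine solution at \<open>b\<close>.\<close>

lemma char_fn_deriv_at_zero:
  assumes "char_fn V a b l = 0"
  shows "deriv (char_fn V a b) l = cosine_sol V a b l b * integral {a..b} (\<lambda>t. (sine_sol V a b l t)^2)"
proof -
  have "(\<lambda>t. sine_sol V a b l t * psi l t) = (\<lambda>t. - cosine_sol V a b l b * (sine_sol V a b l t)^2)"
    using assms by (auto simp: psi_def power2_eq_square algebra_simps)
  then show ?thesis
    using DERIV_imp_deriv[OF char_fn_deriv[of l]] by simp
qed

text \<open>If the integral vanished, the solution would be 0 throughout; its derivative would then
  keep the initial value 1, and the values at \<open>a\<close> and \<open>b\<close> would differ by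
  b - a.\<close>

lemma integral_cmod_sine_sol_pos: "integral {a..b} (\<lambda>t. (cmod (sine_sol V a b l t))^2) > 0"
proof -
  let ?u = "sine_sol V a b l" and ?v = "dsine_sol V a b l"
  have c: "continuous_on {a..b} (\<lambda>t. (cmod (?u t))^2)"
    by (intro continuous_intros continuous_sols)
  have ge: "integral {a..b} (\<lambda>t. (cmod (?u t))^2) \<ge> 0"
    by (intro integral_nonneg integrable_continuous_real c) auto
  have False if "integral {a..b} (\<lambda>t. (cmod (?u t))^2) = 0"
  proof -
    have "((\<lambda>t. (cmod (?u t))^2) has_integral 0) (cbox a b)"
      using that integrable_integral[OF integrable_continuous_real[OF c]] by simp
    then have z: "?u t = 0" if "t \<in> {a..b}" for t
      using has_integral_0_cbox_imp_0[of a b "\<lambda>t. (cmod (?u t))^2" t] c ab that by auto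
    have v1: "?v t = 1" if "t \<in> {a..b}" for t
    proof -
      have "((\<lambda>s. pot l s * ?u s) has_integral (?v t - ?v a)) {a..t}"
        using sl_sol(1)[of l 0 1] that by (simp add: sl_solution_def ac_prim_def)
      moreover have "((\<lambda>s. pot l s * ?u s) has_integral 0) {a..t}"
        using z that by (intro has_integral_is_0) auto
      ultimately have "?v t - ?v a = 0"
        by (rule has_integral_unique)
      then show ?thesis by (simp add: sl_sol)
    qed
    have "((\<lambda>_. 1) has_integral (?u b - ?u a)) {a..b}"
    proof (rule has_integral_eq[OF v1])
      show "(?v has_integral (?u b - ?u a)) {a..b}"
        using sl_sol(1)[of l 0 1] ab by (simp add: sl_solution_def ac_prim_def)
    qed
    moreover have "((\<lambda>_. 1::complex) has_integral (measure lborel {a..b} *\<^sub>R 1)) {a..b}"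
      by (rule has_integral_const_real)
    ultimately have "?u b - ?u a = measure lborel {a..b} *\<^sub>R 1"
      by (rule has_integral_unique)
    moreover have "?u b = 0" "?u a = 0"
      using z[of a] z[of b] ab by simp_all
    ultimately show False
      using ab by (simp add: scaleR_conv_of_real)
  qed
  then show ?thesis using ge by (metis order_le_less)
qed

text \<open>Symmetry of the operator in the form of Green's identity for \<open>l\<close> and
  \<open>cnj l\<close>: both solutions vanish at both ends, so (cnj l - l) times the integral of
  |u|^2 is 0.\<close>

lemma char_fn_zero_real:
  assumes "char_fn V a b l = 0"
  shows "l \<in> \<real>"
proof -
  let ?u = "sine_sol V a b l"
  have hi: "((\<lambda>t. (cnj l - l) * (?u t * sine_sol V a b (cnj l) t)) has_integral
      (- 1) * 0) {a..b}"
    using sl_green[OF sl_sol(1)[of "cnj l" 0 1] sl_sol(1)[of l 0 1]] ab assms sine_sol_real[of b l]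
    by (simp add: sl_sol char_fn_def mult_ac)
  have eq: "?u t * sine_sol V a b (cnj l) t = of_real ((cmod (?u t))^2)" if "t \<in> {a..b}" for t
    unfolding sine_sol_real[OF that] complex_norm_square ..
  have "((\<lambda>t. (cnj l - l) * of_real ((cmod (?u t))^2)) has_integral (- 1) * 0) {a..b}"
    by (rule has_integral_eq[OF _ hi]) (simp only: eq)
  then have "integral {a..b} (\<lambda>t. (cnj l - l) * of_real ((cmod (?u t))^2)) = (- 1) * 0"
    by (rule integral_unique)
  then have "(cnj l - l) * integral {a..b} (\<lambda>t. of_real ((cmod (?u t))^2)) = 0"
    by simp
  moreover have "integral {a..b} (\<lambda>t. complex_of_real ((cmod (?u t))^2)) = of_real (integral {a..b} (\<lambda>t. (cmod (?u t))^2))"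
    by (intro integral_unique has_integral_of_real integrable_integral integrable_continuous_real continuous_intros continuous_sols)
  ultimately have "cnj l = l"
    using integral_cmod_sine_sol_pos[of l] by simp
  then show ?thesis
    using Reals_cnj_iff by blast
qed

text \<open>A zero is real, so its solution is real and the integral of the square is the positive
  integral of the squared modulus. The Wronskian at \<open>b\<close> excludes a zero of the cosine
  solution there.\<close>

lemma char_fn_zero_simple:
  assumes "char_fn V a b l = 0"
  shows "integral {a..b} (\<lambda>t. (sine_sol V a b l t)^2) \<noteq> 0" "deriv (char_fn V a b) l \<noteq> 0"
proof -
  have "cnj l = l"
    using char_fn_zero_real[OF assms] Reals_cnj_iff by blast
  then have "(sine_sol V a b l t)^2 = of_real ((cmod (sine_sol V a b l t))^2)" if "t \<in> {a..b}" for t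
    using sine_sol_real[OF that, of l] by (metis complex_norm_square power2_eq_square)
  then have "integral {a..b} (\<lambda>t. (sine_sol V a b l t)^2) = integral {a..b} (\<lambda>t. complex_of_real ((cmod (sine_sol V a b l t))^2))"
    by (intro integral_cong)
  also have "\<dots> = of_real (integral {a..b} (\<lambda>t. (cmod (sine_sol V a b l t))^2))"
    by (intro integral_unique has_integral_of_real integrable_integral integrable_continuous_real continuous_intros continuous_sols)
  finally show ne: "integral {a..b} (\<lambda>t. (sine_sol V a b l t)^2) \<noteq> 0"
    using integral_cmod_sine_sol_pos[of l] by simp
  have "cosine_sol V a b l b \<noteq> 0"
    using wronskian[of b l] ab assms by (auto simp: char_fn_def)
  then show "deriv (char_fn V a b) l \<noteq> 0"
    using char_fn_deriv_at_zero[OF assms] ne by simp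
qed

section \<open>Volterra equation and behaviour for large spectral parameter\<close>

lemma sine_sol_volterra:
  assumes z: "z \<noteq> 0" and x: "x \<in> {a..b}"
  shows "((\<lambda>t. of_real (V t) * (sine_sol V a b (z^2) t * (sin (z * of_real (x - t)) / z))) has_integral
    (sine_sol V a b (z^2) x - sin (z * of_real (x - a)) / z)) {a..x}"
proof -
  let ?u = "sine_sol V a b (z^2)" and ?v = "dsine_sol V a b (z^2)"
  have "sl_solution (pot (z^2)) a x ?u ?v"
    using x by (intro sl_solution_subinterval[OF sl_sol(1)]) auto
  from sl_green[OF this sl_solution_backward_sine[OF z, of a x x]]
  have "((\<lambda>t. - (of_real (V t) * (?u t * (sin (z * of_real (x - t)) / z)))) has_integral
    (- (?u x) + sin (z * of_real (x - a)) / z)) {a..x}"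
    using x by (simp add: sl_sol)
  from has_integral_neg[OF this] show ?thesis by simp
qed

text \<open>\<open>w\<close> is the modulus with the growth exp(|Im z| (t - a)) divided out.
  Gronwall in the Volterra equation gives \<open>w\<close> = O(1/|z|), and inserting this bound into
  the integral, whose kernel has another factor 1/|z|, gives the square.\<close>

lemma sine_sol_asymptotics:
  "\<exists>C\<ge>0. \<forall>z x. cmod z \<ge> 1 \<longrightarrow> x \<in> {a..b} \<longrightarrow>
    cmod (sine_sol V a b (z^2) x - sin (z * of_real (x - a)) / z) \<le> C * exp (\<bar>Im z\<bar> * (x - a)) / (cmod z)^2"
proof -
  define m where "m = (\<lambda>t. \<bar>V t\<bar>)"
  have mi: "m absolutely_integrable_on {a..b}"
    using absolutely_integrable_norm[OF V] by (simp add: m_def o_def)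
  define M where "M = (\<lambda>x. 0 + integral {a..x} m)"
  have M: "ac_prim a b M m"
    unfolding M_def by (rule ac_prim_integral[OF mi])
  have mint: "m integrable_on {a..x}" if "x \<in> {a..b}" for x
    using that by (intro integrable_on_Icc_subset[OF mi]) auto
  have Mle: "M x \<le> M b" if "x \<in> {a..b}" for x
    using that mint[of x] mint[of b] unfolding M_def by (auto simp: m_def intro!: integral_subset_le)
  have M0: "M b \<ge> 0"
    using mint[of b] ab unfolding M_def by (auto simp: m_def intro!: integral_nonneg)
  have main: "cmod (sine_sol V a b (z^2) x - sin (z * of_real (x - a)) / z) \<le>
      (exp (M b) * M b) * exp (\<bar>Im z\<bar> * (x - a)) / (cmod z)^2"
    if z: "cmod z \<ge> 1" and x: "x \<in> {a..b}" for z x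
  proof -
    let ?k = "\<bar>Im z\<bar>" and ?u = "sine_sol V a b (z^2)"
    have z0: "z \<noteq> 0" using z by auto
    define w where "w = (\<lambda>t. cmod (?u t) * exp (- (?k * (t - a))))"
    have cw: "continuous_on {a..b} w"
      unfolding w_def by (intro continuous_intros continuous_sols)
    have sin_le: "cmod (sin (z * of_real (y - t)) / z) \<le> exp (?k * (y - t)) / cmod z" if "t \<le> y" for t y
      using cmod_sin_le[of "z * of_real (y - t)"] that
      by (auto simp: norm_divide abs_mult intro!: divide_right_mono)
    have mw: "(\<lambda>t. m t * w t) integrable_on {a..y}" if "y \<in> {a..b}" for y
      using that by (intro integrable_on_Icc_subset[OF absolutely_integrable_mult_continuous[OF mi cw]]) auto
    have err: "cmod (?u y - sin (z * of_real (y - a)) / z) \<le>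
        exp (?k * (y - a)) / cmod z * integral {a..y} (\<lambda>t. m t * w t)" if y: "y \<in> {a..b}" for y
    proof -
      note vol = sine_sol_volterra[OF z0 y]
      have "cmod (integral {a..y} (\<lambda>t. of_real (V t) * (?u t * (sin (z * of_real (y - t)) / z)))) \<le>
          integral {a..y} (\<lambda>t. exp (?k * (y - a)) / cmod z * (m t * w t))"
      proof (rule integral_norm_bound_integral)
        show "(\<lambda>t. exp (?k * (y - a)) / cmod z * (m t * w t)) integrable_on {a..y}"
          using mw[OF y] by (rule integrable_on_mult_right)
        show "(\<lambda>t. of_real (V t) * (?u t * (sin (z * of_real (y - t)) / z))) integrable_on {a..y}"
          using vol by blast
        fix t assume t: "t \<in> {a..y}"
        have "cmod (of_real (V t) * (?u t * (sin (z * of_real (y - t)) / z))) =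
            m t * (cmod (?u t) * cmod (sin (z * of_real (y - t)) / z))"
          by (simp only: norm_mult m_def norm_of_real)
        also have "\<dots> \<le> m t * (cmod (?u t) * (exp (?k * (y - t)) / cmod z))"
          using t sin_le[of t y] by (intro mult_left_mono) (auto simp: m_def)
        also have "exp (?k * (y - t)) = exp (?k * (y - a)) * exp (- (?k * (t - a)))"
          unfolding exp_add[symmetric] by (simp add: algebra_simps)
        finally show "cmod (of_real (V t) * (?u t * (sin (z * of_real (y - t)) / z))) \<le>
            exp (?k * (y - a)) / cmod z * (m t * w t)"
          by (simp add: w_def mult_ac)
      qed
      then show ?thesis
        unfolding integral_unique[OF vol] by simp
    qed
    have wle: "w y \<le> (1 / cmod z) * exp (M y)" if "y \<in> {a..b}" for y
    proof (rule gronwall[OF M _ _ cw _ that])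
      show "M a = 0" "0 \<le> m y" for y by (simp_all add: M_def m_def)
      fix y assume y: "y \<in> {a..b}"
      have I0: "0 \<le> integral {a..y} (\<lambda>t. m t * w t)"
        using mw[OF y] by (intro integral_nonneg) (auto simp: m_def w_def)
      have "cmod (?u y) \<le> cmod (sin (z * of_real (y - a)) / z) + cmod (?u y - sin (z * of_real (y - a)) / z)"
        by (metis add.commute diff_add_cancel norm_triangle_ineq)
      also have "\<dots> \<le> exp (?k * (y - a)) / cmod z + exp (?k * (y - a)) / cmod z * integral {a..y} (\<lambda>t. m t * w t)"
        using y by (intro add_mono sin_le err) auto
      \<comment> \<open>The factor 1/|z| \<le> 1 of the kernel is dropped here, which makes the
        Gronwall weight \<open>m\<close> independent of \<open>z\<close>.\<close>
      also have "\<dots> \<le> exp (?k * (y - a)) * (1 / cmod z + integral {a..y} (\<lambda>t. m t * w t))"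
      proof -
        have "integral {a..y} (\<lambda>t. m t * w t) / cmod z \<le> integral {a..y} (\<lambda>t. m t * w t)"
          using I0 z by (simp add: divide_le_eq mult_right_le_one_le mult_le_cancel_left1)
        then have "exp (?k * (y - a)) * (integral {a..y} (\<lambda>t. m t * w t) / cmod z) \<le> exp (?k * (y - a)) * integral {a..y} (\<lambda>t. m t * w t)"
          by (intro mult_left_mono) auto
        then show ?thesis by (simp add: distrib_left)
      qed
      finally have "cmod (?u y) * exp (- (?k * (y - a))) \<le>
          exp (?k * (y - a)) * (1 / cmod z + integral {a..y} (\<lambda>t. m t * w t)) * exp (- (?k * (y - a)))"
        by (intro mult_right_mono) auto
      also have "\<dots> = 1 / cmod z + integral {a..y} (\<lambda>t. m t * w t)"
        by (simp add: exp_minus)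
      finally show "w y \<le> 1 / cmod z + integral {a..y} (\<lambda>t. m t * w t)"
        unfolding w_def .
    qed
    have "integral {a..x} (\<lambda>t. m t * w t) \<le> integral {a..x} (\<lambda>t. (exp (M b) / cmod z) * m t)"
    proof (rule integral_le)
      fix t assume t: "t \<in> {a..x}"
      then have tb: "t \<in> {a..b}" using x by auto
      have "w t \<le> exp (M b) / cmod z"
      proof -
        have "(1 / cmod z) * exp (M t) \<le> (1 / cmod z) * exp (M b)"
          using Mle[OF tb] by (intro mult_left_mono) auto
        then show ?thesis using wle[OF tb] by simp
      qed
      then show "m t * w t \<le> (exp (M b) / cmod z) * m t"
        using mult_left_mono[of "w t" "exp (M b) / cmod z" "m t"] by (simp add: m_def mult.commute)
    qed (intro mw x integrable_on_mult_right mint)+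
    also have "\<dots> = exp (M b) / cmod z * M x"
      by (simp add: M_def)
    also have "\<dots> \<le> exp (M b) / cmod z * M b"
      using Mle[OF x] by (intro mult_left_mono) auto
    finally have "exp (?k * (x - a)) / cmod z * integral {a..x} (\<lambda>t. m t * w t) \<le>
        exp (?k * (x - a)) / cmod z * (exp (M b) / cmod z * M b)"
      by (intro mult_left_mono) auto
    then show ?thesis
      using err[OF x] by (simp add: power2_eq_square field_simps)
  qed
  show ?thesis
    using M0 main by (intro exI[of _ "exp (M b) * M b"]) auto
qed

end

section \<open>Product expansion of functions of sine type\<close>

lemma kth_smallest_eqI:
  assumes "l \<in> S" "finite {m\<in>S. m \<le> l}" "card {m\<in>S. m \<le> l} = k"
  shows "kth_smallest S k = l"
  unfolding kth_smallest_def
proof (rule the_equality)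
  fix l' assume l': "l' \<in> S \<and> finite {m\<in>S. m \<le> l'} \<and> card {m\<in>S. m \<le> l'} = k"
  have *: False if "x < y" "y \<in> S" "finite {m\<in>S. m \<le> y}" "card {m\<in>S. m \<le> x} = card {m\<in>S. m \<le> y}" for x y
  proof -
    have "{m\<in>S. m \<le> x} \<subseteq> {m\<in>S. m \<le> y}" "y \<in> {m\<in>S. m \<le> y} - {m\<in>S. m \<le> x}"
      using that(1,2) by auto
    then have "{m\<in>S. m \<le> x} \<subset> {m\<in>S. m \<le> y}"
      by blast
    from psubset_card_mono[OF that(3) this] show False
      using that(4) by linarith
  qed
  show "l' = l"
    using *[of l l'] *[of l' l] l' assms by (cases l l' rule: linorder_cases) auto
qed (use assms in auto)

lemma exists_element_of_rank:
  fixes A :: "real set"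
  assumes "finite A" "1 \<le> k" "k \<le> card A"
  shows "\<exists>l\<in>A. card {m\<in>A. m \<le> l} = k"
  using assms
proof (induction "card A" arbitrary: A)
  case (Suc n)
  have ne: "A \<noteq> {}" using Suc by auto
  show ?case
  proof (cases "k = card A")
    case True
    have "{m\<in>A. m \<le> Max A} = A" using Suc by auto
    then show ?thesis using True ne Suc by (intro bexI[of _ "Max A"]) auto
  next
    case False
    let ?B = "A - {Max A}"
    have "card ?B = n"
      using Suc ne by simp
    then obtain l where l: "l \<in> ?B" "card {m\<in>?B. m \<le> l} = k"
      using Suc.hyps(1)[of ?B] Suc.hyps(2) Suc.prems False by auto
    have "l < Max A"
      using l Suc.prems by (metis DiffE Max_ge insertCI order_le_less)
    then have "{m\<in>?B. m \<le> l} = {m\<in>A. m \<le> l}"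
      by auto
    then show ?thesis using l by auto
  qed
qed auto

text \<open>Converts counts of elements below thresholds, as Rouche's theorem will provide them,
  into the labeling of eigenvalues.\<close>

lemma kth_smallest_props:
  fixes S :: "real set" and r :: "nat \<Rightarrow> real"
  assumes A: "\<And>N. N \<ge> N0 \<Longrightarrow> finite {x\<in>S. x < r N} \<and> card {x\<in>S. x < r N} = N"
  shows "k \<ge> 1 \<Longrightarrow> kth_smallest S k \<in> S \<and> card {m\<in>S. m \<le> kth_smallest S k} = k"
    and "N \<ge> N0 \<Longrightarrow> bij_betw (kth_smallest S) {1..N} {x\<in>S. x < r N}"
proof -
  have main: "kth_smallest S k \<in> {x\<in>S. x < r N} \<and> card {m\<in>S. m \<le> kth_smallest S k} = k"
    if N: "N \<ge> N0" "1 \<le> k" "k \<le> N" for N k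
  proof -
    let ?A = "{x\<in>S. x < r N}"
    obtain l where l: "l \<in> ?A" "card {m\<in>?A. m \<le> l} = k"
      using exists_element_of_rank[of ?A k] A[OF N(1)] N(2,3) by auto
    have eq: "{m\<in>?A. m \<le> l} = {m\<in>S. m \<le> l}"
      using l(1) by auto
    have "finite {m\<in>S. m \<le> l}"
      using A[OF N(1)] finite_subset[of "{m\<in>?A. m \<le> l}" ?A] unfolding eq[symmetric] by auto
    then have "kth_smallest S k = l"
      using l eq by (intro kth_smallest_eqI) auto
    then show ?thesis using l eq by simp
  qed
  show "kth_smallest S k \<in> S \<and> card {m\<in>S. m \<le> kth_smallest S k} = k" if "k \<ge> 1"
    using main[of "max N0 k" k] that by simp
  show "bij_betw (kth_smallest S) {1..N} {x\<in>S. x < r N}" if N: "N \<ge> N0"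
  proof -
    have inj: "inj_on (kth_smallest S) {1..N}"
      using main[OF N] by (intro inj_onI) (metis atLeastAtMost_iff)
    have "kth_smallest S ` {1..N} \<subseteq> {x\<in>S. x < r N}"
      using main[OF N] by auto
    moreover have "card (kth_smallest S ` {1..N}) = card {x\<in>S. x < r N}"
      using card_image[OF inj] A[OF N] by simp
    ultimately have "kth_smallest S ` {1..N} = {x\<in>S. x < r N}"
      using A[OF N] by (intro card_subset_eq) auto
    then show ?thesis using inj by (simp add: bij_betw_def)
  qed
qed

section \<open>Lower bounds for the sine\<close>

lemma sin_lower_bound_Im:
  assumes "\<bar>Im w\<bar> \<ge> 1"
  shows "cmod (sin w) \<ge> exp \<bar>Im w\<bar> / 6"
proof -
  have e2: "exp \<bar>Im w\<bar> \<ge> 2"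
    using exp_ge_add_one_self[of "\<bar>Im w\<bar>"] assms by linarith
  have em: "exp (- \<bar>Im w\<bar>) \<le> 1/2"
    using e2 by (simp add: exp_minus field_simps)
  have "cmod (exp (\<i> * w) - exp (- (\<i> * w))) \<ge> \<bar>cmod (exp (\<i> * w)) - cmod (exp (- (\<i> * w)))\<bar>"
    by (rule norm_triangle_ineq3)
  also have "\<bar>cmod (exp (\<i> * w)) - cmod (exp (- (\<i> * w)))\<bar> = exp \<bar>Im w\<bar> - exp (- \<bar>Im w\<bar>)"
    using assms by (cases "Im w \<ge> 0") (auto simp: norm_exp_eq_Re abs_if)
  finally have "2 * cmod (sin w) \<ge> exp \<bar>Im w\<bar> - exp (- \<bar>Im w\<bar>)"
    by (simp add: sin_exp_eq norm_divide norm_mult)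
  then show ?thesis using e2 em by linarith
qed

text \<open>Away from the real axis \<open>sin_lower_bound_Im\<close> applies. Within distance 1 of
  it, the real part is within 1 of an extremum of the sine, so |sin (Re w)| \<ge> 1/2; the constant
  6 then comes from exp 1 \<le> 3.\<close>

lemma sin_lower_bound_circle:
  assumes w: "cmod w = (real N + 1/2) * pi"
  shows "cmod (sin w) \<ge> exp \<bar>Im w\<bar> / 6"
proof (cases "\<bar>Im w\<bar> \<ge> 1")
  case False
  let ?R = "(real N + 1/2) * pi"
  have "1/2 * pi \<le> ?R" by (intro mult_right_mono) auto
  then have R1: "?R \<ge> 1" using pi_gt3 by linarith
  have x: "\<bar>Re w\<bar> \<le> ?R" using abs_Re_le_cmod[of w] w by simp
  \<comment> \<open>The distance of |Re w| from the radius \<open>?R\<close>; on the circle t (R +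
    |Re w|) = (Im w)^2, so an imaginary part below 1 forces t \<le> 1.\<close>
  define t where "t = ?R - \<bar>Re w\<bar>"
  have t0: "t \<ge> 0" using x by (simp add: t_def)
  have "?R^2 = (Re w)^2 + (Im w)^2"
    using w cmod_power2[of w] by simp
  then have "t * (?R + \<bar>Re w\<bar>) = (Im w)^2"
    by (simp add: t_def algebra_simps power2_eq_square)
  moreover have "(Im w)^2 \<le> 1"
    using False by (simp add: abs_square_le_1)
  moreover have "t * 1 \<le> t * (?R + \<bar>Re w\<bar>)"
    using R1 t0 by (intro mult_left_mono) auto
  ultimately have t1: "t \<le> 1" by linarith
  have "cos t \<ge> 1 - t^2/2"
  proof -
    have "(sin (t/2))^2 \<le> (t/2)^2"
      by (meson abs_le_square_iff abs_sin_x_le_abs_x)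
    then show ?thesis
      using cos_double_sin[of "t/2"] by (simp add: power2_eq_square)
  qed
  moreover have "t^2 \<le> 1" using t0 t1 by (simp add: power_le_one)
  ultimately have ct: "cos t \<ge> 1/2" by linarith
  have sinR: "\<bar>sin ?R\<bar> = 1" "cos ?R = 0"
  proof -
    have "?R = pi/2 + real N * pi" by (simp add: algebra_simps)
    then show "\<bar>sin ?R\<bar> = 1" "cos ?R = 0"
      by (simp_all add: sin_add cos_add sin_npi cos_npi)
  qed
  have "\<bar>sin (Re w)\<bar> = \<bar>sin \<bar>Re w\<bar>\<bar>" by (auto simp: abs_if)
  also have "\<bar>Re w\<bar> = ?R - t" by (simp add: t_def)
  also have "\<bar>sin (?R - t)\<bar> = cos t"
    using sinR ct by (simp add: sin_diff abs_mult del: of_nat_add)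
  finally have s: "\<bar>sin (Re w)\<bar> \<ge> 1/2" using ct by simp
  have ch: "(exp (Im w) + exp (- Im w)) / 2 \<ge> 1"
    using cosh_real_ge_1[of "Im w"] by (simp add: cosh_def)
  have "cmod (sin w) \<ge> \<bar>Re (sin w)\<bar>" by (rule abs_Re_le_cmod)
  also have "\<bar>Re (sin w)\<bar> = \<bar>sin (Re w)\<bar> * ((exp (Im w) + exp (- Im w)) / 2)"
    by (simp add: Re_sin abs_mult)
  finally have "cmod (sin w) \<ge> \<bar>sin (Re w)\<bar> * 1"
    using mult_left_mono[OF ch, of "\<bar>sin (Re w)\<bar>"] by linarith
  moreover have "exp \<bar>Im w\<bar> \<le> exp 1" using False by simp
  ultimately show ?thesis using s exp_le by linarith
qed (rule sin_lower_bound_Im)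

text \<open>Near a multiple of pi a small sine means a small distance; this is how the position of
  an eigenvalue is read off in \<open>ev_close\<close>.\<close>

lemma abs_sin_ge_half: "\<bar>t\<bar> \<le> pi/2 \<Longrightarrow> \<bar>sin t\<bar> \<ge> \<bar>t\<bar> / 2" for t :: real
proof -
  have pos: "sin t \<ge> t / 2" if "0 \<le> t" "t \<le> pi/2" for t :: real
  proof -
    have "\<bar>sin t - (\<Sum>k<3. sin_coeff k * t ^ k)\<bar> \<le> inverse (fact 3) * \<bar>t\<bar> ^ 3"
      by (rule Maclaurin_sin_bound)
    then have "- (inverse (fact 3) * \<bar>t\<bar> ^ 3) \<le> sin t - (\<Sum>k<3. sin_coeff k * t ^ k)"
      by linarith
    then have "sin t \<ge> t - t * (t * t) / 6"
      using that by (simp add: sin_coeff_def eval_nat_numeral)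
    moreover have "t * (t * t) \<le> t * 3"
    proof -
      have "t \<le> 16/10" using that pi_approx by simp
      then have "t * t \<le> 16/10 * (16/10)" using that by (intro mult_mono) auto
      then show ?thesis using that by (intro mult_left_mono) auto
    qed
    ultimately show ?thesis by linarith
  qed
  assume "\<bar>t\<bar> \<le> pi/2"
  then show ?thesis
    using pos[of t] pos[of "-t"] by (cases "t \<ge> 0") auto
qed

text \<open>Simple zeros have order 1, and the circle winds once around the points inside and not
  around those outside, so the weighted sums in Rouche's theorem are cardinalities.\<close>

lemma card_zeros_Rouche:
  assumes f: "f holomorphic_on UNIV" and g: "g holomorphic_on UNIV" and r: "r > 0"
    and less: "\<And>z. cmod z = r \<Longrightarrow> cmod (g z - f z) < cmod (f z)"
    and sf: "\<And>z. f z = 0 \<Longrightarrow> deriv f z \<noteq> 0" and sg: "\<And>z. g z = 0 \<Longrightarrow> deriv g z \<noteq> 0"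
  shows "finite {z. g z = 0 \<and> cmod z < r} \<and> card {z. g z = 0 \<and> cmod z < r} = card {z. f z = 0 \<and> cmod z < r}"
proof -
  have nz: "f (of_real r) \<noteq> 0" "g (of_real r) \<noteq> 0"
    using less[of "of_real r"] r by auto
  \<comment> \<open>Isolated zeros require a nonconstant function; a constant one with a zero would
    have derivative 0 there, so it has no zeros at all.\<close>
  have fin: "finite {z\<in>cball 0 s. h z = 0}" if h: "h holomorphic_on UNIV" "\<And>z. h z = 0 \<Longrightarrow> deriv h z \<noteq> 0" for h s
  proof (cases "h constant_on UNIV")
    case True
    then obtain c where "\<And>z. h z = c" by (auto simp: constant_on_def)
    then have c: "h = (\<lambda>_. c)" by auto
    then have "c \<noteq> 0" using h(2)[of 0] by auto
    then show ?thesis using c by simp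
  next
    case False
    then show ?thesis
      by (intro holomorphic_compact_finite_zeros[OF h(1)]) auto
  qed
  define B where "B = ball (0::complex) (r + 1)"
  have sub: "{z\<in>B. h z = 0} \<subseteq> {z\<in>cball 0 (r + 1). h z = 0}" for h :: "complex \<Rightarrow> complex"
    by (auto simp: B_def)
  have finB: "finite {z\<in>B. f z = 0}" "finite {z\<in>B. g z = 0}"
    using finite_subset[OF sub fin[OF f sf]] finite_subset[OF sub fin[OF g sg]] by auto
  have wn: "winding_number (circlepath 0 r) p = (if cmod p < r then 1 else 0)" if "cmod p \<noteq> r" for p
  proof (cases "cmod p < r")
    case False
    then have "winding_number (circlepath 0 r) p = 0"
      using that r by (intro winding_number_zero_outside[of _ "cball 0 r"]) auto
    then show ?thesis using False by simp
  qed (simp add: winding_number_circlepath)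
  have sum: "(\<Sum>p\<in>{z\<in>B. h z = 0}. winding_number (circlepath 0 r) p * zorder h p) =
      of_nat (card {z. h z = 0 \<and> cmod z < r})"
    if h: "h holomorphic_on UNIV" "\<And>z. h z = 0 \<Longrightarrow> deriv h z \<noteq> 0" "\<And>z. cmod z = r \<Longrightarrow> h z \<noteq> 0"
      "finite {z\<in>B. h z = 0}" for h
  proof -
    have "(\<Sum>p\<in>{z\<in>B. h z = 0}. winding_number (circlepath 0 r) p * zorder h p) =
        (\<Sum>p\<in>{z\<in>B. h z = 0}. if cmod p < r then 1 else 0)"
    proof (rule sum.cong[OF refl])
      fix p assume p: "p \<in> {z\<in>B. h z = 0}"
      have "zorder h p = 1"
        using p h(2)[of p] by (intro zorder_zero_eqI[OF h(1)]) auto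
      moreover have "cmod p \<noteq> r" using p h(3) by auto
      ultimately show "winding_number (circlepath 0 r) p * zorder h p = (if cmod p < r then 1 else 0)"
        by (simp add: wn)
    qed
    also have "\<dots> = of_nat (card {p \<in> {z\<in>B. h z = 0}. cmod p < r})"
      using h(4) by (simp add: sum.If_cases Int_def)
    also have "{p \<in> {z\<in>B. h z = 0}. cmod p < r} = {z. h z = 0 \<and> cmod z < r}"
      by (auto simp: B_def)
    finally show ?thesis .
  qed
  have fg: "(\<lambda>p. f p + (g p - f p)) = g" by auto
  have gp: "f p + (g p - f p) = g p" for p by simp
  have "(\<Sum>p\<in>{p\<in>B. f p + (g p - f p) = 0}. winding_number (circlepath 0 r) p * zorder (\<lambda>p. f p + (g p - f p)) p) =
      (\<Sum>p\<in>{p\<in>B. f p = 0}. winding_number (circlepath 0 r) p * zorder f p)"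
  proof (rule Rouche_theorem)
    show "open B" "connected B" by (auto simp: B_def)
    show "finite {p\<in>B. f p + (g p - f p) = 0}" "finite {p\<in>B. f p = 0}" using finB by auto
    show "f holomorphic_on B" "(\<lambda>p. g p - f p) holomorphic_on B"
      using f g by (auto intro!: holomorphic_intros intro: holomorphic_on_subset)
    show "path_image (circlepath 0 r) \<subseteq> B"
      using r by (auto simp: B_def)
    show "\<forall>z\<in>path_image (circlepath 0 r). cmod (g z - f z) < cmod (f z)"
      using less r by (auto simp: sphere_def)
    show "\<forall>z. z \<notin> B \<longrightarrow> winding_number (circlepath 0 r) z = 0"
      using wn r by (auto simp: B_def)
  qed auto
  then have "(\<Sum>p\<in>{p\<in>B. g p = 0}. winding_number (circlepath 0 r) p * zorder g p) =
      (\<Sum>p\<in>{p\<in>B. f p = 0}. winding_number (circlepath 0 r) p * zorder f p)"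
    unfolding fg gp .
  moreover have "f z \<noteq> 0" "g z \<noteq> 0" if "cmod z = r" for z
    using less[OF that] by auto
  ultimately have "complex_of_nat (card {z. g z = 0 \<and> cmod z < r}) = of_nat (card {z. f z = 0 \<and> cmod z < r})"
    using sum[OF f sf _ finB(1)] sum[OF g sg _ finB(2)] by simp
  then have "card {z. g z = 0 \<and> cmod z < r} = card {z. f z = 0 \<and> cmod z < r}"
    by (simp only: of_nat_eq_iff)
  moreover have "finite {z. g z = 0 \<and> cmod z < r}"
    by (rule finite_subset[OF _ finB(2)]) (auto simp: B_def)
  ultimately show ?thesis by blast
qed

text \<open>Zeros are divided out one at a time: the product of the other factors does not vanish at
  \<open>x\<close>, so the cofactor \<open>K\<close> does. Its difference quotient, filled in by the
  derivative, is entire; the sign is reversed because the factors are x - \<mu>.\<close>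

lemma entire_factor_zeros:
  assumes "F holomorphic_on UNIV" "finite A" "\<And>x. x \<in> A \<Longrightarrow> F x = 0"
  shows "\<exists>K. K holomorphic_on UNIV \<and> (\<forall>\<mu>. F \<mu> = K \<mu> * (\<Prod>x\<in>A. x - \<mu>))"
  using assms(2,3)
proof (induction A rule: finite_induct)
  case empty
  then show ?case using assms(1) by auto
next
  case (insert x A)
  then obtain K where K: "K holomorphic_on UNIV" "\<And>\<mu>. F \<mu> = K \<mu> * (\<Prod>y\<in>A. y - \<mu>)"
    by auto
  have "(\<Prod>y\<in>A. y - x) \<noteq> 0"
    using insert.hyps by (auto simp: prod_zero_iff)
  then have Kx: "K x = 0"
    using K(2)[of x] insert.prems[of x] by auto
  define K' where "K' = (\<lambda>\<mu>. - (if \<mu> = x then deriv K x else (K \<mu> - K x) / (\<mu> - x)))"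
  have "K' holomorphic_on UNIV"
    unfolding K'_def using K(1) by (intro holomorphic_on_minus pole_lemma) auto
  moreover have "K \<mu> = K' \<mu> * (x - \<mu>)" for \<mu>
    using Kx by (auto simp: K'_def field_simps)
  then have "F \<mu> = K' \<mu> * (\<Prod>y\<in>insert x A. y - \<mu>)" for \<mu>
    using K(2)[of \<mu>] insert.hyps by (simp add: mult_ac)
  ultimately show ?case by blast
qed

lemma deriv_mult_at_zero:
  assumes "f holomorphic_on UNIV" "k holomorphic_on UNIV" "p holomorphic_on UNIV"
    and "\<And>z. f z = k z * p z" "p x = 0"
  shows "deriv f x = k x * deriv p x"
proof -
  have "(k has_field_derivative deriv k x) (at x)" "(p has_field_derivative deriv p x) (at x)"
    using assms by (auto intro: holomorphic_derivI)
  then have "((\<lambda>z. k z * p z) has_field_derivative (deriv k x * p x + deriv p x * k x)) (at x)"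
    by (rule DERIV_mult)
  moreover have "f = (\<lambda>z. k z * p z)" using assms(4) by auto
  ultimately show ?thesis
    using assms(5) DERIV_imp_deriv by (fastforce simp: mult.commute)
qed

text \<open>A crude bound, by a square root whose increments dominate the terms. In
  \<open>gap_sum\<close> it is divided by \<open>n\<close>, so any order below \<open>n\<close> is
  enough.\<close>

lemma sum_inverse_le_sqrt: "(\<Sum>j<n. 1 / real (Suc j)) \<le> 2 * sqrt (real n)"
proof (induction n)
  case (Suc n)
  let ?a = "sqrt (real n)" and ?b = "sqrt (real (Suc n))"
  have b: "?b > 0" "?a \<le> ?b" "?a \<ge> 0" by auto
  have "?b * ?b - ?a * ?a = 1" by simp
  then have "(?b - ?a) * (?b + ?a) = 1" by (simp add: algebra_simps)
  moreover have "(?b - ?a) * (?b + ?a) \<le> (?b - ?a) * (2 * ?b)"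
    using b by (intro mult_left_mono) auto
  ultimately have "1 \<le> (?b - ?a) * (2 * ?b)" by linarith
  then have "1 / ?b \<le> 2 * (?b - ?a)"
    unfolding pos_divide_le_eq[OF b(1)] by (simp only: mult_ac)
  moreover have "?b * 1 \<le> ?b * ?b"
    using b by (intro mult_left_mono) auto
  then have "1 / real (Suc n) \<le> 1 / ?b"
    using b by (intro divide_left_mono) auto
  ultimately have "1 / real (Suc n) \<le> 2 * (?b - ?a)"
    by linarith
  then show ?case using Suc by simp
qed simp

lemma norm_prod_minus_one_le_exp:
  fixes f :: "nat \<Rightarrow> complex"
  assumes "\<And>m. m \<in> A \<Longrightarrow> cmod (f m) \<le> g m"
  shows "cmod ((\<Prod>m\<in>A. 1 + f m) - 1) \<le> exp (\<Sum>m\<in>A. g m) - 1"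
proof -
  have "cmod ((\<Prod>m\<in>A. 1 + f m) - 1) \<le> (\<Prod>m\<in>A. 1 + cmod (f m)) - 1"
    by (rule norm_prod_minus1_le_prod_minus1)
  also have "(\<Prod>m\<in>A. 1 + cmod (f m)) \<le> exp (\<Sum>m\<in>A. cmod (f m))"
    by (rule prod_le_exp_sum) auto
  also have "(\<Sum>m\<in>A. cmod (f m)) \<le> (\<Sum>m\<in>A. g m)"
    by (rule sum_mono) (rule assms)
  finally show ?thesis by simp
qed

section \<open>Comparison of the zeros of \<open>F\<close> and \<open>F0\<close>\<close>

text \<open>The spectral parameter is \<open>z\<^sup>2\<close>; \<open>F\<close> and \<open>F0\<close> stand for the characteristic functions of the
  perturbed and of the free problem on an interval of length \<open>L\<close>.\<close>

locale sine_type =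
  fixes F F0 :: "complex \<Rightarrow> complex" and L C :: real
  assumes L: "L > 0" and C: "C \<ge> 0"
    and F: "F holomorphic_on UNIV" and F0: "F0 holomorphic_on UNIV"
    and asym: "\<And>z. cmod z \<ge> 1 \<Longrightarrow> cmod (F (z^2) - sin (z * L) / z) \<le> C * exp (\<bar>Im z\<bar> * L) / (cmod z)^2"
    and F_real: "\<And>z. F z = 0 \<Longrightarrow> z \<in> \<real>" and F_simple: "\<And>z. F z = 0 \<Longrightarrow> deriv F z \<noteq> 0"
    and F0_sin: "\<And>z. z \<noteq> 0 \<Longrightarrow> F0 (z^2) = sin (z * L) / z" and F0_0: "F0 0 = L"
    and F0_simple: "\<And>z. F0 z = 0 \<Longrightarrow> deriv F0 z \<noteq> 0"
begin

definition zeros :: "real set" where "zeros = {x. F (of_real x) = 0}"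
definition ev :: "nat \<Rightarrow> real" where "ev = kth_smallest zeros"
definition ev0 :: "nat \<Rightarrow> real" where "ev0 m = (real m * pi / L)^2"
text \<open>The circles of radius \<open>r N\<close> separate the \<open>N\<close>-th from the next zero of \<open>F0\<close>.\<close>

definition R :: "nat \<Rightarrow> real" where "R N = (real N + 1/2) * pi / L"
definition r :: "nat \<Rightarrow> real" where "r N = (R N)^2"

lemma R_pos: "R N > 0"
  unfolding R_def using L by (intro divide_pos_pos mult_pos_pos add_nonneg_pos) auto

lemma r_pos: "r N > 0"
  unfolding r_def by (intro zero_less_power R_pos)

lemma ev0_pos: "m \<ge> 1 \<Longrightarrow> ev0 m > 0"
  unfolding ev0_def using L by (intro zero_less_power divide_pos_pos mult_pos_pos) auto

lemma ev0_inj: "inj ev0"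
proof (rule injI)
  fix m n assume "ev0 m = ev0 n"
  then have "real m * pi / L = real n * pi / L"
    using L unfolding ev0_def by (subst (asm) power2_eq_iff_nonneg) auto
  then show "m = n" using L by simp
qed

lemma ev0_less: "ev0 m < r N \<longleftrightarrow> m \<le> N"
proof -
  have "ev0 m < r N \<longleftrightarrow> real m * pi / L < R N"
    unfolding ev0_def r_def using L R_pos[of N]
    by (auto intro: power_strict_mono dest: power2_less_imp_less)
  also have "\<dots> \<longleftrightarrow> real m < real N + 1/2"
    using L by (simp add: R_def divide_less_cancel)
  also have "\<dots> \<longleftrightarrow> m \<le> N" by linarith
  finally show ?thesis .
qed

lemma F0_zero_iff: "F0 \<mu> = 0 \<longleftrightarrow> (\<exists>m\<ge>1. \<mu> = of_real (ev0 m))"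
proof
  assume 0: "F0 \<mu> = 0"
  define z where "z = csqrt \<mu>"
  have z: "z^2 = \<mu>" by (simp add: z_def)
  have "\<mu> \<noteq> 0" using 0 F0_0 L by auto
  then have z0: "z \<noteq> 0" using z by auto
  then have "sin (z * L) = 0" using F0_sin[OF z0] 0 z by simp
  then obtain n :: int where n: "z * L = of_real (n * pi)"
    using sin_eq_0 by blast
  then have zn: "z = of_real (real_of_int n * pi / L)"
    using L by (simp add: field_simps)
  \<comment> \<open>Opposite square roots of \<mu> give opposite \<open>n\<close>, hence the
    absolute value; \<open>n\<close> = 0 is excluded because \<open>F0 0\<close> is not 0.\<close>
  have "\<mu> = of_real (ev0 (nat \<bar>n\<bar>))"
  proof -
    have "real (nat \<bar>n\<bar>) = \<bar>real_of_int n\<bar>" by simp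
    then have "ev0 (nat \<bar>n\<bar>) = (real_of_int n * pi / L)^2"
      by (simp only: ev0_def power_divide power_mult_distrib power2_abs)
    then show ?thesis
      unfolding z[symmetric] zn by (simp only: of_real_power)
  qed
  moreover have "nat \<bar>n\<bar> \<ge> 1" using zn z0 by (cases "n = 0") auto
  ultimately show "\<exists>m\<ge>1. \<mu> = of_real (ev0 m)" by blast
next
  assume "\<exists>m\<ge>1. \<mu> = of_real (ev0 m)"
  then obtain m where m: "m \<ge> 1" "\<mu> = of_real (ev0 m)" by blast
  define z where "z = complex_of_real (real m * pi / L)"
  have "z \<noteq> 0" using m L by (simp add: z_def)
  moreover have "z * L = of_real (real m * pi)" using L by (simp add: z_def)
  then have "sin (z * L) = 0"
    using sin_eq_0 by (metis of_int_of_nat_eq)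
  moreover have "z^2 = \<mu>" by (simp add: z_def m ev0_def)
  ultimately show "F0 \<mu> = 0" using F0_sin[of z] by simp
qed

lemma F0_zeros_disc: "{z. F0 z = 0 \<and> cmod z < r N} = (\<lambda>m. of_real (ev0 m)) ` {1..N}"
proof -
  have "ev0 m \<ge> 0" for m by (simp add: ev0_def)
  then have "cmod (of_real (ev0 m)) = ev0 m" for m by simp
  then show ?thesis
    using ev0_less by (auto simp: F0_zero_iff)
qed

text \<open>Where the sine has its full exponential size, the bound of \<open>asym\<close> is a
  multiple of |F0| = |sin (z L)| / |z|, with one factor 1/|z| to spare.\<close>

lemma relative_error:
  assumes z: "cmod z \<ge> 1" and low: "cmod (sin (z * L)) \<ge> exp (\<bar>Im z\<bar> * L) / 6"
  shows "cmod (F (z^2) - F0 (z^2)) \<le> 6 * C / cmod z * cmod (F0 (z^2))"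
proof -
  have z0: "z \<noteq> 0" using z by auto
  have "cmod (F (z^2) - F0 (z^2)) \<le> C * exp (\<bar>Im z\<bar> * L) / (cmod z)^2"
    using asym[OF z] F0_sin[OF z0] by simp
  also have "\<dots> \<le> C * (6 * cmod (sin (z * L))) / (cmod z)^2"
    using low C by (intro divide_right_mono mult_left_mono) auto
  also have "\<dots> = 6 * C / cmod z * cmod (F0 (z^2))"
    unfolding F0_sin[OF z0] by (simp add: norm_divide power2_eq_square)
  finally show ?thesis .
qed

lemma relative_error_circle:
  assumes "R N \<ge> 1" "cmod \<mu> = r N"
  shows "cmod (F \<mu> - F0 \<mu>) \<le> 6 * C / R N * cmod (F0 \<mu>)" "F0 \<mu> \<noteq> 0"
proof -
  define z where "z = csqrt \<mu>"
  have z: "z^2 = \<mu>" by (simp add: z_def)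
  have "(cmod z)^2 = (R N)^2"
    using assms z by (metis norm_power r_def)
  then have cz: "cmod z = R N"
    using R_pos[of N] by (simp add: power2_eq_iff_nonneg)
  have "cmod (z * L) = (real N + 1/2) * pi"
    using cz L by (simp add: norm_mult R_def)
  from sin_lower_bound_circle[OF this]
  have low: "cmod (sin (z * L)) \<ge> exp (\<bar>Im z\<bar> * L) / 6"
    using L by (simp add: abs_mult)
  show "cmod (F \<mu> - F0 \<mu>) \<le> 6 * C / R N * cmod (F0 \<mu>)"
    using relative_error[of z] low cz assms(1) z by simp
  have "sin (z * L) \<noteq> 0"
    using low exp_gt_zero[of "\<bar>Im z\<bar> * L"] by (metis divide_pos_pos norm_zero not_less zero_less_numeral)
  moreover have "z \<noteq> 0" using cz R_pos[of N] by auto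
  ultimately show "F0 \<mu> \<noteq> 0"
    using F0_sin[of z] z by simp
qed

lemma R_at_top: "filterlim R at_top sequentially"
proof -
  have "filterlim (\<lambda>N. real N + 1/2) at_top sequentially"
    by real_asymp
  then have "filterlim (\<lambda>N. (real N + 1/2) * (pi / L)) at_top sequentially"
    using L by (intro filterlim_at_top_mult_tendsto_pos[OF tendsto_const]) auto
  moreover have "R = (\<lambda>N. (real N + 1/2) * (pi / L))"
    by (auto simp: R_def)
  ultimately show ?thesis by simp
qed

text \<open>On the negative half-line z = \<i> s, and there the sine has its full exponential size,
  so \<open>F0\<close> dominates. The bound reconciles two counts: labels count zeros on a
  half-line, Rouche's theorem in a disc.\<close>

lemma zeros_bounded_below: "\<exists>B. \<forall>x\<in>zeros. x > - B"
proof (intro exI ballI)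
  \<comment> \<open>The three bounds on \<open>s\<close>: 1 for \<open>asym\<close>, 1/L to make |Im
    (z L)| \<ge> 1, and 6 C + 1 to make the relative error smaller than 1.\<close>
  define B where "B = (Max {1, 1/L, 6*C+1})^2"
  fix x assume x: "x \<in> zeros"
  show "x > - B"
  proof (rule ccontr)
    assume "\<not> x > - B"
    then have xB: "- x \<ge> B" by simp
    define s where "s = sqrt (- x)"
    have sM: "s \<ge> Max {1, 1/L, 6*C+1}"
      unfolding s_def using xB B_def by (intro real_le_rsqrt) auto
    then have s: "s \<ge> 1" "s \<ge> 1/L" "s \<ge> 6*C+1" by simp_all
    define z where "z = \<i> * complex_of_real s"
    have "s^2 = - x"
      unfolding s_def using xB B_def by (intro real_sqrt_pow2) (metis order_trans zero_le_power2)
    then have z: "z^2 = of_real x"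
      by (simp add: z_def power_mult_distrib flip: of_real_power)
    have cz: "cmod z = s" "Im z = s" "\<bar>Im z\<bar> = s" using s by (simp_all add: z_def norm_mult)
    have "s * L \<ge> 1" using s(2) L by (simp add: field_simps)
    then have low: "cmod (sin (z * L)) \<ge> exp (\<bar>Im z\<bar> * L) / 6"
      using sin_lower_bound_Im[of "z * L"] s L cz by (simp add: abs_mult)
    have "cmod (F (z^2) - F0 (z^2)) \<le> 6 * C / s * cmod (F0 (z^2))"
      using relative_error[OF _ low] cz s by simp
    moreover have "F (z^2) = 0" using x z by (simp add: zeros_def)
    ultimately have "cmod (F0 (z^2)) * 1 \<le> cmod (F0 (z^2)) * (6 * C / s)" by (simp add: mult.commute)
    moreover have "6 * C / s < 1" using s by (simp add: field_simps)
    ultimately have "cmod (F0 (z^2)) \<le> 0"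
      by (metis mult_le_cancel_left norm_ge_zero not_le order_le_less)
    moreover have z0: "z \<noteq> 0" using cz(1) s(1) by auto
    ultimately have "sin (z * L) = 0" using F0_sin[OF z0] by simp
    then have "exp (\<bar>Im z\<bar> * L) / 6 \<le> 0" using low by simp
    then show False using exp_gt_zero[of "\<bar>Im z\<bar> * L"] by linarith
  qed
qed

definition good :: "nat \<Rightarrow> bool"
  where "good N \<longleftrightarrow> N \<ge> 1 \<and> R N \<ge> 1 \<and> 6 * C / R N \<le> 1/2 \<and>
    finite {x\<in>zeros. x < r N} \<and> card {x\<in>zeros. x < r N} = N \<and> (\<forall>x\<in>zeros. x < r N \<longrightarrow> \<bar>x\<bar> < r N)"

text \<open>As soon as R N \<ge> 12 C, the relative error on the circle is at most 1/2 and Rouche's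
  theorem gives \<open>F\<close> the \<open>N\<close> zeros that \<open>F0\<close> has in the disc.
  R N \<ge> B + 1 puts every zero below r N into the disc, because r N \<ge> R N.\<close>

lemma eventually_good: "\<exists>N0. \<forall>N\<ge>N0. good N"
proof -
  obtain B where B: "\<And>x. x \<in> zeros \<Longrightarrow> x > - B" using zeros_bounded_below by blast
  have "\<forall>\<^sub>F N in sequentially. R N \<ge> max 1 (max (12 * C) (B + 1))"
    using R_at_top unfolding filterlim_at_top by blast
  then have "\<forall>\<^sub>F N in sequentially. good N"
    using eventually_ge_at_top[of 1]
  proof eventually_elim
    case (elim N)
    then have R1: "R N \<ge> 1" "R N \<ge> 12 * C" "R N \<ge> B + 1" by auto
    have rR: "r N \<ge> R N"
      using R1(1) by (simp add: r_def power2_eq_square mult_le_cancel_left1)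
    have small: "6 * C / R N \<le> 1/2" using R1 by (simp add: field_simps)
    have "finite {z. F z = 0 \<and> cmod z < r N} \<and> card {z. F z = 0 \<and> cmod z < r N} = card {z. F0 z = 0 \<and> cmod z < r N}"
    proof (rule card_zeros_Rouche[OF F0 F])
      show "r N > 0" by (rule r_pos)
      fix z assume z: "cmod z = r N"
      have "cmod (F z - F0 z) \<le> 6 * C / R N * cmod (F0 z)" "cmod (F0 z) > 0"
        using relative_error_circle[OF R1(1) z] by auto
      moreover have "6 * C / R N * cmod (F0 z) \<le> 1/2 * cmod (F0 z)"
        using small by (intro mult_right_mono) auto
      ultimately show "cmod (F z - F0 z) < cmod (F0 z)" by linarith
    qed (fact F_simple F0_simple)+
    moreover have "card {z. F0 z = 0 \<and> cmod z < r N} = N"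
    proof -
      have "inj_on (\<lambda>m. complex_of_real (ev0 m)) {1..N}"
        using ev0_inj by (auto simp: inj_on_def)
      then show ?thesis by (simp add: F0_zeros_disc card_image)
    qed
    moreover have abs: "\<bar>x\<bar> < r N" if "x \<in> zeros" "x < r N" for x
      using B[OF that(1)] that(2) R1 rR by linarith
    have "{z. F z = 0 \<and> cmod z < r N} = of_real ` {x\<in>zeros. x < r N}"
    proof (intro equalityI subsetI)
      fix z assume z: "z \<in> {z. F z = 0 \<and> cmod z < r N}"
      then obtain x where "z = of_real x" using F_real by (auto elim: Reals_cases)
      then show "z \<in> of_real ` {x\<in>zeros. x < r N}" using z by (auto simp: zeros_def)
    next
      fix z assume "z \<in> complex_of_real ` {x\<in>zeros. x < r N}"
      then show "z \<in> {z. F z = 0 \<and> cmod z < r N}" using abs by (auto simp: zeros_def)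
    qed
    moreover have inj: "inj_on complex_of_real A" for A by (simp add: inj_on_def)
    ultimately have "finite {x\<in>zeros. x < r N} \<and> card {x\<in>zeros. x < r N} = N"
      by (simp add: card_image finite_image_iff)
    then show ?case
      unfolding good_def using elim R1 small abs by auto
  qed
  then show ?thesis by (simp add: eventually_sequentially)
qed

end

context sine_type
begin

definition N0 :: nat where "N0 = (SOME N0. \<forall>N\<ge>N0. good N)"

lemma good: "N \<ge> N0 \<Longrightarrow> good N"
  unfolding N0_def by (rule someI_ex[OF eventually_good, rule_format])

lemma good_card: "N \<ge> N0 \<Longrightarrow> finite {x\<in>zeros. x < r N} \<and> card {x\<in>zeros. x < r N} = N"
  using good[of N] by (simp add: good_def)

lemma ev_bij: "N \<ge> N0 \<Longrightarrow> bij_betw ev {1..N} {x\<in>zeros. x < r N}"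
  unfolding ev_def by (rule kth_smallest_props(2)[OF good_card])

lemma ev_zero: "m \<ge> 1 \<Longrightarrow> F (of_real (ev m)) = 0"
proof -
  assume "m \<ge> 1"
  from kth_smallest_props(1)[OF good_card this] have "ev m \<in> zeros"
    by (simp add: ev_def)
  then show ?thesis by (simp add: zeros_def)
qed

lemma ev_image: "N \<ge> N0 \<Longrightarrow> ev ` {1..N} = {x\<in>zeros. x < r N}"
  using ev_bij by (simp add: bij_betw_def)

lemma ev_inj: "inj_on ev {1..}"
proof (rule inj_onI)
  fix m n :: nat assume mn: "m \<in> {1..}" "n \<in> {1..}" "ev m = ev n"
  have inj: "inj_on ev {1..max N0 (max m n)}"
    using ev_bij[of "max N0 (max m n)"] by (simp add: bij_betw_def)
  show "m = n"
    by (rule inj_onD[OF inj mn(3)]) (use mn in auto)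
qed

text \<open>For m > N0 both \<open>m - 1\<close> and \<open>m\<close> are good indices: the labels
  up to \<open>m\<close> exhaust the zeros below r m, and those up to \<open>m - 1\<close> exhaust
  the zeros below r (m - 1).\<close>

lemma ev_between:
  assumes "m > N0"
  shows "r (m - 1) \<le> ev m" "ev m < r m"
proof -
  have m: "m \<in> {1..m}" using assms by auto
  have "ev m \<in> ev ` {1..m}" using m by blast
  then show lt: "ev m < r m"
    using ev_image[of m] assms by auto
  show "r (m - 1) \<le> ev m"
  proof (rule ccontr)
    assume "\<not> r (m - 1) \<le> ev m"
    moreover have "ev m \<in> zeros"
      using ev_zero[of m] assms by (simp add: zeros_def)
    ultimately have "ev m \<in> ev ` {1..m - 1}"
      using ev_image[of "m - 1"] assms by auto
    then obtain j where "j \<in> {1..m - 1}" "ev m = ev j" by auto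
    then show False
      using ev_inj assms by (auto dest: inj_onD)
  qed
qed

text \<open>With s = sqrt (ev m), s L lies within pi/2 of m pi by \<open>ev_between\<close>. Since
  F(s^2) = 0, \<open>asym\<close> gives |sin (s L)| \<le> C / s, so t = s L - m pi is O(1/s), which
  offsets the factor \<open>s\<close> that appears on squaring.\<close>

lemma ev_close: "\<exists>D\<ge>0. \<forall>m\<ge>1. \<bar>ev m - ev0 m\<bar> \<le> D"
proof -
  \<comment> \<open>The product of the bounds |t| \<le> 2 C / s and |2 s L - t| \<le> s (2 L +
    pi/2), divided by L^2.\<close>
  define D1 where "D1 = 2 * C * (2 * L + pi/2) / L^2"
  have large: "\<bar>ev m - ev0 m\<bar> \<le> D1" if m: "m > N0" for m
  proof -
    have g: "R (m - 1) \<ge> 1" using good[of "m - 1"] m by (simp add: good_def)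
    define s where "s = sqrt (ev m)"
    have rm: "r (m - 1) > 0" by (rule r_pos)
    then have s2: "s^2 = ev m"
      using ev_between(1)[OF m] by (simp add: s_def)
    have s_low: "s \<ge> R (m - 1)"
      unfolding s_def using ev_between(1)[OF m] by (intro real_le_rsqrt) (simp add: r_def)
    have s_up: "s < R m"
      unfolding s_def using ev_between(2)[OF m] R_pos[of m] by (intro real_less_lsqrt) (auto simp: r_def)
    have s1: "s \<ge> 1" using g s_low by simp
    define t where "t = s * L - real m * pi"
    have RL: "R N * L = (real N + 1/2) * pi" for N
      using L by (simp add: R_def)
    have "real (m - 1) + 1/2 = real m - 1/2"
      using m by (simp add: of_nat_diff)
    with RL[of "m - 1"] RL[of m] have "R (m - 1) * L = (real m - 1/2) * pi" "R m * L = (real m + 1/2) * pi"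
      by simp_all
    then have "(real m - 1/2) * pi \<le> s * L" "s * L \<le> (real m + 1/2) * pi"
      using mult_right_mono[OF s_low, of L] mult_right_mono[OF less_imp_le[OF s_up], of L] L by auto
    then have "t \<le> pi/2" "- t \<le> pi/2"
      by (simp_all add: t_def algebra_simps)
    then have tb: "\<bar>t\<bar> \<le> pi/2" by linarith
    have sl: "s * L = t + real m * pi" by (simp add: t_def)
    have Fs: "F ((of_real s)^2) = 0"
      using ev_zero[of m] m s2 by (simp flip: of_real_power)
    have sinr: "sin (complex_of_real s * of_real L) = of_real (sin (s * L))"
      unfolding of_real_mult[symmetric] by (rule sin_of_real)
    have "cmod (F ((of_real s)^2) - sin (of_real s * of_real L) / of_real s) \<le>
        C * exp (\<bar>Im (of_real s)\<bar> * L) / (cmod (of_real s))^2"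
      by (rule asym) (use s1 in simp)
    then have "\<bar>sin (s * L)\<bar> / s \<le> C / s^2"
      unfolding Fs sinr using s1 by (simp add: norm_divide)
    then have "\<bar>sin (s * L)\<bar> \<le> C / s"
      using s1 by (simp add: field_simps power2_eq_square)
    moreover have "\<bar>sin (s * L)\<bar> = \<bar>sin t\<bar>"
      unfolding sl by (simp add: sin_add sin_npi cos_npi abs_mult)
    ultimately have "\<bar>t\<bar> \<le> 2 * C / s"
      using abs_sin_ge_half[OF tb] by linarith
    have "(ev m - ev0 m) * L^2 = t * (2 * (s * L) - t)"
    proof -
      have "ev m * L^2 = (s * L)^2" "ev0 m * L^2 = (s * L - t)^2"
        using L by (simp_all add: s2[symmetric] ev0_def power_mult_distrib t_def power_divide)
      then show ?thesis by (simp add: left_diff_distrib power2_eq_square algebra_simps)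
    qed
    then have "\<bar>(ev m - ev0 m) * L^2\<bar> = \<bar>t * (2 * (s * L) - t)\<bar>"
      by (rule arg_cong)
    then have "\<bar>ev m - ev0 m\<bar> * L^2 = \<bar>t\<bar> * \<bar>2 * (s * L) - t\<bar>"
      by (simp only: abs_mult abs_power2)
    also have "\<dots> \<le> (2 * C / s) * (s * (2 * L + pi/2))"
    proof (intro mult_mono)
      have "pi/2 \<le> s * (pi/2)" using s1 by simp
      moreover have "s * L \<ge> 0" using s1 L by simp
      ultimately have "\<bar>2 * (s * L) - t\<bar> \<le> 2 * (s * L) + s * (pi/2)"
        using tb by linarith
      then show "\<bar>2 * (s * L) - t\<bar> \<le> s * (2 * L + pi/2)"
        by (simp add: algebra_simps)
    qed (use \<open>\<bar>t\<bar> \<le> 2 * C / s\<close> C s1 in auto)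
    finally have "\<bar>ev m - ev0 m\<bar> * L^2 \<le> 2 * C * (2 * L + pi/2)" using s1 by simp
    then show ?thesis
      using L by (simp add: D1_def pos_le_divide_eq)
  qed
  \<comment> \<open>The estimate covers only m > N0; the finitely many earlier deviations are simply
    added.\<close>
  define D where "D = D1 + (\<Sum>m\<in>{1..N0}. \<bar>ev m - ev0 m\<bar>)"
  have D1: "D1 \<ge> 0"
    unfolding D1_def using C L by (intro divide_nonneg_nonneg mult_nonneg_nonneg add_nonneg_nonneg) auto
  have "\<bar>ev m - ev0 m\<bar> \<le> D" if "m \<ge> 1" for m
  proof (cases "m > N0")
    case True
    then show ?thesis using large[of m] by (simp add: D_def sum_nonneg add_increasing2)
  next
    case False
    then have "\<bar>ev m - ev0 m\<bar> \<le> (\<Sum>m\<in>{1..N0}. \<bar>ev m - ev0 m\<bar>)"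
      using that by (intro member_le_sum) auto
    then show ?thesis using D1 by (simp add: D_def)
  qed
  moreover have "D \<ge> 0" using D1 by (simp add: D_def sum_nonneg)
  ultimately show ?thesis by blast
qed

end

section \<open>Infinite products for \<open>F\<close> and for its derivative at a zero\<close>

context sine_type
begin

text \<open>Both functions are split as \<open>F = K N * P N\<close> and \<open>F0 = K0 N * P0 N\<close>.  The quotient \<open>K N / K0 N\<close> is
  holomorphic on the disc of radius \<open>r N\<close> and close to 1 on its boundary, hence inside.\<close>

definition P :: "nat \<Rightarrow> complex \<Rightarrow> complex" where "P N \<mu> = (\<Prod>m\<in>{1..N}. of_real (ev m) - \<mu>)"
definition P0 :: "nat \<Rightarrow> complex \<Rightarrow> complex" where "P0 N \<mu> = (\<Prod>m\<in>{1..N}. of_real (ev0 m) - \<mu>)"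
definition c0 :: "nat \<Rightarrow> complex" where "c0 N = (\<Prod>m\<in>{1..N}. of_real (ev0 m))"

definition K :: "nat \<Rightarrow> complex \<Rightarrow> complex"
  where "K N = (SOME k. k holomorphic_on UNIV \<and> (\<forall>\<mu>. F \<mu> = k \<mu> * P N \<mu>))"
definition K0 :: "nat \<Rightarrow> complex \<Rightarrow> complex"
  where "K0 N = (SOME k. k holomorphic_on UNIV \<and> (\<forall>\<mu>. F0 \<mu> = k \<mu> * P0 N \<mu>))"

lemma c0_nz: "c0 N \<noteq> 0"
proof -
  have "complex_of_real (ev0 m) \<noteq> 0" if "m \<in> {1..N}" for m
    using ev0_pos[of m] that by simp
  then show ?thesis
    unfolding c0_def by (subst prod_zero_iff) auto
qed

lemma K_factor: "K N holomorphic_on UNIV" "F \<mu> = K N \<mu> * P N \<mu>"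
proof -
  have inj: "inj_on (\<lambda>m. complex_of_real (ev m)) {1..N}"
    using ev_inj by (auto simp: inj_on_def)
  have "\<exists>k. k holomorphic_on UNIV \<and> (\<forall>\<mu>. F \<mu> = k \<mu> * (\<Prod>x\<in>(\<lambda>m. complex_of_real (ev m)) ` {1..N}. x - \<mu>))"
    by (rule entire_factor_zeros[OF F]) (auto simp: ev_zero)
  then have "\<exists>k. k holomorphic_on UNIV \<and> (\<forall>\<mu>. F \<mu> = k \<mu> * P N \<mu>)"
    unfolding prod.reindex[OF inj] P_def by (simp only: o_def)
  then have *: "K N holomorphic_on UNIV \<and> (\<forall>\<mu>. F \<mu> = K N \<mu> * P N \<mu>)"
    unfolding K_def by (rule someI_ex)
  show "K N holomorphic_on UNIV"
    by (rule conjunct1[OF *])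
  show "F \<mu> = K N \<mu> * P N \<mu>"
    by (rule spec[OF conjunct2[OF *]])
qed

lemma K0_factor: "K0 N holomorphic_on UNIV" "F0 \<mu> = K0 N \<mu> * P0 N \<mu>"
proof -
  have inj: "inj_on (\<lambda>m. complex_of_real (ev0 m)) {1..N}"
    using ev0_inj by (auto simp: inj_on_def)
  have "\<exists>k. k holomorphic_on UNIV \<and> (\<forall>\<mu>. F0 \<mu> = k \<mu> * (\<Prod>x\<in>(\<lambda>m. complex_of_real (ev0 m)) ` {1..N}. x - \<mu>))"
    by (rule entire_factor_zeros[OF F0]) (auto simp: F0_zero_iff)
  then have "\<exists>k. k holomorphic_on UNIV \<and> (\<forall>\<mu>. F0 \<mu> = k \<mu> * P0 N \<mu>)"
    unfolding prod.reindex[OF inj] P0_def by (simp only: o_def)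
  then have *: "K0 N holomorphic_on UNIV \<and> (\<forall>\<mu>. F0 \<mu> = K0 N \<mu> * P0 N \<mu>)"
    unfolding K0_def by (rule someI_ex)
  show "K0 N holomorphic_on UNIV"
    by (rule conjunct1[OF *])
  show "F0 \<mu> = K0 N \<mu> * P0 N \<mu>"
    by (rule spec[OF conjunct2[OF *]])
qed

lemma P_holomorphic: "P N holomorphic_on UNIV" "P0 N holomorphic_on UNIV"
  unfolding P_def P0_def by (intro holomorphic_intros)+

text \<open>All zeros of \<open>F0\<close> in the closed disc are roots of \<open>P0 N\<close>. If
  \<open>K0 N\<close> vanished at one of them as well, it would be a multiple zero of
  \<open>F0\<close>.\<close>

lemma K0_nz:
  assumes "R N \<ge> 1" "cmod \<mu> \<le> r N"
  shows "K0 N \<mu> \<noteq> 0"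
proof
  assume 0: "K0 N \<mu> = 0"
  then have F00: "F0 \<mu> = 0" using K0_factor(2)[of \<mu> N] by simp
  then have "cmod \<mu> < r N"
    using relative_error_circle(2)[OF assms(1), of \<mu>] F00 assms(2) by (auto simp: order_le_less)
  then have "\<mu> \<in> {z. F0 z = 0 \<and> cmod z < r N}"
    using F00 by simp
  then obtain m where m: "m \<in> {1..N}" "\<mu> = of_real (ev0 m)"
    unfolding F0_zeros_disc by auto
  then have "P0 N \<mu> = 0"
    by (auto simp: P0_def prod_zero_iff)
  then have "deriv F0 \<mu> = 0"
    using deriv_mult_at_zero[OF F0 K0_factor(1)[of N] P_holomorphic(2)[of N] K0_factor(2)] 0 by simp
  then show False using F0_simple[OF F00] by simp
qed

text \<open>r N - ev0 m = (pi/L)^2 (N + 1/2 - m)(N + 1/2 + m). The last factor is at least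
  \<open>N\<close> and the other at least half of N - m + 1, which leaves a harmonic sum divided by
  \<open>N\<close>.\<close>

lemma gap_sum:
  assumes "N \<ge> 1"
  shows "(\<Sum>m\<in>{1..N}. 1 / (r N - ev0 m)) \<le> (L / pi)^2 * (4 / sqrt (real N))"
proof -
  have "(\<Sum>m\<in>{1..N}. 1 / (r N - ev0 m)) \<le> (\<Sum>m\<in>{1..N}. (L / pi)^2 * (2 / real N) * (1 / real (Suc (N - m))))"
  proof (rule sum_mono)
    fix m assume m: "m \<in> {1..N}"
    have e: "r N - ev0 m = (pi / L)^2 * ((real N + 1/2 - real m) * (real N + 1/2 + real m))"
      unfolding r_def R_def ev0_def by (simp add: power2_eq_square algebra_simps add_divide_distrib diff_divide_distrib)
    have "real (Suc (N - m)) / 2 * real N \<le> (real N + 1/2 - real m) * (real N + 1/2 + real m)"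
      using m by (intro mult_mono) (auto simp: of_nat_diff)
    then have "(pi / L)^2 * (real (Suc (N - m)) / 2 * real N) \<le> r N - ev0 m"
      unfolding e by (intro mult_left_mono) auto
    moreover have "(pi / L)^2 * (real (Suc (N - m)) / 2 * real N) > 0"
      using L assms by (intro mult_pos_pos) auto
    ultimately have "1 / (r N - ev0 m) \<le> 1 / ((pi / L)^2 * (real (Suc (N - m)) / 2 * real N))"
      by (intro divide_left_mono) (auto intro: mult_pos_pos)
    also have "\<dots> = (L / pi)^2 * (2 / real N) * (1 / real (Suc (N - m)))"
      using L assms by (simp add: power_divide field_simps del: of_nat_Suc)
    finally show "1 / (r N - ev0 m) \<le> (L / pi)^2 * (2 / real N) * (1 / real (Suc (N - m)))" .
  qed
  also have "\<dots> = (L / pi)^2 * (2 / real N) * (\<Sum>m\<in>{1..N}. 1 / real (Suc (N - m)))"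
    by (rule sum_distrib_left[symmetric])
  also have "(\<Sum>m\<in>{1..N}. 1 / real (Suc (N - m))) = (\<Sum>j<N. 1 / real (Suc j))"
    by (rule sum.reindex_bij_witness[of _ "\<lambda>j. N - j" "\<lambda>m. N - m"]) auto
  also have "(L / pi)^2 * (2 / real N) * (\<Sum>j<N. 1 / real (Suc j)) \<le> (L / pi)^2 * (2 / real N) * (2 * sqrt (real N))"
    by (intro mult_left_mono sum_inverse_le_sqrt) auto
  also have "\<dots> = (L / pi)^2 * (4 / sqrt (real N))"
  proof -
    have "sqrt (real N) / real N = 1 / sqrt (real N)"
      using assms by (simp add: field_simps)
    moreover have "(L / pi)^2 * (2 / real N) * (2 * sqrt (real N)) = (L / pi)^2 * (4 * (sqrt (real N) / real N))"
      by simp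
    ultimately show ?thesis by simp
  qed
  finally show ?thesis .
qed

text \<open>A factor of P/P0 is 1 plus (ev m - ev0 m) / (ev0 m - \<mu>), and on the circle the
  second summand is at most D / (r N - ev0 m) in modulus; by \<open>gap_sum\<close> these bounds add
  up to something that tends to 0.\<close>

lemma ratio_circle:
  "\<exists>\<eta>. \<eta> \<longlonglongrightarrow> 0 \<and> (\<forall>N\<ge>N0. \<forall>\<mu>. cmod \<mu> = r N \<longrightarrow> P0 N \<mu> \<noteq> 0 \<and> cmod (P N \<mu> / P0 N \<mu> - 1) \<le> \<eta> N)"
proof -
  obtain D where D: "D \<ge> 0" "\<And>m. m \<ge> 1 \<Longrightarrow> \<bar>ev m - ev0 m\<bar> \<le> D"
    using ev_close by blast
  define \<eta> where "\<eta> = (\<lambda>N. exp (D * ((L / pi)^2 * (4 / sqrt (real N)))) - 1)"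
  have "(\<lambda>N. 4 / sqrt (real N)) \<longlonglongrightarrow> 0" by real_asymp
  then have "(\<lambda>N. exp (D * ((L / pi)^2 * (4 / sqrt (real N)))) - 1) \<longlonglongrightarrow> exp (D * ((L / pi)^2 * 0)) - 1"
    by (intro tendsto_intros)
  then have lim: "\<eta> \<longlonglongrightarrow> 0" by (simp add: \<eta>_def)
  have "P0 N \<mu> \<noteq> 0 \<and> cmod (P N \<mu> / P0 N \<mu> - 1) \<le> \<eta> N" if N: "N \<ge> N0" and \<mu>: "cmod \<mu> = r N" for N \<mu>
  proof -
    have N1: "N \<ge> 1" using good[OF N] by (simp add: good_def)
    have gap: "cmod (of_real (ev0 m) - \<mu>) \<ge> r N - ev0 m" "r N - ev0 m > 0" if "m \<in> {1..N}" for m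
    proof -
      have "cmod (complex_of_real (ev0 m)) = ev0 m" using ev0_pos[of m] that by simp
      then show "cmod (of_real (ev0 m) - \<mu>) \<ge> r N - ev0 m"
        using norm_triangle_ineq2[of \<mu> "of_real (ev0 m)"] \<mu> by (simp add: norm_minus_commute)
      show "r N - ev0 m > 0" using ev0_less[of m N] that by simp
    qed
    have nz: "of_real (ev0 m) - \<mu> \<noteq> 0" if "m \<in> {1..N}" for m
      using gap[OF that] by auto
    then have P0nz: "P0 N \<mu> \<noteq> 0" by (auto simp: P0_def prod_zero_iff)
    have "P N \<mu> / P0 N \<mu> = (\<Prod>m\<in>{1..N}. 1 + (of_real (ev m) - of_real (ev0 m)) / (of_real (ev0 m) - \<mu>))"
      unfolding P_def P0_def prod_dividef[symmetric] using nz by (intro prod.cong refl) (simp add: field_simps)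
    also have "cmod (\<dots> - 1) \<le> exp (\<Sum>m\<in>{1..N}. D * (1 / (r N - ev0 m))) - 1"
    proof (rule norm_prod_minus_one_le_exp)
      fix m assume m: "m \<in> {1..N}"
      have "cmod ((of_real (ev m) - of_real (ev0 m)) / (of_real (ev0 m) - \<mu>)) =
          \<bar>ev m - ev0 m\<bar> / cmod (of_real (ev0 m) - \<mu>)"
        by (simp add: norm_divide flip: of_real_diff)
      also have "\<dots> \<le> D / (r N - ev0 m)"
        using gap[OF m] D m by (intro frac_le) auto
      finally show "cmod ((of_real (ev m) - of_real (ev0 m)) / (of_real (ev0 m) - \<mu>)) \<le> D * (1 / (r N - ev0 m))"
        by simp
    qed
    also have "\<dots> \<le> \<eta> N"
      unfolding \<eta>_def sum_distrib_left[symmetric] using mult_left_mono[OF gap_sum[OF N1] D(1)]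
      by (intro diff_right_mono) (simp only: exp_le_cancel_iff)
    finally show ?thesis using P0nz by blast
  qed
  with lim show ?thesis by blast
qed

lemma K_ratio: "(\<lambda>N. K N \<mu> / K0 N \<mu>) \<longlonglongrightarrow> 1"
proof -
  obtain \<eta> where \<eta>: "\<eta> \<longlonglongrightarrow> 0" "\<And>N \<mu>. N \<ge> N0 \<Longrightarrow> cmod \<mu> = r N \<Longrightarrow> P0 N \<mu> \<noteq> 0 \<and> cmod (P N \<mu> / P0 N \<mu> - 1) \<le> \<eta> N"
    using ratio_circle by blast
  define \<epsilon> where "\<epsilon> = (\<lambda>N. 6 * C / R N)"
  have \<epsilon>: "\<epsilon> \<longlonglongrightarrow> 0"
    unfolding \<epsilon>_def using R_at_top by (rule real_tendsto_divide_at_top[OF tendsto_const])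
  \<comment> \<open>On the circle K/K0 is (F/F0) / (P/P0). If the first factor and the inverse of
    the second deviate from 1 by x and y, their product deviates by x + y + x y; inverting P/P0
    costs the factor 2, valid for \<eta> N \<le> 1/2.\<close>
  define \<delta> where "\<delta> = (\<lambda>N. \<epsilon> N + 2 * \<eta> N + \<epsilon> N * (2 * \<eta> N))"
  have "\<delta> \<longlonglongrightarrow> 0 + 2 * 0 + 0 * (2 * 0)"
    unfolding \<delta>_def by (intro tendsto_intros \<eta>(1) \<epsilon>)
  then have \<delta>: "\<delta> \<longlonglongrightarrow> 0" by simp
  have circle: "cmod (K N z / K0 N z - 1) \<le> \<delta> N" if N: "N \<ge> N0" "\<eta> N \<le> 1/2" and z: "cmod z = r N" for N z
  proof -
    have R1: "R N \<ge> 1" using good[OF N(1)] by (simp add: good_def)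
    define X where "X = F z / F0 z"
    define Y where "Y = P N z / P0 N z"
    have F0nz: "F0 z \<noteq> 0" and rel: "cmod (F z - F0 z) \<le> \<epsilon> N * cmod (F0 z)"
      using relative_error_circle[OF R1 z] by (auto simp: \<epsilon>_def)
    have X: "cmod (X - 1) \<le> \<epsilon> N"
    proof -
      have "X - 1 = (F z - F0 z) / F0 z" using F0nz by (simp add: X_def field_simps)
      then show ?thesis using rel F0nz by (simp add: norm_divide divide_le_eq)
    qed
    have Y: "cmod (Y - 1) \<le> \<eta> N" "P0 N z \<noteq> 0" using \<eta>(2)[OF N(1) z] by (auto simp: Y_def)
    have Yge: "cmod Y \<ge> 1/2"
      using Y(1) N(2) norm_triangle_ineq3[of 1 "1 - Y"] norm_minus_commute[of Y 1] by simp
    have Ynz: "Y \<noteq> 0" using Yge by auto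
    have Pnz: "P N z \<noteq> 0" using Ynz by (auto simp: Y_def)
    have \<eta>0: "\<eta> N \<ge> 0" using Y(1) norm_ge_zero order_trans by blast
    have \<epsilon>0: "\<epsilon> N \<ge> 0" using X norm_ge_zero order_trans by blast
    have Y': "cmod (1 / Y - 1) \<le> 2 * \<eta> N"
    proof -
      have "1 / Y - 1 = (1 - Y) / Y" using Ynz by (simp add: field_simps)
      then have "cmod (1 / Y - 1) = cmod (Y - 1) / cmod Y"
        by (simp add: norm_divide norm_minus_commute)
      also have "\<dots> \<le> \<eta> N / (1/2)"
        using Y(1) Yge \<eta>0 by (intro frac_le) auto
      finally show ?thesis by simp
    qed
    have "K N z / K0 N z = X * (1 / Y)"
      using K_factor(2)[of z N] K0_factor(2)[of z N] Pnz Y(2) F0nz by (simp add: X_def Y_def field_simps)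
    moreover have "X * y - 1 = (X - 1) + (y - 1) + (X - 1) * (y - 1)" for y
      by (simp add: algebra_simps)
    ultimately have "K N z / K0 N z - 1 = (X - 1) + (1 / Y - 1) + (X - 1) * (1 / Y - 1)"
      by metis
    also have "cmod \<dots> \<le> cmod (X - 1) + cmod (1 / Y - 1) + cmod (X - 1) * cmod (1 / Y - 1)"
      by (metis norm_mult norm_triangle_ineq norm_triangle_mono order_refl)
    also have "\<dots> \<le> \<delta> N"
      unfolding \<delta>_def using X Y' \<epsilon>0 by (intro add_mono mult_mono) auto
    finally show ?thesis .
  qed
  have inside: "cmod (K N \<mu> / K0 N \<mu> - 1) \<le> \<delta> N" if N: "N \<ge> N0" "\<eta> N \<le> 1/2" and \<mu>: "cmod \<mu> \<le> r N" for N
  proof -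
    have R1: "R N \<ge> 1" using good[OF N(1)] by (simp add: good_def)
    have hol: "(\<lambda>z. K N z / K0 N z - 1) holomorphic_on S" if "\<forall>z\<in>S. K0 N z \<noteq> 0" for S
      using K_factor(1) K0_factor(1) that by (intro holomorphic_intros) (auto intro: holomorphic_on_subset)
    have nz: "K0 N z \<noteq> 0" if "cmod z \<le> r N" for z by (rule K0_nz[OF R1 that])
    show ?thesis
    proof (rule maximum_modulus_frontier[of "\<lambda>z. K N z / K0 N z - 1" "cball 0 (r N)"])
      show "(\<lambda>z. K N z / K0 N z - 1) holomorphic_on interior (cball 0 (r N))"
        using nz by (intro hol) auto
      have "(\<lambda>z. K N z / K0 N z - 1) holomorphic_on cball 0 (r N)"
        using nz by (intro hol) auto
      then show "continuous_on (closure (cball 0 (r N))) (\<lambda>z. K N z / K0 N z - 1)"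
        by (simp add: holomorphic_on_imp_continuous_on)
      show "cmod (K N z / K0 N z - 1) \<le> \<delta> N" if "z \<in> frontier (cball 0 (r N))" for z
        using that N by (intro circle) auto
    qed (use \<mu> in auto)
  qed
  have "\<forall>\<^sub>F N in sequentially. cmod (K N \<mu> / K0 N \<mu> - 1) \<le> \<delta> N"
  proof -
    have "\<forall>\<^sub>F N in sequentially. \<eta> N < 1/2" using \<eta>(1) by (rule order_tendstoD) simp
    moreover have "\<forall>\<^sub>F N in sequentially. R N \<ge> max 1 (cmod \<mu>)"
      using R_at_top unfolding filterlim_at_top by blast
    ultimately show ?thesis
      using eventually_ge_at_top[of N0]
    proof eventually_elim
      case (elim N)
      have "cmod \<mu> * 1 \<le> R N * R N" using elim(2) by (intro mult_mono) auto
      then show ?case using elim by (intro inside) (auto simp: r_def power2_eq_square)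
    qed
  qed
  then have "(\<lambda>N. K N \<mu> / K0 N \<mu> - 1) \<longlonglongrightarrow> 0"
    using \<delta> by (rule Lim_null_comparison)
  then show ?thesis by (rule LIM_zero_cancel)
qed

text \<open>Euler's product for sin (pi w) with w = z L / pi and \<mu> = z^2; the division by z L is
  why \<mu> = 0 is treated apart.\<close>

lemma F0_product: "(\<lambda>n. \<Prod>m\<in>{1..n}. 1 - \<mu> / of_real (ev0 m)) \<longlonglongrightarrow> F0 \<mu> / L"
proof (cases "\<mu> = 0")
  case True
  then show ?thesis using F0_0 L by simp
next
  case False
  define z where "z = csqrt \<mu>"
  have z: "z^2 = \<mu>" "z \<noteq> 0" using False by (auto simp: z_def)
  define w where "w = z * L / pi"
  have e: "w^2 / of_nat m ^ 2 = \<mu> / of_real (ev0 m)" for m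
    by (simp add: w_def ev0_def z(1)[symmetric] power_divide power_mult_distrib)
  have pw: "of_real pi * w = z * L" by (simp add: w_def)
  have "(\<lambda>n. of_real pi * w * (\<Prod>m=1..n. 1 - w^2 / of_nat m ^ 2)) \<longlonglongrightarrow> sin (of_real pi * w)"
    by (rule sin_product_formula_complex)
  then have "(\<lambda>n. (z * L) * (\<Prod>m=1..n. 1 - \<mu> / of_real (ev0 m))) \<longlonglongrightarrow> sin (z * L)"
    unfolding e pw .
  then have "(\<lambda>n. (z * L) * (\<Prod>m=1..n. 1 - \<mu> / of_real (ev0 m)) / (z * L)) \<longlonglongrightarrow> sin (z * L) / (z * L)"
    using z(2) L by (intro tendsto_divide tendsto_const) auto
  moreover have "sin (z * L) / (z * L) = F0 \<mu> / L"
    using F0_sin[OF z(2)] z(1) by simp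
  moreover have "z * L \<noteq> 0" using z(2) L by simp
  ultimately show ?thesis
    by (simp only: nonzero_mult_div_cancel_left not_False_eq_True)
qed

text \<open>Where \<open>F0\<close> does not vanish, K0 N \<mu> c0 N / L is the tail over m > N of
  the product for F0 / L; the exponent comes from |\<mu>| / ev0 m and the sum of 1/m^2 over m > N.
  The bound is continuous in \<mu>, so it extends to the zeros of \<open>F0\<close>.\<close>

lemma K0_limit_bound:
  assumes "N \<ge> 1"
  shows "cmod (K0 N \<mu> * c0 N / L - 1) \<le> exp (cmod \<mu> * (L / pi)^2 / real N) - 1"
proof -
  have Q: "P0 N \<mu> = c0 N * (\<Prod>m\<in>{1..N}. 1 - \<mu> / of_real (ev0 m))" for N \<mu>
    unfolding P0_def c0_def prod.distrib[symmetric]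
    using ev0_pos by (intro prod.cong refl) (fastforce simp: field_simps)
  have telescope: "(\<Sum>m\<in>{N<..n}. 1 / (real m)^2) \<le> 1 / real N - 1 / real n" if "N \<le> n" for n
    using that
  proof (induction n rule: dec_induct)
    case (step n)
    have "n > 0" using step assms by simp
    then have "1 / real n - 1 / real (Suc n) = 1 / (real n * real (Suc n))"
      by (simp add: field_simps)
    moreover have "1 / (real (Suc n) * real (Suc n)) \<le> 1 / (real n * real (Suc n))"
      using \<open>n > 0\<close> by (intro divide_left_mono mult_right_mono) auto
    ultimately have "1 / (real (Suc n))^2 \<le> 1 / real n - 1 / real (Suc n)"
      by (simp only: power2_eq_square)
    moreover have "{N<..Suc n} = insert (Suc n) {N<..n}" using step by auto
    ultimately show ?case using step by simp
  qed simp
  have nonzero: "cmod (K0 N \<nu> * c0 N / L - 1) \<le> exp (cmod \<nu> * (L / pi)^2 / real N) - 1" if \<nu>: "F0 \<nu> \<noteq> 0" for \<nu>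
  proof -
    let ?Q = "\<lambda>n. \<Prod>m\<in>{1..n}. 1 - \<nu> / of_real (ev0 m)"
    let ?T = "\<lambda>n. \<Prod>m\<in>{N<..n}. 1 - \<nu> / of_real (ev0 m)"
    have QN: "?Q N \<noteq> 0" using K0_factor(2)[of \<nu> N] Q[of N \<nu>] \<nu> by auto
    have "\<forall>\<^sub>F n in sequentially. ?Q n / ?Q N = ?T n"
      using eventually_ge_at_top[of N]
    proof eventually_elim
      case (elim n)
      then have "{1..n} = {1..N} \<union> {N<..n}" by auto
      then have "?Q n = ?Q N * ?T n"
        by (simp add: prod.union_disjoint[symmetric] ivl_disj_int)
      then show ?case using QN by simp
    qed
    moreover have "(\<lambda>n. ?Q n / ?Q N) \<longlonglongrightarrow> F0 \<nu> / L / ?Q N"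
      by (intro tendsto_divide F0_product tendsto_const QN)
    ultimately have "?T \<longlonglongrightarrow> F0 \<nu> / L / ?Q N"
      by (rule Lim_transform_eventually[rotated])
    also have "F0 \<nu> / L / ?Q N = K0 N \<nu> * c0 N / L"
    proof -
      have "k * (c * q) / l / q = k * c / l" if "q \<noteq> 0" for k c q l :: complex
        using that by simp
      then show ?thesis
        unfolding K0_factor(2)[of \<nu> N] Q using QN by blast
    qed
    finally have "(\<lambda>n. cmod (?T n - 1)) \<longlonglongrightarrow> cmod (K0 N \<nu> * c0 N / L - 1)"
      by (intro tendsto_intros)
    moreover have "\<forall>\<^sub>F n in sequentially. cmod (?T n - 1) \<le> exp (cmod \<nu> * (L / pi)^2 / real N) - 1"
      using eventually_ge_at_top[of N]
    proof eventually_elim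
      case (elim n)
      have "cmod ((\<Prod>m\<in>{N<..n}. 1 + - (\<nu> / of_real (ev0 m))) - 1) \<le>
          exp (\<Sum>m\<in>{N<..n}. cmod \<nu> * (L / pi)^2 * (1 / (real m)^2)) - 1"
        by (rule norm_prod_minus_one_le_exp)
           (simp add: norm_divide ev0_def power_divide power_mult_distrib norm_mult norm_power mult.commute)
      also have "(\<Sum>m\<in>{N<..n}. cmod \<nu> * (L / pi)^2 * (1 / (real m)^2)) = cmod \<nu> * (L / pi)^2 * (\<Sum>m\<in>{N<..n}. 1 / (real m)^2)"
        by (rule sum_distrib_left[symmetric])
      also have "\<dots> \<le> cmod \<nu> * (L / pi)^2 * (1 / real N)"
      proof (rule mult_left_mono)
        have "1 / real n \<ge> 0" by simp
        then show "(\<Sum>m\<in>{N<..n}. 1 / (real m)^2) \<le> 1 / real N"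
          using telescope[OF elim] by linarith
      qed simp
      finally show ?case by simp
    qed
    ultimately show ?thesis by (rule tendsto_upperbound) simp
  qed
  show ?thesis
  proof (cases "F0 \<mu> = 0")
    case True
    \<comment> \<open>A perturbed eigenvalue may coincide with a free one; approach it off the real axis.\<close>
    define \<nu> where "\<nu> = (\<lambda>n. \<mu> + \<i> * of_real (1 / real (Suc n)))"
    have "Im \<mu> = 0" using True by (auto simp: F0_zero_iff)
    then have Im\<nu>: "Im (\<nu> n) = 1 / real (Suc n)" for n
      unfolding \<nu>_def by (simp only: plus_complex.sel Im_i_times Re_complex_of_real)
    have nz: "F0 (\<nu> n) \<noteq> 0" for n
    proof
      assume "F0 (\<nu> n) = 0"
      then obtain m where "\<nu> n = of_real (ev0 m)" unfolding F0_zero_iff by blast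
      then have "Im (\<nu> n) = 0" by simp
      then show False using Im\<nu>[of n] by simp
    qed
    have "(\<lambda>n. complex_of_real (1 / real (Suc n))) \<longlonglongrightarrow> of_real 0"
      using LIMSEQ_inverse_real_of_nat unfolding inverse_eq_divide by (rule tendsto_of_real)
    then have "\<nu> \<longlonglongrightarrow> \<mu> + \<i> * of_real 0"
      unfolding \<nu>_def by (rule tendsto_add[OF tendsto_const tendsto_mult[OF tendsto_const]])
    then have lim: "\<nu> \<longlonglongrightarrow> \<mu>" by simp
    have "isCont (K0 N) \<mu>"
      using holomorphic_on_imp_continuous_on[OF K0_factor(1)[of N]]
      by (simp add: continuous_on_eq_continuous_at)
    then have "(\<lambda>n. K0 N (\<nu> n)) \<longlonglongrightarrow> K0 N \<mu>"
      using lim by (rule isCont_tendsto_compose)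
    then have "(\<lambda>n. cmod (K0 N (\<nu> n) * c0 N / L - 1)) \<longlonglongrightarrow> cmod (K0 N \<mu> * c0 N / L - 1)"
      using L by (intro tendsto_intros) auto
    moreover have "(\<lambda>n. exp (cmod (\<nu> n) * (L / pi)^2 / real N) - 1) \<longlonglongrightarrow> exp (cmod \<mu> * (L / pi)^2 / real N) - 1"
      using assms lim by (intro tendsto_intros) auto
    ultimately show ?thesis
      by (rule LIMSEQ_le) (intro exI[of _ 0] allI impI nonzero nz)
  qed (rule nonzero)
qed

lemma K_limit: "(\<lambda>N. K N \<mu> * c0 N / L) \<longlonglongrightarrow> 1"
proof -
  have "(\<lambda>N. K0 N \<mu> * c0 N / L - 1) \<longlonglongrightarrow> 0"
  proof (rule Lim_null_comparison)
    show "\<forall>\<^sub>F N in sequentially. cmod (K0 N \<mu> * c0 N / L - 1) \<le> exp (cmod \<mu> * (L / pi)^2 / real N) - 1"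
      using eventually_ge_at_top[of 1] by eventually_elim (rule K0_limit_bound)
    have "(\<lambda>N. 1 / real N) \<longlonglongrightarrow> 0" by real_asymp
    then have "(\<lambda>N. exp (cmod \<mu> * (L / pi)^2 * (1 / real N)) - 1) \<longlonglongrightarrow> exp (cmod \<mu> * (L / pi)^2 * 0) - 1"
      by (intro tendsto_intros)
    then show "(\<lambda>N. exp (cmod \<mu> * (L / pi)^2 / real N) - 1) \<longlonglongrightarrow> 0" by simp
  qed
  then have "(\<lambda>N. K0 N \<mu> * c0 N / L) \<longlonglongrightarrow> 1" by (rule LIM_zero_cancel)
  from tendsto_mult[OF K_ratio[of \<mu>] this]
  have lim: "(\<lambda>N. K N \<mu> / K0 N \<mu> * (K0 N \<mu> * c0 N / L)) \<longlonglongrightarrow> 1" by simp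
  have "\<forall>\<^sub>F N in sequentially. K0 N \<mu> \<noteq> 0"
  proof -
    have "\<forall>\<^sub>F N in sequentially. R N \<ge> max 1 (cmod \<mu>)"
      using R_at_top unfolding filterlim_at_top by blast
    then show ?thesis
    proof eventually_elim
      case (elim N)
      have "cmod \<mu> * 1 \<le> R N * R N" using elim by (intro mult_mono) auto
      then show ?case using elim by (intro K0_nz) (auto simp: r_def power2_eq_square)
    qed
  qed
  then have "\<forall>\<^sub>F N in sequentially. K N \<mu> / K0 N \<mu> * (K0 N \<mu> * c0 N / L) = K N \<mu> * c0 N / L"
    by eventually_elim simp
  with lim show ?thesis by (rule Lim_transform_eventually)
qed

text \<open>Since F = K P, the partial product is F / L divided by K c0 / L, whose limit is 1.
  Nothing is divided by \<open>F\<close> or \<open>P\<close>, so \<mu> may be a zero.\<close>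

theorem product_formula:
  "(\<lambda>N. \<Prod>m\<in>{1..N}. (of_real (ev m) - \<mu>) / of_real (ev0 m)) \<longlonglongrightarrow> F \<mu> / L"
proof -
  have eq: "(\<Prod>m\<in>{1..N}. (of_real (ev m) - \<mu>) / of_real (ev0 m)) = P N \<mu> / c0 N" for N
    by (simp add: P_def c0_def prod_dividef)
  have lim: "(\<lambda>N. F \<mu> / L / (K N \<mu> * c0 N / L)) \<longlonglongrightarrow> F \<mu> / L"
    using tendsto_divide[OF tendsto_const K_limit[of \<mu>] one_neq_zero] unfolding div_by_1 .
  have "\<forall>\<^sub>F N in sequentially. K N \<mu> * c0 N / L \<noteq> 0"
    using tendsto_imp_eventually_ne[OF K_limit, of 0] by simp
  then have ev: "\<forall>\<^sub>F N in sequentially. F \<mu> / L / (K N \<mu> * c0 N / L) = P N \<mu> / c0 N"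
  proof eventually_elim
    case (elim N)
    then have "K N \<mu> \<noteq> 0" by auto
    then show ?case using L c0_nz[of N] K_factor(2)[of \<mu> N] by (simp add: field_simps)
  qed
  show ?thesis
    unfolding eq by (rule Lim_transform_eventually[OF lim ev])
qed

text \<open>In the derivative of K N times P N at \<open>ev k\<close> only the derivative -1 of the
  factor ev k - \<mu> survives, hence the minus sign; \<open>ev0 k\<close> makes up for the factor
  absent from the denominators.\<close>

theorem product_formula_deriv:
  assumes k: "k \<ge> 1"
  shows "(\<lambda>N. \<Prod>m\<in>{1..N}-{k}. (of_real (ev m) - of_real (ev k)) / of_real (ev0 m)) \<longlonglongrightarrow>
    - deriv F (of_real (ev k)) * of_real (ev0 k) / L"
proof -
  let ?l = "complex_of_real (ev k)"
  have main: "(\<Prod>m\<in>{1..N}-{k}. (of_real (ev m) - ?l) / of_real (ev0 m)) =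
      - deriv F ?l * of_real (ev0 k) / L / (K N ?l * c0 N / L)" if N: "N \<ge> k" "K N ?l * c0 N / L \<noteq> 0" for N
  proof -
    let ?p = "\<lambda>\<mu>. \<Prod>m\<in>{1..N}-{k}. complex_of_real (ev m) - \<mu>"
    let ?c = "\<Prod>m\<in>{1..N}-{k}. complex_of_real (ev0 m)"
    have kN: "k \<in> {1..N}" using k N by auto
    have Peq: "P N \<mu> = ?p \<mu> * (?l - \<mu>)" for \<mu>
      unfolding P_def using prod.remove[OF _ kN, of "\<lambda>m. complex_of_real (ev m) - \<mu>"] by (simp add: mult.commute)
    have "deriv (P N) ?l = ?p ?l * deriv (\<lambda>\<mu>. ?l - \<mu>) ?l"
      by (rule deriv_mult_at_zero[OF P_holomorphic(1) _ _ Peq]) (auto intro!: holomorphic_intros)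
    also have "deriv (\<lambda>\<mu>. ?l - \<mu>) ?l = -1"
      by (intro DERIV_imp_deriv) (auto intro!: derivative_eq_intros)
    finally have dP: "deriv (P N) ?l = - ?p ?l" by simp
    have "P N ?l = 0" using Peq[of ?l] by simp
    then have dF: "deriv F ?l = K N ?l * (- ?p ?l)"
      using deriv_mult_at_zero[OF F K_factor(1)[of N] P_holomorphic(1)[of N] K_factor(2)] dP by simp
    have c: "c0 N = of_real (ev0 k) * ?c"
      unfolding c0_def using prod.remove[OF _ kN] by blast
    have "(\<Prod>m\<in>{1..N}-{k}. (of_real (ev m) - ?l) / of_real (ev0 m)) = ?p ?l / ?c"
      by (rule prod_dividef)
    moreover have "complex_of_real (ev0 k) * ?c \<noteq> 0"
      using c0_nz[of N] unfolding c .
    then have "?c \<noteq> 0" "complex_of_real (ev0 k) \<noteq> 0"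
      by simp_all
    moreover have "K N ?l \<noteq> 0"
      using N(2) by auto
    ultimately show ?thesis
      unfolding dF c using L by (simp add: field_simps)
  qed
  have lim: "(\<lambda>N. - deriv F ?l * of_real (ev0 k) / L / (K N ?l * c0 N / L)) \<longlonglongrightarrow> - deriv F ?l * of_real (ev0 k) / L"
    using tendsto_divide[OF tendsto_const K_limit[of ?l] one_neq_zero] unfolding div_by_1 .
  have "\<forall>\<^sub>F N in sequentially. K N ?l * c0 N / L \<noteq> 0"
    using tendsto_imp_eventually_ne[OF K_limit, of 0] by simp
  then have ev: "\<forall>\<^sub>F N in sequentially. - deriv F ?l * of_real (ev0 k) / L / (K N ?l * c0 N / L) =
      (\<Prod>m\<in>{1..N}-{k}. (of_real (ev m) - ?l) / of_real (ev0 m))"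
    using eventually_ge_at_top[of k]
  proof eventually_elim
    case (elim N)
    then show ?case by (intro main[symmetric])
  qed
  show ?thesis
    by (rule Lim_transform_eventually[OF lim ev])
qed

end

context sine_type
begin

lemma kth_smallest_F0:
  assumes "k \<ge> 1"
  shows "kth_smallest {x. F0 (of_real x) = 0} k = ev0 k"
proof (rule kth_smallest_eqI)
  have less: "ev0 m < ev0 n" if "m < n" for m n
    unfolding ev0_def using L that
    by (intro power_strict_mono divide_strict_right_mono mult_strict_right_mono) auto
  have ev0_le: "ev0 m \<le> ev0 k \<longleftrightarrow> m \<le> k" for m
    using less[of m k] less[of k m] by (cases m k rule: linorder_cases) auto
  have "{m \<in> {x. F0 (of_real x) = 0}. m \<le> ev0 k} = ev0 ` {1..k}"
  proof (intro equalityI subsetI)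
    fix x assume "x \<in> {m \<in> {x. F0 (of_real x) = 0}. m \<le> ev0 k}"
    then obtain m where "m \<ge> 1" "complex_of_real x = of_real (ev0 m)" "x \<le> ev0 k"
      unfolding F0_zero_iff by blast
    then show "x \<in> ev0 ` {1..k}"
      using ev0_le[of m] by simp
  next
    fix x assume "x \<in> ev0 ` {1..k}"
    then obtain m where "m \<ge> 1" "m \<le> k" "x = ev0 m" by auto
    then show "x \<in> {m \<in> {x. F0 (of_real x) = 0}. m \<le> ev0 k}"
      using ev0_le[of m] F0_zero_iff[of "of_real x"] by blast
  qed
  moreover have "inj_on ev0 {1..k}"
    by (rule inj_on_subset[OF ev0_inj]) simp
  ultimately show "finite {m \<in> {x. F0 (of_real x) = 0}. m \<le> ev0 k}"
    "card {m \<in> {x. F0 (of_real x) = 0}. m \<le> ev0 k} = k"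
    by (simp_all add: card_image)
  show "ev0 k \<in> {x. F0 (of_real x) = 0}"
    using assms F0_zero_iff by blast
qed

end

section \<open>Dirichlet eigenvalues and eigenfunctions\<close>

lemma negligible_AE_lebesgue_on:
  assumes "AE x in lebesgue_on {a<..<b::real}. Q x"
  obtains N where "negligible N" "\<And>x. x \<in> {a<..<b} - N \<Longrightarrow> Q x"
proof -
  have "AE x in lebesgue. x \<in> {a<..<b} \<longrightarrow> Q x"
    using assms by (simp add: AE_restrict_space_iff)
  then obtain N where "N \<in> null_sets lebesgue" "{x. \<not> (x \<in> {a<..<b} \<longrightarrow> Q x)} \<subseteq> N"
    unfolding eventually_ae_filter by auto
  then show ?thesis
    by (intro that[of N]) (auto simp: negligible_iff_null_sets)
qed

lemma AE_lebesgue_on_negligible: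
  assumes "negligible N" "\<And>x. x \<in> {a<..<b::real} - N \<Longrightarrow> Q x"
  shows "AE x in lebesgue_on {a<..<b}. Q x"
proof -
  have "AE x in lebesgue. x \<in> {a<..<b} \<longrightarrow> Q x"
    by (rule AE_I'[of N]) (use assms in \<open>auto simp: negligible_iff_null_sets\<close>)
  then show ?thesis by (simp add: AE_restrict_space_iff)
qed

lemma continuous_imp_L2_on:
  assumes "continuous_on {a..b} f"
  shows "L2_on a b f"
  unfolding L2_on_def
proof
  show "f \<in> borel_measurable (lebesgue_on {a<..<b})"
    using assms by (intro continuous_imp_measurable_on_sets_lebesgue) (auto intro: continuous_on_subset)
  have "(\<lambda>x. (norm (f x))\<^sup>2) absolutely_integrable_on {a..b}"
    by (intro absolutely_integrable_continuous_real continuous_intros assms)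
  then have "(\<lambda>x. (norm (f x))\<^sup>2) absolutely_integrable_on {a<..<b}"
    by (rule set_integrable_subset) auto
  then show "integrable (lebesgue_on {a<..<b}) (\<lambda>x. (norm (f x))\<^sup>2)"
    by (simp add: integrable_restrict_space set_integrable_def)
qed

lemma L2_on_AE_cong:
  assumes "L2_on a b f" "AE x in lebesgue_on {a<..<b}. f x = g x"
  shows "L2_on a b g"
proof -
  have ae: "AE x in lebesgue. (if x \<in> {a<..<b} then f x else 0) = (if x \<in> {a<..<b} then g x else 0)"
    using assms(2) by (simp add: AE_restrict_space_iff)
  have fm: "(\<lambda>x. if x \<in> {a<..<b} then f x else 0) \<in> borel_measurable lebesgue"
    using assms(1) by (subst borel_measurable_if) (auto simp: L2_on_def)
  have "(\<lambda>x. if x \<in> {a<..<b} then g x else 0) \<in> borel_measurable lebesgue"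
    by (rule borel_measurable_AE[OF fm ae])
  then have gm: "g \<in> borel_measurable (lebesgue_on {a<..<b})"
    using borel_measurable_if[of "{a<..<b}" g] by simp
  have "integrable (lebesgue_on {a<..<b}) (\<lambda>x. (norm (g x))\<^sup>2)"
  proof (rule integrable_cong_AE_imp)
    show "integrable (lebesgue_on {a<..<b}) (\<lambda>x. (norm (f x))\<^sup>2)"
      using assms(1) by (simp add: L2_on_def)
    show "AE x in lebesgue_on {a<..<b}. (norm (f x))\<^sup>2 = (norm (g x))\<^sup>2"
      using assms(2) by eventually_elim simp
  qed (use gm in measurable)
  with gm show ?thesis by (simp add: L2_on_def)
qed

context sl_problem
begin

lemma deriv_on_eq:
  assumes "(f has_vector_derivative D) (at x within {a..b})" "x \<in> {a..b}"
  shows "deriv_on a b f x = D"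
  unfolding deriv_on_def using ab assms by (intro vector_derivative_within_closed_interval) auto

lemma ac_prim_deriv_AE:
  assumes "ac_prim a b v g"
  obtains N where "negligible N" "\<And>x. x \<in> {a<..<b} - N \<Longrightarrow> deriv_on a b v x = g x"
proof -
  have ga: "g absolutely_integrable_on {a..b}"
    using assms by (simp add: ac_prim_def)
  obtain N where N: "negligible N"
    "\<And>x. x \<in> {a<..<b} - N \<Longrightarrow> ((\<lambda>x. integral {a..x} g) has_vector_derivative g x) (at x within {a..b})"
    by (rule indefinite_integral_has_vector_derivative_AE[OF ab ga], rule that)
  have "deriv_on a b v x = g x" if x: "x \<in> {a<..<b} - N" for x
  proof (rule deriv_on_eq)
    have "((\<lambda>x. v a + integral {a..x} g) has_vector_derivative 0 + g x) (at x within {a..b})"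
      by (intro has_vector_derivative_add has_vector_derivative_const N(2) x)
    moreover have "v y = v a + integral {a..y} g" if y: "y \<in> {a..b}" for y
    proof -
      have "integral {a..y} g = v y - v a"
        using assms y by (intro integral_unique) (simp add: ac_prim_def)
      then show ?thesis by simp
    qed
    moreover have "x \<in> {a..b}" using x by auto
    ultimately have "(v has_vector_derivative 0 + g x) (at x within {a..b})"
      by (intro has_vector_derivative_transform[of x "{a..b}" v "\<lambda>x. v a + integral {a..x} g"])
    then show "(v has_vector_derivative g x) (at x within {a..b})" by simp
  qed (use x in auto)
  with N(1) show ?thesis by (rule that)
qed

text \<open>\<open>f\<close> is continuously differentiable, so only f' needs care: its density
  \<open>g\<close> is almost everywhere the derivative of f', hence by the eigenvalue equation
  almost everywhere (V - l) f, which may replace it under the integral.\<close>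

lemma eigenfunction_imp_solution:
  assumes "dirichlet_eigenfunction V a b l f"
  shows "sl_solution (pot l) a b f (deriv_on a b f)" "f a = 0" "f b = 0"
proof -
  let ?h = "deriv_on a b f"
  have dom: "\<And>x. x \<in> {a..b} \<Longrightarrow> f differentiable (at x within {a..b})" "abs_cont_on {a..b} ?h"
    "f a = 0" "f b = 0" and op: "AE x in lebesgue_on {a<..<b}. dirichlet_op V a b f x = l * f x"
    using assms by (auto simp: dirichlet_eigenfunction_def dirichlet_dom_def)
  show "f a = 0" "f b = 0" by fact+
  have ch: "continuous_on {a..b} ?h"
    by (intro uniformly_continuous_imp_continuous abs_cont_on_imp_uniformly_continuous dom)
  have "(f has_vector_derivative ?h x) (at x within {a..b})" if "x \<in> {a..b}" for x
    using dom(1)[OF that] unfolding deriv_on_def by (rule vector_derivative_works[THEN iffD1])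
  then have fh: "ac_prim a b f ?h"
    using ch by (rule ac_prim_C1)
  have cf: "continuous_on {a..b} f" by (rule ac_prim_continuous[OF fh])
  obtain g where g: "g absolutely_integrable_on {a..b}" "\<forall>x\<in>{a..b}. ?h x = ?h a + integral {a..x} g"
    using abs_cont_density[OF ab dom(2)] by blast
  have "ac_prim a b (\<lambda>x. ?h a + integral {a..x} g) g"
    by (rule ac_prim_integral[OF g(1)])
  then have hg: "ac_prim a b ?h g"
    using g(2) ab unfolding ac_prim_def by (metis atLeastAtMost_iff less_imp_le order_refl)
  obtain N1 where N1: "negligible N1" "\<And>x. x \<in> {a<..<b} - N1 \<Longrightarrow> deriv_on a b ?h x = g x"
    by (rule ac_prim_deriv_AE[OF hg], rule that)
  obtain N2 where N2: "negligible N2" "\<And>x. x \<in> {a<..<b} - N2 \<Longrightarrow> dirichlet_op V a b f x = l * f x"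
    by (rule negligible_AE_lebesgue_on[OF op], rule that)
  \<comment> \<open>The endpoints are added because the exceptional sets concern the open interval
    only.\<close>
  define N where "N = N1 \<union> N2 \<union> {a, b}"
  have N: "negligible N"
    unfolding N_def using N1(1) N2(1) by (intro negligible_Un) auto
  have eq: "pot l x * f x = g x" if "x \<in> {a..b} - N" for x
    using N1(2)[of x] N2(2)[of x] that by (auto simp: N_def dirichlet_op_def algebra_simps)
  have "ac_prim a b ?h (\<lambda>x. pot l x * f x)"
    unfolding ac_prim_def
  proof (intro conjI ballI)
    show "(\<lambda>x. pot l x * f x) absolutely_integrable_on {a..b}"
      by (rule absolutely_integrable_mult_continuous[OF pot cf])
    fix x assume x: "x \<in> {a..b}"
    show "((\<lambda>x. pot l x * f x) has_integral (?h x - ?h a)) {a..x}"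
    proof (rule has_integral_spike[OF N])
      show "(g has_integral (?h x - ?h a)) {a..x}"
        using hg x by (simp add: ac_prim_def)
      show "pot l y * f y = g y" if "y \<in> {a..x} - N" for y
        using that x by (intro eq) auto
    qed
  qed
  with fh show "sl_solution (pot l) a b f ?h"
    by (simp add: sl_solution_def)
qed

lemma solution_eq_multiple:
  assumes "sl_solution (pot l) a b f h" "f a = 0" "x \<in> {a..b}"
  shows "f x = h a * sine_sol V a b l x"
proof -
  have "sl_solution (pot l) a b (\<lambda>x. h a * sine_sol V a b l x + 0 * sine_sol V a b l x)
      (\<lambda>x. h a * dsine_sol V a b l x + 0 * dsine_sol V a b l x)"
    by (intro sl_solution_lincomb sl_sol)
  from sl_solution_unique(1)[OF pot assms(1) this _ _ assms(3)] show ?thesis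
    using assms(2) by (simp add: sl_sol)
qed

lemma eigenvalue_imp_zero:
  assumes "dirichlet_eigenfunction V a b l f"
  shows "char_fn V a b l = 0"
proof -
  note sol = eigenfunction_imp_solution[OF assms]
  let ?c = "deriv_on a b f a"
  have f: "f x = ?c * sine_sol V a b l x" if "x \<in> {a..b}" for x
    by (rule solution_eq_multiple[OF sol(1,2) that])
  have "?c \<noteq> 0"
  proof
    assume "?c = 0"
    then have "AE x in lebesgue_on {a<..<b}. f x = 0"
      using f by (intro AE_I2) auto
    then show False using assms by (simp add: dirichlet_eigenfunction_def)
  qed
  then show ?thesis
    using f[of b] sol(3) ab by (simp add: char_fn_def)
qed

lemma zero_imp_eigenfunction:
  assumes "char_fn V a b l = 0"
  shows "dirichlet_eigenfunction V a b l (sine_sol V a b l)"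
proof -
  let ?u = "sine_sol V a b l" and ?v = "dsine_sol V a b l"
  have sol: "ac_prim a b ?u ?v" "ac_prim a b ?v (\<lambda>t. pot l t * ?u t)"
    using sl_sol(1)[of l 0 1] by (auto simp: sl_solution_def)
  have cu: "continuous_on {a..b} ?u" and cv: "continuous_on {a..b} ?v"
    using sol by (auto intro: ac_prim_continuous)
  have eqv: "F x = F a + integral {a..x} f" if "ac_prim a b F f" "x \<in> {a..b}" for F f :: "real \<Rightarrow> complex" and x
    using that integral_unique[of f "F x - F a" "{a..x}"] by (simp add: ac_prim_def)
  have der: "(?u has_vector_derivative ?v x) (at x within {a..b})" if x: "x \<in> {a..b}" for x
  proof -
    have "((\<lambda>x. ?u a + integral {a..x} ?v) has_vector_derivative 0 + ?v x) (at x within {a..b})"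
      by (intro has_vector_derivative_add has_vector_derivative_const integral_has_vector_derivative cv x)
    then have "((\<lambda>x. ?u a + integral {a..x} ?v) has_vector_derivative ?v x) (at x within {a..b})"
      by simp
    then show ?thesis
      by (intro has_vector_derivative_transform[of x "{a..b}" ?u "\<lambda>x. ?u a + integral {a..x} ?v"] x eqv[OF sol(1)])
  qed
  have du: "deriv_on a b ?u x = ?v x" if "x \<in> {a..b}" for x
    by (rule deriv_on_eq[OF der[OF that] that])
  obtain N where N: "negligible N" "\<And>x. x \<in> {a<..<b} - N \<Longrightarrow> deriv_on a b ?v x = pot l x * ?u x"
    by (rule ac_prim_deriv_AE[OF sol(2)], rule that)
  have op: "AE x in lebesgue_on {a<..<b}. dirichlet_op V a b ?u x = l * ?u x"
  proof (rule AE_lebesgue_on_negligible[OF N(1)])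
    fix x assume x: "x \<in> {a<..<b} - N"
    have "deriv_on a b (deriv_on a b ?u) x = deriv_on a b ?v x"
      using du x by (intro deriv_on_cong) auto
    then show "dirichlet_op V a b ?u x = l * ?u x"
      using N(2)[OF x] by (simp add: dirichlet_op_def algebra_simps)
  qed
  have ne: "\<not> (AE x in lebesgue_on {a<..<b}. ?u x = 0)"
  proof
    assume ae: "AE x in lebesgue_on {a<..<b}. ?u x = 0"
    obtain M where M: "negligible M" "\<And>x. x \<in> {a<..<b} - M \<Longrightarrow> ?u x = 0"
      by (rule negligible_AE_lebesgue_on[OF ae], rule that)
    have "((\<lambda>t. (cmod (?u t))^2) has_integral 0) {a..b}"
    proof (rule has_integral_spike[where f = "\<lambda>_. 0"])
      show "negligible (M \<union> {a, b})" using M(1) by (intro negligible_Un) auto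
      show "(cmod (?u x))^2 = 0" if "x \<in> {a..b} - (M \<union> {a, b})" for x
        using M(2)[of x] that by auto
    qed simp
    then show False
      using integral_cmod_sine_sol_pos[of l] by (simp add: integral_unique)
  qed
  have "?u \<in> dirichlet_dom V a b"
    unfolding dirichlet_dom_def
  proof (intro CollectI conjI ballI)
    show "L2_on a b ?u" by (rule continuous_imp_L2_on[OF cu])
    show "abs_cont_on {a..b} ?u"
    proof (rule indefinite_integral_abs_cont_on[OF _ eqv[OF sol(1)]])
      show "?v absolutely_integrable_on {a..b}"
        using sol(1) by (simp add: ac_prim_def)
    qed
    show "?u differentiable (at x within {a..b})" if "x \<in> {a..b}" for x
      using der[OF that] by (rule differentiableI_vector)
    have "abs_cont_on {a..b} ?v"
    proof (rule indefinite_integral_abs_cont_on[OF _ eqv[OF sol(2)]])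
      show "(\<lambda>t. pot l t * ?u t) absolutely_integrable_on {a..b}"
        using sol(2) by (simp add: ac_prim_def)
    qed
    then show "abs_cont_on {a..b} (deriv_on a b ?u)"
      using abs_cont_on_cong[of a b "deriv_on a b ?u" ?v, OF du] by simp
    show "?u a = 0" by (simp add: sl_sol)
    show "?u b = 0" using assms by (simp add: char_fn_def)
    \<comment> \<open>For merely integrable \<open>V\<close>, neither u'' nor V u has to be square
      integrable. The operator value is, because almost everywhere it equals \<open>l\<close> times
      a continuous function.\<close>
    have "L2_on a b (\<lambda>x. l * ?u x)"
      by (intro continuous_imp_L2_on continuous_intros cu)
    moreover have "AE x in lebesgue_on {a<..<b}. l * ?u x = dirichlet_op V a b ?u x"
      using op by eventually_elim simp
    ultimately show "L2_on a b (dirichlet_op V a b ?u)"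
      by (rule L2_on_AE_cong)
  qed
  with ne op show ?thesis by (simp add: dirichlet_eigenfunction_def)
qed

lemma dirichlet_eigenvalues_eq: "dirichlet_eigenvalues V a b = {x. char_fn V a b (of_real x) = 0}"
  using eigenvalue_imp_zero zero_imp_eigenfunction by (auto simp: dirichlet_eigenvalues_def)

section \<open>Product formulas for the characteristic function\<close>

lemma sl_problem_zero: "sl_problem (\<lambda>_. 0) a b"
  using ab by unfold_locales auto

lemma sine_type_char_fn: "\<exists>C. sine_type (char_fn V a b) (char_fn (\<lambda>_. 0) a b) (b - a) C"
proof -
  interpret zero: sl_problem "\<lambda>_. 0" a b by (rule sl_problem_zero)
  obtain C where C: "C \<ge> 0" "\<And>z x. cmod z \<ge> 1 \<Longrightarrow> x \<in> {a..b} \<Longrightarrow>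
    cmod (sine_sol V a b (z^2) x - sin (z * of_real (x - a)) / z) \<le> C * exp (\<bar>Im z\<bar> * (x - a)) / (cmod z)^2"
    using sine_sol_asymptotics by blast
  have b: "b \<in> {a..b}" using ab by auto
  have sine: "char_fn (\<lambda>_. 0) a b (z^2) = sin (z * of_real (b - a)) / z" if "z \<noteq> 0" for z
  proof -
    have "((\<lambda>t::real. 0) has_integral (sine_sol (\<lambda>_. 0) a b (z^2) b - sin (z * of_real (b - a)) / z)) {a..b}"
      using zero.sine_sol_volterra[OF that b] by simp
    then show ?thesis
      by (simp add: char_fn_def)
  qed
  \<comment> \<open>The Volterra equation was derived for z \<noteq> 0, so the value at 0 is taken
    from the explicit solution t - a.\<close>
  have lin: "char_fn (\<lambda>_. 0) a b 0 = of_real (b - a)"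
  proof -
    have "sl_solution (\<lambda>_. 0) a b (\<lambda>t. complex_of_real (t - a)) (\<lambda>_. 1)"
      unfolding sl_solution_def
    proof (intro conjI ac_prim_C1)
      fix t :: real
      show "((\<lambda>t. complex_of_real (t - a)) has_vector_derivative 1) (at t within {a..b})"
        by (auto intro!: derivative_eq_intros simp: has_vector_derivative_def scaleR_conv_of_real)
    qed auto
    then have "sl_solution (\<lambda>t. complex_of_real 0 - 0) a b (\<lambda>t. complex_of_real (t - a)) (\<lambda>_. 1)"
      by simp
    from zero.sl_sol_unique(1)[OF this _ _ b, of 0 1] show ?thesis
      by (simp add: char_fn_def)
  qed
  have "sine_type (char_fn V a b) (char_fn (\<lambda>_. 0) a b) (b - a) C"
  proof
    show "cmod (char_fn V a b (z^2) - sin (z * complex_of_real (b - a)) / z) \<le> C * exp (\<bar>Im z\<bar> * (b - a)) / (cmod z)^2"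
      if "cmod z \<ge> 1" for z
      using C(2)[OF that b] by (simp add: char_fn_def)
  qed (use ab C sine lin char_fn_zero_real char_fn_zero_simple(2) zero.char_fn_zero_simple(2)
      char_fn_holomorphic zero.char_fn_holomorphic in auto)
  then show ?thesis by blast
qed

lemma dirichlet_ev_zero:
  assumes "k \<ge> 1"
  shows "dirichlet_ev (\<lambda>_. 0) a b k = (real k * pi / (b - a))^2"
proof -
  interpret zero: sl_problem "\<lambda>_. 0" a b by (rule sl_problem_zero)
  obtain C where "sine_type (char_fn V a b) (char_fn (\<lambda>_. 0) a b) (b - a) C"
    using sine_type_char_fn by blast
  then interpret st: sine_type "char_fn V a b" "char_fn (\<lambda>_. 0) a b" "b - a" C .
  show ?thesis
    using st.kth_smallest_F0[OF assms] unfolding dirichlet_ev_def zero.dirichlet_eigenvalues_eq st.ev0_def .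
qed

text \<open>The characteristic function is complex-valued while the partial products are real: the
  imaginary part of the limit is a limit of zeros, so the formula descends to the reals.\<close>

lemma char_fn_product:
  "\<exists>p. (\<lambda>N. \<Prod>m\<in>{1..N}. (dirichlet_ev V a b m - x) / dirichlet_ev (\<lambda>_. 0) a b m) \<longlonglongrightarrow> p \<and>
    of_real p = char_fn V a b (of_real x) / of_real (b - a)"
proof -
  obtain C where "sine_type (char_fn V a b) (char_fn (\<lambda>_. 0) a b) (b - a) C"
    using sine_type_char_fn by blast
  then interpret st: sine_type "char_fn V a b" "char_fn (\<lambda>_. 0) a b" "b - a" C .
  have ev: "st.ev = dirichlet_ev V a b"
    unfolding st.ev_def st.zeros_def dirichlet_ev_def[abs_def] dirichlet_eigenvalues_eq ..
  have ev0: "st.ev0 m = dirichlet_ev (\<lambda>_. 0) a b m" if "m \<ge> 1" for m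
    using dirichlet_ev_zero[of m] that by (simp add: st.ev0_def)
  let ?q = "\<lambda>N. \<Prod>m\<in>{1..N}. (dirichlet_ev V a b m - x) / dirichlet_ev (\<lambda>_. 0) a b m"
  have eq: "(\<Prod>m\<in>{1..N}. (complex_of_real (st.ev m) - of_real x) / of_real (st.ev0 m)) = of_real (?q N)" for N
    unfolding of_real_prod ev by (intro prod.cong refl) (simp add: ev0)
  have "(\<lambda>N. complex_of_real (?q N)) \<longlonglongrightarrow> char_fn V a b (of_real x) / of_real (b - a)"
    using st.product_formula[of "of_real x"] unfolding eq .
  from tendsto_Re[OF this] tendsto_Im[OF this]
  have "?q \<longlonglongrightarrow> Re (char_fn V a b (of_real x) / of_real (b - a))"
    "(\<lambda>N. 0::real) \<longlonglongrightarrow> Im (char_fn V a b (of_real x) / of_real (b - a))"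
    by (simp_all only: Re_complex_of_real Im_complex_of_real)
  moreover from this(2) have "Im (char_fn V a b (of_real x) / of_real (b - a)) = 0"
    by (metis LIMSEQ_unique tendsto_const)
  ultimately show ?thesis
    by (intro exI[of _ "Re (char_fn V a b (of_real x) / of_real (b - a))"]) (simp add: complex_eq_iff)
qed

lemma char_fn_product_deriv:
  assumes k: "k \<ge> 1"
  shows "\<exists>p. (\<lambda>N. \<Prod>m\<in>{1..N}-{k}. (dirichlet_ev V a b m - dirichlet_ev V a b k) / dirichlet_ev (\<lambda>_. 0) a b m) \<longlonglongrightarrow> p \<and>
    of_real p = - deriv (char_fn V a b) (of_real (dirichlet_ev V a b k)) * of_real (dirichlet_ev (\<lambda>_. 0) a b k) / of_real (b - a)"
    (is "\<exists>p. ?q \<longlonglongrightarrow> p \<and> of_real p = ?r")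
    and "char_fn V a b (of_real (dirichlet_ev V a b k)) = 0"
proof -
  obtain C where "sine_type (char_fn V a b) (char_fn (\<lambda>_. 0) a b) (b - a) C"
    using sine_type_char_fn by blast
  then interpret st: sine_type "char_fn V a b" "char_fn (\<lambda>_. 0) a b" "b - a" C .
  have ev: "st.ev = dirichlet_ev V a b"
    unfolding st.ev_def st.zeros_def dirichlet_ev_def[abs_def] dirichlet_eigenvalues_eq ..
  have ev0: "st.ev0 m = dirichlet_ev (\<lambda>_. 0) a b m" if "m \<ge> 1" for m
    using dirichlet_ev_zero[of m] that by (simp add: st.ev0_def)
  have eq: "(\<Prod>m\<in>{1..N}-{k}. (complex_of_real (st.ev m) - of_real (st.ev k)) / of_real (st.ev0 m)) = of_real (?q N)" for N
    unfolding of_real_prod ev by (intro prod.cong refl) (simp add: ev0)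
  have "(\<lambda>N. complex_of_real (?q N)) \<longlonglongrightarrow> ?r"
    using st.product_formula_deriv[OF k, unfolded eq, unfolded ev ev0[OF k]] .
  from tendsto_Re[OF this] tendsto_Im[OF this]
  have "?q \<longlonglongrightarrow> Re ?r" "(\<lambda>N. 0::real) \<longlonglongrightarrow> Im ?r"
    by (simp_all only: Re_complex_of_real Im_complex_of_real)
  moreover from this(2) have "Im ?r = 0"
    by (metis LIMSEQ_unique tendsto_const)
  ultimately show "\<exists>p. ?q \<longlonglongrightarrow> p \<and> of_real p = ?r"
    by (intro exI[of _ "Re ?r"]) (simp only: complex_eq_iff Re_complex_of_real Im_complex_of_real simp_thms)
  show "char_fn V a b (of_real (dirichlet_ev V a b k)) = 0"
    using st.ev_zero[OF k] by (simp add: ev)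
qed

lemma char_fn_left:
  assumes "x0 \<in> {a<..<b}"
  shows "char_fn V a x0 l = sine_sol V a b l x0"
proof -
  interpret left: sl_problem V a x0
    using assms V by unfold_locales (auto intro: set_integrable_subset)
  have "sl_solution (pot l) a x0 (sine_sol V a b l) (dsine_sol V a b l)"
    using assms by (intro sl_solution_subinterval[OF sl_sol(1)]) auto
  from left.sl_sol_unique(1)[OF this, of 0 1 x0] show ?thesis
    using assms by (simp add: char_fn_def sl_sol)
qed

text \<open>The combination of the sine and cosine solutions with coefficients \<open>?c\<close> and
  \<open>?d\<close> vanishes at \<open>x0\<close> and has slope 1 there by the Wronskian, so it is
  the sine solution of (x0, b). At an eigenvalue of the whole interval the first term drops
  out.\<close>

lemma char_fn_right:
  assumes x0: "x0 \<in> {a<..<b}"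
  shows "char_fn V x0 b l = cosine_sol V a b l x0 * char_fn V a b l - sine_sol V a b l x0 * cosine_sol V a b l b"
proof -
  interpret right: sl_problem V x0 b
    using assms V by unfold_locales (auto intro: set_integrable_subset)
  let ?c = "cosine_sol V a b l x0" and ?d = "- sine_sol V a b l x0"
  have sol: "sl_solution (pot l) x0 b (\<lambda>x. ?c * sine_sol V a b l x + ?d * cosine_sol V a b l x)
      (\<lambda>x. ?c * dsine_sol V a b l x + ?d * dcosine_sol V a b l x)"
    using x0 by (intro sl_solution_lincomb sl_solution_subinterval[OF sl_sol(1)]) auto
  have "?c * dsine_sol V a b l x0 + ?d * dcosine_sol V a b l x0 = 1"
    using wronskian[of x0 l] x0 by (simp add: algebra_simps)
  then have "?c * sine_sol V a b l b + ?d * cosine_sol V a b l b = sine_sol V x0 b l b"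
    using x0 by (intro right.sl_sol_unique(1)[OF sol]) auto
  then show ?thesis by (simp add: char_fn_def)
qed

end

section \<open>Interleaving the two half intervals, and the trace formula for the
  eigenfunction\<close>

lemma prod_interleave:
  fixes p q :: "nat \<Rightarrow> real"
  shows "(\<Prod>j\<in>{1..n}. if even j then p (j div 2) else q ((j + 1) div 2)) =
    (\<Prod>m\<in>{1..n div 2}. p m) * (\<Prod>m\<in>{1..(n + 1) div 2}. q m)"
proof (induction n)
  case (Suc n)
  show ?case
  proof (cases "even n")
    case True
    then have "Suc n div 2 = n div 2" "(Suc n + 1) div 2 = Suc ((n + 1) div 2)"
      by (auto elim!: evenE)
    then show ?thesis using Suc True by simp
  next
    case False
    then have "Suc n div 2 = Suc (n div 2)" "(Suc n + 1) div 2 = (n + 1) div 2"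
      by (auto elim!: oddE)
    then show ?thesis using Suc False by simp
  qed
qed simp

text \<open>An interleaved partial product is a partial product of \<open>p\<close> times one of
  \<open>q\<close>, of lengths n div 2 and (n + 1) div 2. Both lengths tend to infinity, so
  convergence carries over even when a limit is 0.\<close>

lemma tendsto_prod_interleave:
  fixes p q :: "nat \<Rightarrow> real"
  assumes "(\<lambda>n. \<Prod>m\<in>{1..n}. p m) \<longlonglongrightarrow> P" "(\<lambda>n. \<Prod>m\<in>{1..n}. q m) \<longlonglongrightarrow> Q"
  shows "(\<lambda>n. \<Prod>j\<in>{1..n}. if even j then p (j div 2) else q ((j + 1) div 2)) \<longlonglongrightarrow> P * Q"
proof -
  have half: "filterlim (\<lambda>n. (n + i) div 2) sequentially sequentially" for i :: nat
    unfolding filterlim_at_top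
  proof
    fix Z :: nat
    show "\<forall>\<^sub>F n in sequentially. Z \<le> (n + i) div 2"
      using eventually_ge_at_top[of "2 * Z"] by eventually_elim linarith
  qed
  have "(\<lambda>n. \<Prod>m\<in>{1..(n + 0) div 2}. p m) \<longlonglongrightarrow> P"
    by (rule filterlim_compose[OF assms(1) half])
  moreover have "(\<lambda>n. \<Prod>m\<in>{1..(n + 1) div 2}. q m) \<longlonglongrightarrow> Q"
    by (rule filterlim_compose[OF assms(2) half])
  ultimately show ?thesis
    unfolding prod_interleave add_0_right by (rule tendsto_mult)
qed

text \<open>The limits are asserted to exist, and \<open>Q \<noteq> 0\<close> is part of the
  conclusion because division is total and the quotient would otherwise lack its meaning.\<close>

theorem theorem2p4:
  fixes a b x0 :: real and V e :: "real \<Rightarrow> real" and k :: nat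
  assumes "a < b"
    and "V absolutely_integrable_on {a<..<b}"
    and "x0 \<in> {a<..<b}"
    and "k \<ge> 1"
    and "normalized_eigenfunction V a b k e"
  shows "\<exists>P Q.
    (\<lambda>n. \<Prod>j\<in>{1..n}. (split_ev V a x0 b j - dirichlet_ev V a b k) / split_ev (\<lambda>_. 0) a x0 b j)
      \<longlonglongrightarrow> P \<and>
    (\<lambda>n. \<Prod>m\<in>{1..n} - {k}. (dirichlet_ev V a b m - dirichlet_ev V a b k) / dirichlet_ev (\<lambda>_. 0) a b m)
      \<longlonglongrightarrow> Q \<and>
    Q \<noteq> 0 \<and>
    (e x0)\<^sup>2 = (x0 - a) * (b - x0) / (b - a) * dirichlet_ev (\<lambda>_. 0) a b k * (P / Q)"
proof -
  have V: "V absolutely_integrable_on {a..b}"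
    using assms(2) absolutely_integrable_on_open_interval[of a b V] by simp
  have ax: "a < x0" "x0 < b" using assms(3) by auto
  interpret whole: sl_problem V a b
    using assms(1) V by unfold_locales
  interpret left: sl_problem V a x0
    using ax V by unfold_locales (auto intro: set_integrable_subset)
  interpret right: sl_problem V x0 b
    using ax V by unfold_locales (auto intro: set_integrable_subset)
  define l where "l = dirichlet_ev V a b k"
  define l0 where "l0 = dirichlet_ev (\<lambda>_. 0) a b k"
  let ?u = "sine_sol V a b (of_real l)" and ?t = "cosine_sol V a b (of_real l) b"
  define I where "I = integral {a..b} (\<lambda>t. (?u t)^2)"
  have zero: "char_fn V a b (of_real l) = 0"
    using whole.char_fn_product_deriv(2)[OF assms(4)] by (simp add: l_def)
  have I: "I \<noteq> 0"
    unfolding I_def by (rule whole.char_fn_zero_simple(1)[OF zero])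
  have t: "?t \<noteq> 0"
    using whole.wronskian[of b "of_real l"] assms(1) zero by (auto simp: char_fn_def)
  have l0: "l0 \<noteq> 0"
    using whole.dirichlet_ev_zero[OF assms(4)] assms(1,4) by (simp add: l0_def)
  obtain Q where Q: "(\<lambda>n. \<Prod>m\<in>{1..n} - {k}. (dirichlet_ev V a b m - l) / dirichlet_ev (\<lambda>_. 0) a b m) \<longlonglongrightarrow> Q"
    "complex_of_real Q = - (?t * I) * of_real l0 / of_real (b - a)"
    using whole.char_fn_product_deriv(1)[OF assms(4)] whole.char_fn_deriv_at_zero[OF zero]
    unfolding l_def[symmetric] l0_def[symmetric] I_def[symmetric] by metis
  obtain P1 where P1: "(\<lambda>n. \<Prod>m\<in>{1..n}. (dirichlet_ev V a x0 m - l) / dirichlet_ev (\<lambda>_. 0) a x0 m) \<longlonglongrightarrow> P1"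
    "complex_of_real P1 = ?u x0 / of_real (x0 - a)"
    using left.char_fn_product[of l] unfolding whole.char_fn_left[OF assms(3)] by blast
  obtain P2 where P2: "(\<lambda>n. \<Prod>m\<in>{1..n}. (dirichlet_ev V x0 b m - l) / dirichlet_ev (\<lambda>_. 0) x0 b m) \<longlonglongrightarrow> P2"
    "complex_of_real P2 = - (?u x0 * ?t) / of_real (b - x0)"
    using right.char_fn_product[of l] unfolding whole.char_fn_right[OF assms(3)] zero mult_zero_right diff_0 by blast
  have split: "(split_ev V a x0 b j - l) / split_ev (\<lambda>_. 0) a x0 b j =
      (if even j then (dirichlet_ev V a x0 (j div 2) - l) / dirichlet_ev (\<lambda>_. 0) a x0 (j div 2)
       else (dirichlet_ev V x0 b ((j + 1) div 2) - l) / dirichlet_ev (\<lambda>_. 0) x0 b ((j + 1) div 2))" for j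
    by (simp add: split_ev_def)
  have P: "(\<lambda>n. \<Prod>j\<in>{1..n}. (split_ev V a x0 b j - l) / split_ev (\<lambda>_. 0) a x0 b j) \<longlonglongrightarrow> P1 * P2"
    unfolding split by (rule tendsto_prod_interleave[OF P1(1) P2(1)])
  have "complex_of_real Q \<noteq> 0"
    unfolding Q(2) using I t l0 assms(1) by simp
  then have Q0: "Q \<noteq> 0" by simp
  have eig: "dirichlet_eigenfunction V a b (of_real l) (\<lambda>x. of_real (e x))"
    and norm: "integral {a..b} (\<lambda>x. (e x)\<^sup>2) = 1"
    using assms(5) by (auto simp: normalized_eigenfunction_def l_def)
  define c where "c = deriv_on a b (\<lambda>x. complex_of_real (e x)) a"
  have e: "complex_of_real (e x) = c * ?u x" if "x \<in> {a..b}" for x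
    unfolding c_def
    by (rule whole.solution_eq_multiple[OF whole.eigenfunction_imp_solution(1,2)[OF eig] that])
  \<comment> \<open>The integral of a nonintegrable function is 0 by default, so the value 1 already
    implies integrability.\<close>
  have "(\<lambda>x. (e x)\<^sup>2) integrable_on {a..b}"
    using norm not_integrable_integral by force
  then have "((\<lambda>x. complex_of_real ((e x)\<^sup>2)) has_integral of_real 1) {a..b}"
    unfolding norm[symmetric] by (intro has_integral_of_real integrable_integral)
  moreover have "complex_of_real ((e x)\<^sup>2) = c^2 * (?u x)^2" if "x \<in> {a..b}" for x
    using e[OF that] by (simp add: power_mult_distrib)
  ultimately have "((\<lambda>x. c^2 * (?u x)^2) has_integral of_real 1) {a..b}"
    by (rule has_integral_eq[rotated])
  then have "integral {a..b} (\<lambda>x. c^2 * (?u x)^2) = of_real 1"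
    by (rule integral_unique)
  then have cI: "c^2 * I = 1"
    unfolding I_def by simp
  have "complex_of_real ((e x0)\<^sup>2) = c^2 * (?u x0)^2"
    using e[of x0] ax by (simp add: power_mult_distrib)
  also have "\<dots> = (?u x0)^2 / I"
    using cI I by (simp add: field_simps)
  also have "\<dots> = of_real ((x0 - a) * (b - x0) / (b - a) * l0 * (P1 * P2 / Q))"
  proof -
    \<comment> \<open>\<open>t\<close> and \<open>m\<close> occur in numerator and denominator and
      cancel, as do the three lengths and the two minus signs, leaving u^2 / i.\<close>
    have "(x - a') * (b' - x) / (b' - a') * m * ((u / (x - a')) * (- (u * t) / (b' - x)) / (- (t * i) * m / (b' - a'))) = u^2 / i"
      if "x - a' \<noteq> 0" "b' - x \<noteq> 0" "b' - a' \<noteq> 0" "m \<noteq> 0" "t \<noteq> 0" "i \<noteq> 0" for x a' b' m u t i :: complex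
      using that by (simp add: power2_eq_square)
    from this[of "of_real x0" "of_real a" "of_real b" "of_real l0" ?t I "?u x0"] show ?thesis
      using ax assms(1) l0 t I by (simp add: P1(2) P2(2) Q(2))
  qed
  finally have "(e x0)\<^sup>2 = (x0 - a) * (b - x0) / (b - a) * l0 * (P1 * P2 / Q)"
    by (simp only: of_real_eq_iff)
  with P Q(1) Q0 show ?thesis
    unfolding l_def[symmetric] l0_def[symmetric] by blast
qed

end
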